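(* Let $n\ge 2$ and let $I$ be an inner function in $\mathbb{D}^n$. For each $\alpha\in\mathbb{T}$, the map $T_\alpha$, defined on the reproducing kernels $K_w$, $w\in\mathbb{D}^n$, of $I^*(H^2)$ by \[ (T_\alpha K_w)(\xi)=\bigl(1-\alpha\overline{I(w)}\bigr)\,C(\xi,w)=\frac{1-\alpha\overline{I(w)}}{\prod_{j=1}^n(1-\xi_j\overline{w_j})},\qquad \xi\in\mathbb{T}^n, \] has a unique extension to an isometric (linear) operator from $I^*(H^2)$ into $L^2(\sigma_\alpha)$, where $\sigma_\alpha=\sigma_\alpha[I]$ is the Clark measure of $I$.
   Context: $\mathbb{D}$ is the open unit disc of $\mathbb{C}$ and $\mathbb{T}=\partial\mathbb{D}$. $m_n$ is the normalized Lebesgue measure on $\mathbb{T}^n$. Cauchy kernel: $C(z,\zeta)=\prod_{j=1}^n\frac{1}{1-z_j\overline{\zeta_j}}$ (used whenever the product makes sense, in particular if one of $z,\zeta$ lies in $\mathbb{D}^n$ and the other in $\mathbb{D}^n\cup\mathbb{T}^n$). Poisson kernel: $P(z,\zeta)=\frac{C(z,\zeta)C(\zeta,z)}{C(z,z)}=\prod_{j=1}^n\frac{1-|z_j|^2}{|1-z_j\overline{\zeta_j}|^2}$, $z\in\mathbb{D}^n$, $\zeta\in\mathbb{T}^n$; $P[\mu](z)=\int_{\mathbb{T}^n}P(z,\zeta)\,d\mu(\zeta)$ for a complex Borel measure $\mu$ on $\mathbb{T}^n$. A holomorphic function $I:\mathbb{D}^n\to\mathbb{D}$ is inner if $|I(\zeta)|=1$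 for $m_n$-a.e. $\zeta\in\mathbb{T}^n$, where $I(\zeta)=\lim_{r\to1-}I(r\zeta)$ (the limit exists $m_n$-a.e.). Clark measure: for $\alpha\in\mathbb{T}$, $\sigma_\alpha[I]$ is the unique positive Borel measure on $\mathbb{T}^n$ such that $P[\sigma_\alpha[I]](z)=\mathrm{Re}\left(\frac{\alpha+I(z)}{\alpha-I(z)}\right)$, $z\in\mathbb{D}^n$. $H^2$ is the Hardy space of the polydisc: holomorphic $f$ on $\mathbb{D}^n$ with $\sup_{0<r<1}\int_{\mathbb{T}^n}|f(r\zeta)|^2\,dm_n(\zeta)<\infty$, identified with the space of boundary values, a closed subspace of $L^2(\mathbb{T}^n,m_n)$. $I^*(H^2)=H^2\ominus IH^2$ is the orthogonal complement of $IH^2$ in $H^2$. Its reproducing kernel is $K(z,w)=(1-I(z)\overline{I(w)})\,C(z,w)$, $z,w\in\mathbb{D}^n$, and $K_w(z)=K(z,w)$. *)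

theory Defs
  imports "HOL-Analysis.Analysis"
begin

definition polydisc :: "(complex^'n) set" where
  "polydisc = {z. \<forall>j. norm (z $ j) < 1}"

definition torus :: "(complex^'n) set" where
  "torus = {\<zeta>. \<forall>j. norm (\<zeta> $ j) = 1}"

text \<open>Normalized Lebesgue measure on the torus: the image of the uniform distribution on
  the cube \<open>[0, 2\<pi>]\<^sup>n\<close> under \<open>t \<mapsto> (exp (\<i> t\<^sub>j))\<^sub>j\<close>.\<close>

definition torus_measure :: "(complex^'n) measure" where
  "torus_measure =
     distr (uniform_measure lborel (cbox 0 (\<chi> j. 2 * pi) :: (real^'n) set))
       (restrict_space borel torus) (\<lambda>t. \<chi> j. cis (t $ j))"

text \<open>Holomorphy in several variables: at every point of the (open) set there is a Frechet
  derivative, and it is complex linear.\<close>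

definition holomorphic_several_on :: "(complex^'n \<Rightarrow> complex) \<Rightarrow> (complex^'n) set \<Rightarrow> bool" where
  "holomorphic_several_on f S \<longleftrightarrow>
     (\<forall>z\<in>S. \<exists>f'. (f has_derivative f') (at z) \<and> (\<forall>c v. f' (c *s v) = c * f' v))"

definition cauchy_kernel :: "complex^'n \<Rightarrow> complex^'n \<Rightarrow> complex" where
  "cauchy_kernel z \<zeta> = (\<Prod>j\<in>UNIV. 1 / (1 - z $ j * cnj (\<zeta> $ j)))"

definition poisson_kernel :: "complex^'n \<Rightarrow> complex^'n \<Rightarrow> real" where
  "poisson_kernel z \<zeta> =
     (\<Prod>j\<in>UNIV. (1 - (norm (z $ j))\<^sup>2) / (norm (1 - z $ j * cnj (\<zeta> $ j)))\<^sup>2)"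

definition poisson_integral :: "(complex^'n) measure \<Rightarrow> complex^'n \<Rightarrow> real" where
  "poisson_integral \<mu> z = (\<integral>\<zeta>. poisson_kernel z \<zeta> \<partial>\<mu>)"

definition inner_function :: "(complex^'n \<Rightarrow> complex) \<Rightarrow> bool" where
  "inner_function I \<longleftrightarrow>
     holomorphic_several_on I polydisc \<and>
     (\<forall>z\<in>polydisc. norm (I z) < 1) \<and>
     (AE \<zeta> in torus_measure. \<exists>l. ((\<lambda>r. I (r *\<^sub>R \<zeta>)) \<longlongrightarrow> l) (at_left 1) \<and> norm l = 1)"

text \<open>The Poisson integrals of a measure determine it, so at most one \<open>\<sigma>\<close> satisfies this.\<close>

definition is_clark_measure ::
    "(complex^'n \<Rightarrow> complex) \<Rightarrow> complex \<Rightarrow> (complex^'n) measure \<Rightarrow> bool" where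
  "is_clark_measure I \<alpha> \<sigma> \<longleftrightarrow>
     sets \<sigma> = sets (restrict_space borel torus) \<and> finite_measure \<sigma> \<and>
     (\<forall>z\<in>polydisc. poisson_integral \<sigma> z = Re ((\<alpha> + I z) / (\<alpha> - I z)))"

text \<open>Square integrable functions and their norm and inner product. Elements of the space
  \<open>L\<^sup>2(M)\<close> are represented by functions, and equality in \<open>L\<^sup>2(M)\<close> is equality almost
  everywhere.\<close>

definition L2_functions :: "'a measure \<Rightarrow> ('a \<Rightarrow> complex) set" where
  "L2_functions M = {f \<in> borel_measurable M. integrable M (\<lambda>x. (norm (f x))\<^sup>2)}"

definition L2_norm :: "'a measure \<Rightarrow> ('a \<Rightarrow> complex) \<Rightarrow> real" where
  "L2_norm M f = sqrt (\<integral>x. (norm (f x))\<^sup>2 \<partial>M)"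

definition L2_inner :: "'a measure \<Rightarrow> ('a \<Rightarrow> complex) \<Rightarrow> ('a \<Rightarrow> complex) \<Rightarrow> complex" where
  "L2_inner M f g = (\<integral>x. f x * cnj (g x) \<partial>M)"

definition boundary_value :: "(complex^'n \<Rightarrow> complex) \<Rightarrow> complex^'n \<Rightarrow> complex" where
  "boundary_value f \<zeta> = Lim (at_left 1) (\<lambda>r. f (r *\<^sub>R \<zeta>))"

text \<open>Only the values of \<open>f\<close> on the polydisc matter here: functions that agree there have the
  same boundary values on the torus and represent the same element of \<open>H\<^sup>2\<close>.\<close>

definition hardy_space :: "(complex^'n \<Rightarrow> complex) set" where
  "hardy_space =
     {f. holomorphic_several_on f polydisc \<and>
         bdd_above ((\<lambda>r. \<integral>\<zeta>. (norm (f (r *\<^sub>R \<zeta>)))\<^sup>2 \<partial>torus_measure) ` {0<..<1})}"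

definition hardy_norm :: "(complex^'n \<Rightarrow> complex) \<Rightarrow> real" where
  "hardy_norm f = L2_norm torus_measure (boundary_value f)"

definition hardy_inner :: "(complex^'n \<Rightarrow> complex) \<Rightarrow> (complex^'n \<Rightarrow> complex) \<Rightarrow> complex" where
  "hardy_inner f g = L2_inner torus_measure (boundary_value f) (boundary_value g)"

text \<open>The space \<open>I\<^sup>*(H\<^sup>2) = H\<^sup>2 \<ominus> I H\<^sup>2\<close> and its reproducing kernel.\<close>

definition model_space :: "(complex^'n \<Rightarrow> complex) \<Rightarrow> (complex^'n \<Rightarrow> complex) set" where
  "model_space I = {f \<in> hardy_space. \<forall>g\<in>hardy_space. hardy_inner f (\<lambda>z. I z * g z) = 0}"

definition model_kernel :: "(complex^'n \<Rightarrow> complex) \<Rightarrow> complex^'n \<Rightarrow> complex^'n \<Rightarrow> complex" where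
  "model_kernel I w = (\<lambda>z. (1 - I z * cnj (I w)) * cauchy_kernel z w)"

text \<open>Linearity is required in \<open>L\<^sup>2(\<sigma>)\<close>, that is, up to null sets. Together with isometry it
  forces \<open>T f = T g\<close> in \<open>L\<^sup>2(\<sigma>)\<close> for \<open>f\<close>, \<open>g\<close> that agree on the polydisc.\<close>

definition isometric_operator_into_L2 ::
    "(complex^'n \<Rightarrow> complex) set \<Rightarrow> (complex^'n) measure \<Rightarrow>
     ((complex^'n \<Rightarrow> complex) \<Rightarrow> complex^'n \<Rightarrow> complex) \<Rightarrow> bool" where
  "isometric_operator_into_L2 V \<sigma> T \<longleftrightarrow>
     (\<forall>f\<in>V. T f \<in> L2_functions \<sigma>) \<and>
     (\<forall>f\<in>V. \<forall>g\<in>V. AE \<xi> in \<sigma>. T (\<lambda>z. f z + g z) \<xi> = T f \<xi> + T g \<xi>) \<and>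
     (\<forall>c. \<forall>f\<in>V. AE \<xi> in \<sigma>. T (\<lambda>z. c * f z) \<xi> = c * T f \<xi>) \<and>
     (\<forall>f\<in>V. L2_norm \<sigma> (T f) = hardy_norm f)"

definition extends_kernel_map ::
    "(complex^'n \<Rightarrow> complex) \<Rightarrow> complex \<Rightarrow> (complex^'n) measure \<Rightarrow>
     ((complex^'n \<Rightarrow> complex) \<Rightarrow> complex^'n \<Rightarrow> complex) \<Rightarrow> bool" where
  "extends_kernel_map I \<alpha> \<sigma> T \<longleftrightarrow>
     (\<forall>w\<in>polydisc. AE \<xi> in \<sigma>.
        T (model_kernel I w) \<xi> = (1 - \<alpha> * cnj (I w)) * cauchy_kernel \<xi> w)"

end

theory Submission
  imports Defs "HOL-Complex_Analysis.Complex_Analysis"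
begin

text \<open>
  On the kernels the map is isometric: \<open>\<langle>K\<^sub>v, K\<^sub>w\<rangle> = K\<^sub>v(w)\<close>, while the inner product of the images in
  \<open>L\<^sup>2(\<sigma>)\<close> is a multiple of \<open>\<integral> C(w,\<xi>) C(\<xi>,v) d\<sigma>(\<xi>)\<close>, which for \<open>v = w\<close> is read off from the Poisson
  integral of \<open>\<sigma>\<close> and for general \<open>v, w\<close> follows by polarization. Since the kernels span a dense
  subspace of the model space, the map extends uniquely.

  The analytic input is that functions in \<open>H\<^sup>2\<close> have radial limits almost everywhere and that their
  dilates converge to them in \<open>L\<^sup>2\<close>. Convergence in \<open>L\<^sup>2\<close> only needs that the dilations are given by the
  symmetric Markov semigroup \<open>A\<^sub>r\<close> of Poisson kernels, \<open>A\<^sub>r A\<^sub>s = A\<^sub>r\<^sub>s\<close>. Almost everywhere convergence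
  follows from a maximal inequality, which the kernel bound \<open>A\<^sub>r\<^sub>s \<le> C (A\<^sub>r + A\<^sub>s)\<close> gives without any
  covering argument.
\<close>

text \<open>Formally the map replaces I(\<xi>) by \<alpha> in K_w(\<xi>). The obstacle is that the
  two sides carry different data: inner products in H^2 are integrals of radial limits, which must
  first be shown to exist almost everywhere, while \<sigma> is known only through its Poisson
  integrals, that is, through diagonal values of the integrals of C(z,\<xi>) C(\<xi>,w). These are
  holomorphic in z and antiholomorphic in w, and such functions are determined on the diagonal.

  All coordinates are dilated by the same r. Hence the Poisson kernels form a single one-parameter
  semigroup, a product of circle semigroups, and the kernel bound follows coordinate by coordinate
  from the smaller of the two radii. The semigroup also gives <f_r, A_q A_q f_r> = |A_q f_r|^2, so
  that increments of the dilates are controlled by increments of their norms, which are monotone and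
  bounded.

  Equality in L^2(\<sigma>) holds only up to null sets. The operator is therefore built as a
  relation between functions, the closure of the graph on kernel combinations, and values are chosen
  only at the end.\<close>

no_notation fps_nth (infixl "$" 75)

section \<open>Square integrable functions\<close>

lemma measurable_cnj [measurable]: "cnj \<in> borel_measurable borel"
  by (intro borel_measurable_continuous_onI continuous_intros)

lemma L2_functionsD:
  assumes "f \<in> L2_functions M"
  shows "f \<in> borel_measurable M" "integrable M (\<lambda>x. (norm (f x))\<^sup>2)"
  using assms by (auto simp: L2_functions_def)

lemma L2_mult_integrable:
  assumes "f \<in> L2_functions M" "g \<in> L2_functions M"
  shows "integrable M (\<lambda>x. f x * cnj (g x))"
proof (rule Bochner_Integration.integrable_bound)
  note [measurable] = L2_functionsD(1)[OF assms(1)] L2_functionsD(1)[OF assms(2)]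
  show "integrable M (\<lambda>x. (norm (f x))\<^sup>2 + (norm (g x))\<^sup>2)"
    using L2_functionsD(2)[OF assms(1)] L2_functionsD(2)[OF assms(2)] by simp
  show "(\<lambda>x. f x * cnj (g x)) \<in> borel_measurable M" by measurable
  have "norm (f x) * norm (g x) \<le> (norm (f x))\<^sup>2 + (norm (g x))\<^sup>2" for x
    using sum_squares_bound[of "norm (f x)" "norm (g x)"] mult_nonneg_nonneg[OF norm_ge_zero[of "f x"] norm_ge_zero[of "g x"]]
    by linarith
  then show "AE x in M. norm (f x * cnj (g x)) \<le> norm ((norm (f x))\<^sup>2 + (norm (g x))\<^sup>2)"
    by (simp add: norm_mult)
qed

lemma L2_add:
  assumes "f \<in> L2_functions M" "g \<in> L2_functions M"
  shows "(\<lambda>x. f x + g x) \<in> L2_functions M"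
proof -
  note [measurable] = L2_functionsD(1)[OF assms(1)] L2_functionsD(1)[OF assms(2)]
  have *: "(norm (a + b))\<^sup>2 \<le> 2 * (norm a)\<^sup>2 + 2 * (norm b)\<^sup>2" for a b :: complex
  proof -
    have "(norm (a + b))\<^sup>2 \<le> (norm a + norm b)\<^sup>2"
      by (intro power_mono norm_triangle_ineq) simp
    also have "\<dots> \<le> 2 * (norm a)\<^sup>2 + 2 * (norm b)\<^sup>2"
      using sum_squares_bound[of "norm a" "norm b"] by (simp add: power2_sum)
    finally show ?thesis .
  qed
  have "integrable M (\<lambda>x. 2 * (norm (f x))\<^sup>2 + 2 * (norm (g x))\<^sup>2)"
    using L2_functionsD(2)[OF assms(1)] L2_functionsD(2)[OF assms(2)] by simp
  then have "integrable M (\<lambda>x. (norm (f x + g x))\<^sup>2)"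
    by (rule Bochner_Integration.integrable_bound) (use * in \<open>auto intro!: AE_I2\<close>)
  then show ?thesis
    by (simp add: L2_functions_def)
qed

lemma L2_cmult:
  assumes "f \<in> L2_functions M"
  shows "(\<lambda>x. c * f x) \<in> L2_functions M"
  using L2_functionsD[OF assms] by (auto simp: L2_functions_def norm_mult power_mult_distrib)

lemma L2_diff:
  assumes "f \<in> L2_functions M" "g \<in> L2_functions M"
  shows "(\<lambda>x. f x - g x) \<in> L2_functions M"
  using L2_add[OF assms(1) L2_cmult[OF assms(2), of "-1"]] by simp

lemma L2_inner_cnj: "L2_inner M g f = cnj (L2_inner M f g)"
  unfolding L2_inner_def
  by (subst Bochner_Integration.integral_cnj[symmetric]) (simp add: mult.commute)

lemma L2_inner_add_left:
  assumes "f \<in> L2_functions M" "g \<in> L2_functions M" "h \<in> L2_functions M"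
  shows "L2_inner M (\<lambda>x. f x + g x) h = L2_inner M f h + L2_inner M g h"
  unfolding L2_inner_def using L2_mult_integrable[OF assms(1,3)] L2_mult_integrable[OF assms(2,3)]
  by (simp add: distrib_right)

lemma L2_inner_cmult_left: "L2_inner M (\<lambda>x. c * f x) h = c * L2_inner M f h"
  unfolding L2_inner_def by (simp add: mult.assoc)

lemma L2_inner_add_right:
  assumes "f \<in> L2_functions M" "g \<in> L2_functions M" "h \<in> L2_functions M"
  shows "L2_inner M h (\<lambda>x. f x + g x) = L2_inner M h f + L2_inner M h g"
  using L2_inner_add_left[OF assms] by (subst (1 2 3) L2_inner_cnj) simp

lemma L2_inner_cmult_right: "L2_inner M h (\<lambda>x. c * f x) = cnj c * L2_inner M h f"
  by (subst (1 2) L2_inner_cnj) (simp add: L2_inner_cmult_left)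

lemma L2_norm_nonneg [simp]: "L2_norm M f \<ge> 0"
  by (simp add: L2_norm_def)

lemma L2_norm_sq: "(L2_norm M f)\<^sup>2 = (\<integral>x. (norm (f x))\<^sup>2 \<partial>M)"
  by (simp add: L2_norm_def)

lemma L2_inner_self: "L2_inner M f f = of_real ((L2_norm M f)\<^sup>2)"
  unfolding L2_inner_def L2_norm_sq
  by (simp only: integral_complex_of_real[symmetric] complex_norm_square)

lemma L2_norm_cmult: "L2_norm M (\<lambda>x. c * f x) = norm c * L2_norm M f"
  by (simp add: L2_norm_def norm_mult power_mult_distrib real_sqrt_mult)

lemma L2_norm_cong_AE:
  assumes "f \<in> borel_measurable M" "g \<in> borel_measurable M" "AE x in M. f x = g x"
  shows "L2_norm M f = L2_norm M g"
  unfolding L2_norm_def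
  by (intro arg_cong[where f=sqrt] integral_cong_AE) (use assms in auto)

lemma L2_norm_add_sq:
  assumes "f \<in> L2_functions M" "g \<in> L2_functions M"
  shows "(L2_norm M (\<lambda>x. f x + g x))\<^sup>2 = (L2_norm M f)\<^sup>2 + (L2_norm M g)\<^sup>2 + 2 * Re (L2_inner M f g)"
proof -
  have "complex_of_real ((L2_norm M (\<lambda>x. f x + g x))\<^sup>2) =
      L2_inner M f f + L2_inner M g g + (L2_inner M f g + cnj (L2_inner M f g))"
    using assms
    by (simp add: L2_inner_self[symmetric] L2_inner_add_left L2_inner_add_right L2_add
        L2_inner_cnj[of M g f] del: of_real_power)
  then show ?thesis
    by (simp add: L2_inner_self complex_add_cnj complex_eq_iff del: of_real_power)
qed

lemma L2_Cauchy_Schwarz: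
  assumes f: "f \<in> L2_functions M" and g: "g \<in> L2_functions M"
  shows "norm (L2_inner M f g) \<le> L2_norm M f * L2_norm M g"
proof (cases "L2_inner M f g = 0")
  case False
  define p where "p = L2_inner M f g"
  define G where "G = (L2_norm M g)\<^sup>2"
  define F where "F = (L2_norm M f)\<^sup>2"
  have quad: "0 \<le> F + (norm c)\<^sup>2 * G + 2 * Re (cnj c * p)" for c
  proof -
    have "(L2_norm M (\<lambda>x. f x + c * g x))\<^sup>2 = F + (norm c)\<^sup>2 * G + 2 * Re (cnj c * p)"
      by (subst L2_norm_add_sq[OF f L2_cmult[OF g]])
        (simp add: F_def G_def p_def L2_norm_cmult L2_inner_cmult_right power_mult_distrib)
    then show ?thesis by (metis zero_le_power2)
  qed
  have "(norm p)\<^sup>2 \<le> F * G"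
  proof (cases "G = 0")
    case True
    \<comment> \<open>With G = 0 the quadratic is affine in c; at c = -t p it equals F - (F + 1) =
      -1, which contradicts nonnegativity.\<close>
    define t where "t = (F + 1) / (2 * (norm p)\<^sup>2)"
    have "Re (cnj (of_real (-t) * p) * p) = - t * (norm p)\<^sup>2"
      by (simp add: mult.assoc cmod_power2) (simp add: power2_eq_square algebra_simps)
    then have "0 \<le> F - 2 * t * (norm p)\<^sup>2"
      using quad[of "of_real (-t) * p"] True by simp
    moreover have "2 * t * (norm p)\<^sup>2 = F + 1"
      using False by (simp add: t_def p_def)
    ultimately show ?thesis by simp
  next
    case False
    then have G: "G > 0" by (simp add: G_def)
    \<comment> \<open>c = -p / G is the minimizer of the quadratic.\<close>
    have "Re (cnj (of_real (-1/G) * p) * p) = - (1/G) * (norm p)\<^sup>2"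
      by (simp add: mult.assoc cmod_power2) (simp add: power2_eq_square algebra_simps add_divide_distrib)
    then have "0 \<le> F + (norm p / G)\<^sup>2 * G - 2 * ((norm p)\<^sup>2 / G)"
      using quad[of "of_real (-1/G) * p"] G by (simp add: norm_divide norm_mult)
    also have "\<dots> = F - (norm p)\<^sup>2 / G"
      using G by (simp add: power2_eq_square)
    finally show ?thesis using G by (simp add: field_simps)
  qed
  then have "(norm p)\<^sup>2 \<le> (L2_norm M f * L2_norm M g)\<^sup>2"
    by (simp add: F_def G_def power_mult_distrib)
  then show ?thesis unfolding p_def
    by (rule power2_le_imp_le) simp
qed simp

lemma L2_triangle:
  assumes "f \<in> L2_functions M" "g \<in> L2_functions M"
  shows "L2_norm M (\<lambda>x. f x + g x) \<le> L2_norm M f + L2_norm M g"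
proof (rule power2_le_imp_le)
  have "Re (L2_inner M f g) \<le> L2_norm M f * L2_norm M g"
    using L2_Cauchy_Schwarz[OF assms] complex_Re_le_cmod order_trans by blast
  then show "(L2_norm M (\<lambda>x. f x + g x))\<^sup>2 \<le> (L2_norm M f + L2_norm M g)\<^sup>2"
    by (simp add: L2_norm_add_sq[OF assms] power2_sum)
qed simp

lemma L2_norm_diff_commute: "L2_norm M (\<lambda>x. f x - g x) = L2_norm M (\<lambda>x. g x - f x)"
  by (simp add: L2_norm_def norm_minus_commute)

section \<open>Null functions, Fatou's lemma and completeness of L2\<close>

lemma L2_norm_eq_0_AE:
  assumes "f \<in> L2_functions M" "L2_norm M f = 0"
  shows "AE x in M. f x = 0"
proof -
  have "(\<integral>x. (norm (f x))\<^sup>2 \<partial>M) = 0"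
    using assms(2) by (simp add: L2_norm_def)
  then have "AE x in M. (norm (f x))\<^sup>2 = 0"
    using integral_nonneg_eq_0_iff_AE[OF L2_functionsD(2)[OF assms(1)]] by simp
  then show ?thesis by simp
qed

lemma L2_nn_integral:
  assumes "f \<in> L2_functions M"
  shows "(\<integral>\<^sup>+x. ennreal ((norm (f x))\<^sup>2) \<partial>M) = ennreal ((L2_norm M f)\<^sup>2)"
  unfolding L2_norm_sq using L2_functionsD(2)[OF assms] by (intro nn_integral_eq_integral) auto

lemma L2_nn_integral_le:
  assumes [measurable]: "f \<in> borel_measurable M"
    and "(\<integral>\<^sup>+x. ennreal ((norm (f x))\<^sup>2) \<partial>M) \<le> ennreal (e\<^sup>2)" "0 \<le> e"
  shows "f \<in> L2_functions M" "L2_norm M f \<le> e"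
proof -
  show 1: "f \<in> L2_functions M"
    unfolding L2_functions_def integrable_iff_bounded
    using assms(2) by (auto intro: le_less_trans)
  have "(L2_norm M f)\<^sup>2 \<le> e\<^sup>2"
    using assms(2) L2_nn_integral[OF 1] by simp
  then show "L2_norm M f \<le> e" using assms(3) by (rule power2_le_imp_le)
qed

text \<open>Fatou's lemma for the squares: a bound that holds eventually survives almost everywhere
  convergence. It serves both completeness and the passage to radial limits.\<close>

lemma L2_Fatou:
  assumes u: "\<And>k. u k \<in> L2_functions M" and v[measurable]: "v \<in> borel_measurable M"
    and lim: "AE x in M. (\<lambda>k. u k x) \<longlonglongrightarrow> v x"
    and e: "eventually (\<lambda>k. L2_norm M (u k) \<le> e) sequentially"
  shows "v \<in> L2_functions M" "L2_norm M v \<le> e"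
proof -
  note [measurable] = L2_functionsD(1)[OF u]
  from e obtain k where "L2_norm M (u k) \<le> e"
    unfolding eventually_sequentially by blast
  then have e0: "0 \<le> e" using L2_norm_nonneg[of M "u k"] by linarith
  have "(\<integral>\<^sup>+x. ennreal ((norm (v x))\<^sup>2) \<partial>M)
      = (\<integral>\<^sup>+x. liminf (\<lambda>k. ennreal ((norm (u k x))\<^sup>2)) \<partial>M)"
  proof (rule nn_integral_cong_AE, use lim in eventually_elim)
    case (elim x)
    then have "(\<lambda>k. ennreal ((norm (u k x))\<^sup>2)) \<longlonglongrightarrow> ennreal ((norm (v x))\<^sup>2)"
      by (intro tendsto_intros)
    then show ?case by (intro lim_imp_Liminf[symmetric]) simp_all
  qed
  also have "\<dots> \<le> liminf (\<lambda>k. \<integral>\<^sup>+x. ennreal ((norm (u k x))\<^sup>2) \<partial>M)"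
    by (rule nn_integral_liminf) simp
  also have "\<dots> \<le> limsup (\<lambda>k. ennreal ((L2_norm M (u k))\<^sup>2))"
    unfolding L2_nn_integral[OF u] by (simp add: Liminf_le_Limsup)
  also have "\<dots> \<le> ennreal (e\<^sup>2)"
    using e by (intro Limsup_bounded) (auto elim!: eventually_mono intro!: ennreal_leI power_mono)
  finally have "(\<integral>\<^sup>+x. ennreal ((norm (v x))\<^sup>2) \<partial>M) \<le> ennreal (e\<^sup>2)" .
  from L2_nn_integral_le[OF v this e0]
  show "v \<in> L2_functions M" "L2_norm M v \<le> e" by auto
qed

lemma (in finite_measure) L2_const: "(\<lambda>x. c) \<in> L2_functions M"
  by (simp add: L2_functions_def)

lemma (in finite_measure) L2_imp_L1:
  assumes f: "f \<in> L2_functions M"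
  shows "integrable M (\<lambda>x. norm (f x))"
    and "(\<integral>x. norm (f x) \<partial>M) \<le> sqrt (measure M (space M)) * L2_norm M f"
proof -
  define h where "h = (\<lambda>x. complex_of_real (norm (f x)))"
  have h: "h \<in> L2_functions M"
    using L2_functionsD[OF f] by (auto simp: L2_functions_def h_def)
  have nh: "L2_norm M h = L2_norm M f" by (simp add: L2_norm_def h_def)
  have "integrable M (\<lambda>x. h x * cnj 1)" by (rule L2_mult_integrable[OF h L2_const])
  then show "integrable M (\<lambda>x. norm (f x))"
    by (simp add: h_def complex_of_real_integrable_eq)
  have "L2_inner M h (\<lambda>x. 1) = complex_of_real (\<integral>x. norm (f x) \<partial>M)"
    by (simp add: L2_inner_def h_def)
  moreover have "L2_norm M (\<lambda>x. 1) = sqrt (measure M (space M))"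
    by (simp add: L2_norm_def)
  ultimately show "(\<integral>x. norm (f x) \<partial>M) \<le> sqrt (measure M (space M)) * L2_norm M f"
    using L2_Cauchy_Schwarz[OF h L2_const[of 1]] nh
    by (simp add: mult.commute abs_le_iff)
qed

text \<open>Riesz-Fischer: along a subsequence the increments have geometrically decreasing L2
  norms. On a finite measure space their L1 norms are then summable, so the subsequence converges
  almost everywhere.\<close>

lemma (in finite_measure) L2_complete:
  assumes f: "\<And>n. f n \<in> L2_functions M"
    and Cauchy: "\<And>e. e > 0 \<Longrightarrow> \<exists>N. \<forall>m\<ge>N. \<forall>n\<ge>N. L2_norm M (\<lambda>x. f m x - f n x) < e"
  shows "\<exists>g\<in>L2_functions M. (\<lambda>n. L2_norm M (\<lambda>x. g x - f n x)) \<longlonglongrightarrow> 0"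
proof -
  note [measurable] = L2_functionsD(1)[OF f]
  have "\<exists>N. \<forall>m\<ge>N. \<forall>n\<ge>N. L2_norm M (\<lambda>x. f m x - f n x) < (1/2)^k" for k
    by (rule Cauchy) simp
  then obtain N where N: "\<And>k m n. m \<ge> N k \<Longrightarrow> n \<ge> N k \<Longrightarrow> L2_norm M (\<lambda>x. f m x - f n x) < (1/2)^k"
    by metis
  \<comment> \<open>Adding up all \<open>N i\<close> and k makes s increasing, at least
    \<open>N k\<close> and at least k at the same time.\<close>
  define s where "s k = (\<Sum>i\<le>k. N i) + k" for k
  have sN: "s k \<ge> N k" for k unfolding s_def
    by (metis atMost_iff finite_atMost le_add1 member_le_sum order_refl trans_le_add1 zero_le)
  have smono: "s k \<le> s (Suc k)" for k by (simp add: s_def)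
  have sk: "s k \<ge> k" for k by (simp add: s_def)
  define D where "D k x = norm (f (s (Suc k)) x - f (s k) x)" for k x
  have D: "integrable M (D k)" "(\<integral>x. D k x \<partial>M) \<le> sqrt (measure M (space M)) * (1/2)^k" for k
  proof -
    have "L2_norm M (\<lambda>x. f (s (Suc k)) x - f (s k) x) < (1/2)^k"
      by (rule N) (use sN smono order_trans in blast)+
    then show "integrable M (D k)" "(\<integral>x. D k x \<partial>M) \<le> sqrt (measure M (space M)) * (1/2)^k"
      using L2_imp_L1[OF L2_diff[OF f f], of "s (Suc k)" "s k"]
      unfolding D_def by (auto elim!: order_trans intro!: mult_left_mono)
  qed
  have "(\<integral>\<^sup>+x. (\<Sum>k. ennreal (D k x)) \<partial>M) = (\<Sum>k. \<integral>\<^sup>+x. ennreal (D k x) \<partial>M)"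
    by (rule nn_integral_suminf) (simp add: D_def)
  also have "\<dots> = (\<Sum>k. ennreal (\<integral>x. D k x \<partial>M))"
    by (intro suminf_cong nn_integral_eq_integral D) (simp add: D_def)
  also have "\<dots> \<le> (\<Sum>k. ennreal (sqrt (measure M (space M)) * (1/2)^k))"
    by (intro suminf_le ennreal_leI D) auto
  also have "\<dots> = ennreal (\<Sum>k. sqrt (measure M (space M)) * (1/2)^k)"
    by (intro suminf_ennreal2) (auto intro!: summable_mult summable_geometric)
  also have "\<dots> < \<infinity>" by simp
  finally have "AE x in M. (\<Sum>k. ennreal (D k x)) \<noteq> \<infinity>"
    by (intro nn_integral_PInf_AE) (auto simp: D_def)
  then have ae: "AE x in M. (\<lambda>k. f (s k) x) \<longlonglongrightarrow> lim (\<lambda>k. f (s k) x)"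
  proof eventually_elim
    case (elim x)
    then have "summable (\<lambda>k. D k x)"
      by (intro summable_suminf_not_top) (auto simp: D_def)
    then have "summable (\<lambda>k. f (s (Suc k)) x - f (s k) x)"
      unfolding D_def by (rule summable_norm_cancel)
    then have "convergent (\<lambda>n. \<Sum>k<n. f (s (Suc k)) x - f (s k) x)"
      by (simp add: summable_iff_convergent)
    moreover have "(\<Sum>k<n. f (s (Suc k)) x - f (s k) x) = f (s n) x - f (s 0) x" for n
      by (rule sum_lessThan_telescope)
    ultimately have "convergent (\<lambda>n. (f (s n) x - f (s 0) x) + f (s 0) x)"
      by (intro convergent_add convergent_const) simp
    then show ?case by (simp add: convergent_LIMSEQ_iff)
  qed
  define g where "g x = lim (\<lambda>k. f (s k) x)" for x
  have g[measurable]: "g \<in> borel_measurable M"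
    unfolding g_def by (rule borel_measurable_lim_metric) simp
  \<comment> \<open>Fatou along the subsequence, with n held fixed, turns the Cauchy bound into a
    distance to the limit.\<close>
  have bound: "L2_norm M (\<lambda>x. g x - f n x) \<le> (1/2)^j \<and> (\<lambda>x. g x - f n x) \<in> L2_functions M"
    if "n \<ge> N j" for n j
  proof -
    have ev: "eventually (\<lambda>k. L2_norm M (\<lambda>x. f (s k) x - f n x) \<le> (1/2)^j) sequentially"
    proof (rule eventually_sequentiallyI)
      fix k assume "N j \<le> k"
      then show "L2_norm M (\<lambda>x. f (s k) x - f n x) \<le> (1/2)^j"
        using N[of j "s k" n] that sk[of k] by linarith
    qed
    have "AE x in M. (\<lambda>k. f (s k) x - f n x) \<longlonglongrightarrow> g x - f n x"
      using ae unfolding g_def by eventually_elim (intro tendsto_intros)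
    from L2_Fatou[OF L2_diff[OF f f] _ this ev] show ?thesis by simp
  qed
  have "(\<lambda>x. (g x - f (N 0) x) + f (N 0) x) \<in> L2_functions M"
    using bound[of 0 "N 0"] f by (intro L2_add) auto
  then have gL: "g \<in> L2_functions M" by simp
  have "(\<lambda>n. L2_norm M (\<lambda>x. g x - f n x)) \<longlonglongrightarrow> 0"
  proof (rule LIMSEQ_I)
    fix r :: real assume "r > 0"
    then obtain j where "(1/2)^j < r"
      using real_arch_pow_inv[of r "1/2"] by auto
    then show "\<exists>no. \<forall>n\<ge>no. norm (L2_norm M (\<lambda>x. g x - f n x) - 0) < r"
      using bound by (intro exI[of _ "N j"]) (auto intro: le_less_trans)
  qed
  with gL show ?thesis by blast
qed

lemma L2_norm_mono:
  assumes "f \<in> L2_functions M" "g \<in> L2_functions M" "\<And>x. x \<in> space M \<Longrightarrow> norm (f x) \<le> norm (g x)"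
  shows "L2_norm M f \<le> L2_norm M g"
  unfolding L2_norm_def using assms
  by (intro real_sqrt_le_mono integral_mono) (auto simp: L2_functions_def intro: power_mono)

lemma L2_inner_cong_AE:
  assumes "f \<in> borel_measurable M" "f' \<in> borel_measurable M" "g \<in> borel_measurable M" "g' \<in> borel_measurable M"
    and "AE x in M. f x = f' x" "AE x in M. g x = g' x"
  shows "L2_inner M f g = L2_inner M f' g'"
proof -
  note [measurable] = assms(1-4)
  show ?thesis unfolding L2_inner_def
  proof (rule integral_cong_AE)
    show "AE x in M. f x * cnj (g x) = f' x * cnj (g' x)"
      using assms(5,6) by eventually_elim simp
  qed measurable
qed

section \<open>Integration over the torus\<close>

text \<open>One factor of \<open>torus_measure\<close>: the cube in the definition of the latter
  becomes a product of these, so that integrals over the torus can be iterated.\<close>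

definition angle_measure :: "real measure" where
  "angle_measure = uniform_measure lborel {0..2 * pi}"

lemma sets_angle_measure [simp, measurable_cong]: "sets angle_measure = sets borel"
  by (simp add: angle_measure_def)

lemma space_angle_measure [simp]: "space angle_measure = UNIV"
  by (simp add: angle_measure_def)

lemma emeasure_angle_measure_UNIV [simp]: "emeasure angle_measure UNIV = 1"
  using emeasure_uniform_measure_1[of lborel "{0..2*pi}"]
  by (simp add: angle_measure_def)

interpretation angle: finite_measure angle_measure
  by standard simp

interpretation angle_product: product_sigma_finite "\<lambda>_. angle_measure"
  by standard

interpretation lborel_real_product: product_sigma_finite "\<lambda>_. lborel :: real measure"
  by standard

lemma integral_angle_measure:
  fixes h :: "real \<Rightarrow> complex"
  assumes "continuous_on UNIV h"
  shows "(\<integral>t. h t \<partial>angle_measure) = integral {0..2 * pi} h / (2 * pi)"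
proof -
  have [measurable]: "h \<in> borel_measurable borel"
    using assms by (rule borel_measurable_continuous_onI)
  have "angle_measure = density lborel (\<lambda>x. ennreal (indicator {0..2*pi} x / (2 * pi)))"
    unfolding angle_measure_def uniform_measure_def
    using divide_ennreal[of 1 "2 * pi"]
    by (intro density_cong) (auto split: split_indicator)
  then have "(\<integral>t. h t \<partial>angle_measure)
      = (\<integral>t. h t \<partial>density lborel (\<lambda>x. ennreal (indicator {0..2*pi} x / (2 * pi))))"
    by (rule arg_cong)
  also have "\<dots> = (\<integral>t. (indicator {0..2*pi} t / (2 * pi)) *\<^sub>R h t \<partial>lborel)"
    by (subst integral_density) auto
  also have "\<dots> = (\<integral>t. (1 / (2 * pi)) *\<^sub>R (indicator {0..2*pi} t *\<^sub>R h t) \<partial>lborel)"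
    by (intro Bochner_Integration.integral_cong) (simp_all add: scaleR_scaleR)
  also have "\<dots> = (1 / (2 * pi)) *\<^sub>R (LINT t:{0..2*pi}|lborel. h t)"
    by (simp only: set_lebesgue_integral_def integral_scaleR_right)
  also have "(LINT t:{0..2*pi}|lborel. h t) = integral {0..2*pi} h"
    using assms by (intro set_borel_integral_eq_integral borel_integrable_atLeastAtMost')
      (auto intro: continuous_on_subset)
  finally show ?thesis by (simp add: scaleR_conv_of_real field_simps)
qed

lemma measurable_vec_lambda_real [measurable]:
  "(vec_lambda :: ('n \<Rightarrow> real) \<Rightarrow> real^'n) \<in> borel_measurable (PiM UNIV (\<lambda>_. borel))"
  by (subst borel_measurable_euclidean_space) (auto simp: Basis_vec_def inner_axis)

text \<open>Carries Lebesgue measure on vectors over to the product measure on functions, for which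
  Fubini's theorem is stated one coordinate at a time.\<close>

lemma lborel_vec:
  "(lborel :: (real^'n) measure) = distr (PiM UNIV (\<lambda>_. lborel)) borel vec_lambda"
proof (rule lborel_eqI)
  fix l u :: "real^'n"
  assume le: "\<And>b. b \<in> Basis \<Longrightarrow> l \<bullet> b \<le> u \<bullet> b"
  have le': "l $ j \<le> u $ j" for j
    using le[of "axis j 1"] by (auto simp: inner_axis Basis_vec_def)
  have [measurable]: "(vec_lambda :: ('n \<Rightarrow> real) \<Rightarrow> real^'n) \<in> borel_measurable (PiM UNIV (\<lambda>_. lborel))"
    using measurable_vec_lambda_real by (simp cong: measurable_cong_sets add: sets_PiM_cong[of UNIV UNIV "\<lambda>_. lborel" "\<lambda>_. borel"])
  have pre: "vec_lambda -` box l u \<inter> space (PiM UNIV (\<lambda>_. lborel)) = (\<Pi>\<^sub>E j\<in>UNIV. {l $ j<..<u $ j})"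
    by (auto simp: space_PiM mem_box_cart PiE_UNIV_domain Pi_iff)
  have inj: "inj (\<lambda>j::'n. axis j (1::real))" by (auto simp: inj_on_def axis_eq_axis)
  have B: "(Basis :: (real^'n) set) = range (\<lambda>j. axis j 1)" by (auto simp: Basis_vec_def)
  have "emeasure (distr (PiM UNIV (\<lambda>_. lborel)) borel vec_lambda) (box l u)
      = (\<Prod>j\<in>UNIV. emeasure lborel {l $ j<..<u $ j})"
    by (simp add: emeasure_distr pre lborel_real_product.emeasure_PiM)
  also have "\<dots> = ennreal (\<Prod>j\<in>UNIV. u $ j - l $ j)"
    using le' by (simp add: prod_ennreal)
  also have "(\<Prod>j\<in>UNIV. u $ j - l $ j) = (\<Prod>b\<in>Basis. (u - l) \<bullet> b)"
    unfolding B by (subst prod.reindex[OF inj]) (simp add: inner_axis)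
  finally show "emeasure (distr (PiM UNIV (\<lambda>_. lborel)) borel vec_lambda) (box l u) = (\<Prod>b\<in>Basis. (u - l) \<bullet> b)" .
qed simp

lemma uniform_measure_cube:
  "uniform_measure lborel (cbox 0 (\<chi> j. 2 * pi) :: (real^'n) set)
     = distr (PiM UNIV (\<lambda>_. angle_measure)) borel vec_lambda"
proof -
  let ?Q = "cbox 0 (\<chi> j. 2 * pi) :: (real^'n) set"
  let ?P = "PiM (UNIV :: 'n set) (\<lambda>_. angle_measure)"
  have sets_eq: "sets ?P = sets (PiM UNIV (\<lambda>_. borel))"
      "sets (PiM (UNIV :: 'n set) (\<lambda>_. lborel :: real measure)) = sets (PiM UNIV (\<lambda>_. borel))"
    by (intro sets_PiM_cong; simp)+
  have nth[measurable]: "vec_nth \<in> measurable borel ?P"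
    by (subst measurable_cong_sets[OF refl sets_eq(1)], rule measurable_PiM_single')
      (auto simp: PiE_def extensional_def intro!: borel_measurable_continuous_onI continuous_intros)
  have lam[measurable]: "vec_lambda \<in> borel_measurable ?P"
      "vec_lambda \<in> borel_measurable (PiM (UNIV :: 'n set) (\<lambda>_. lborel :: real measure))"
    using measurable_vec_lambda_real by (simp_all cong: measurable_cong_sets add: sets_eq)
  \<comment> \<open>The sides are arbitrary Borel sets, because product measures are compared on all
    measurable rectangles and not only on boxes.\<close>
  have box: "emeasure lborel {t::real^'n. \<forall>j. t $ j \<in> A j} = (\<Prod>j\<in>UNIV. emeasure lborel (A j))"
    if A: "\<And>j. A j \<in> sets borel" for A :: "'n \<Rightarrow> real set"
  proof -
    have m: "{t::real^'n. \<forall>j. t $ j \<in> A j} \<in> sets borel"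
    proof -
      have "{t::real^'n. \<forall>j. t $ j \<in> A j} = (\<Inter>j. (\<lambda>t. t $ j) -` A j \<inter> space borel)" by auto
      also have "\<dots> \<in> sets borel"
        using A by (intro sets.countable_INT'' measurable_sets[of _ borel borel]
            borel_measurable_continuous_onI continuous_intros) auto
      finally show ?thesis .
    qed
    have "emeasure lborel {t::real^'n. \<forall>j. t $ j \<in> A j}
      = emeasure (PiM UNIV (\<lambda>_. lborel)) (vec_lambda -` {t::real^'n. \<forall>j. t $ j \<in> A j} \<inter> space (PiM UNIV (\<lambda>_. lborel)))"
      using m by (subst lborel_vec) (simp add: emeasure_distr)
    also have "vec_lambda -` {t::real^'n. \<forall>j. t $ j \<in> A j} \<inter> space (PiM UNIV (\<lambda>_. lborel)) = PiE UNIV A"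
      by (auto simp: space_PiM)
    finally show ?thesis using A by (simp add: lborel_real_product.emeasure_PiM)
  qed
  have Q: "?Q = {t. \<forall>j. t $ j \<in> {0..2*pi}}" by (auto simp: mem_box_cart)
  have "distr (uniform_measure lborel ?Q) ?P vec_nth = ?P"
  proof (rule angle_product.PiM_eqI)
    fix A :: "'n \<Rightarrow> real set"
    assume "\<And>i. i \<in> UNIV \<Longrightarrow> A i \<in> sets angle_measure"
    then have A: "A i \<in> sets borel" for i by simp
    then have AP: "Pi\<^sub>E UNIV A \<in> sets ?P" by (intro sets_PiM_I_finite) auto
    have pre: "vec_nth -` Pi\<^sub>E UNIV A = {t::real^'n. \<forall>j. t $ j \<in> A j}" by auto
    have preS: "{t::real^'n. \<forall>j. t $ j \<in> A j} \<in> sets borel"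
      using measurable_sets[OF nth AP] pre by simp
    have "emeasure (distr (uniform_measure lborel ?Q) ?P vec_nth) (Pi\<^sub>E UNIV A)
        = emeasure lborel (?Q \<inter> {t. \<forall>j. t $ j \<in> A j}) / emeasure lborel ?Q"
      using AP preS by (subst emeasure_distr) (auto simp: pre cong: measurable_cong_sets)
    also have "?Q \<inter> {t. \<forall>j. t $ j \<in> A j} = {t. \<forall>j. t $ j \<in> {0..2*pi} \<inter> A j}"
      unfolding Q by auto
    also have "emeasure lborel \<dots> = (\<Prod>j\<in>UNIV. emeasure lborel ({0..2*pi} \<inter> A j))"
      using A by (intro box) auto
    also have "emeasure lborel ?Q = ennreal ((2*pi) ^ CARD('n))"
      unfolding Q by (subst box) (simp_all add: prod_constant ennreal_power)
    also have "(\<Prod>j\<in>UNIV. emeasure lborel ({0..2*pi} \<inter> A j)) / ennreal ((2*pi) ^ CARD('n))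
       = (\<Prod>j\<in>UNIV. emeasure lborel ({0..2*pi} \<inter> A j) / ennreal (2*pi))"
    proof -
      have "inverse (ennreal ((2*pi) ^ CARD('n))) = inverse (ennreal (2*pi)) ^ CARD('n)"
        by (simp only: inverse_ennreal ennreal_power zero_less_power pi_gt_zero zero_less_mult_iff
            zero_less_numeral power_inverse inverse_nonnegative_iff_nonnegative simp_thms less_imp_le)
      then show ?thesis by (simp only: divide_ennreal_def prod.distrib prod_constant)
    qed
    also have "\<dots> = (\<Prod>j\<in>UNIV. emeasure angle_measure (A j))"
      using A by (simp add: angle_measure_def)
    finally show "emeasure (distr (uniform_measure lborel ?Q) ?P vec_nth) (Pi\<^sub>E UNIV A)
        = (\<Prod>j\<in>UNIV. emeasure angle_measure (A j))" .
  qed simp_all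
  then have "distr ?P borel vec_lambda = distr (distr (uniform_measure lborel ?Q) ?P vec_nth) borel vec_lambda"
    by simp
  also have "\<dots> = distr (uniform_measure lborel ?Q) borel (vec_lambda \<circ> vec_nth)"
    by (rule distr_distr) (auto cong: measurable_cong_sets)
  also have "\<dots> = distr (uniform_measure lborel ?Q) (uniform_measure lborel ?Q) (\<lambda>x. x)"
    by (intro distr_cong) (auto simp: o_def)
  also have "\<dots> = uniform_measure lborel ?Q" by (rule distr_id)
  finally show ?thesis by simp
qed

section \<open>The torus as a compact probability space and integrals over it\<close>

lemma closed_torus: "closed (torus :: (complex^'n) set)"
proof -
  have "torus = (\<Inter>j. {\<zeta>::complex^'n. norm (\<zeta> $ j) = 1})" by (auto simp: torus_def)
  also have "closed \<dots>" by (intro closed_INT ballI closed_Collect_eq continuous_intros)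
  finally show ?thesis .
qed

lemma compact_torus: "compact (torus :: (complex^'n) set)"
proof -
  have "bounded (torus :: (complex^'n) set)"
    unfolding bounded_iff
  proof (intro exI ballI)
    fix \<zeta> :: "complex^'n" assume "\<zeta> \<in> torus"
    then show "norm \<zeta> \<le> real CARD('n)"
      using L2_set_le_sum[of UNIV "\<lambda>i. norm (\<zeta> $ i)"]
      by (simp add: torus_def norm_vec_def)
  qed
  then show ?thesis using closed_torus compact_eq_bounded_closed by blast
qed

lemma sets_torus_measure [simp, measurable_cong]:
  "sets (torus_measure :: (complex^'n) measure) = sets (restrict_space borel torus)"
  by (simp add: torus_measure_def)

lemma space_torus_measure [simp]: "space (torus_measure :: (complex^'n) measure) = torus"
  by (simp add: torus_measure_def space_restrict_space)

lemma cis_vec_measurable: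
  "(\<lambda>t::real^'n. \<chi> j. cis (t $ j)) \<in> measurable borel (restrict_space borel torus)"
proof (rule measurable_restrict_space2)
  show "(\<lambda>t::real^'n. \<chi> j. cis (t $ j)) \<in> borel_measurable borel"
    by (intro borel_measurable_continuous_onI continuous_intros)
qed (auto simp: torus_def)

lemma torus_measure_eq:
  "(torus_measure :: (complex^'n) measure)
     = distr (PiM UNIV (\<lambda>_. angle_measure)) (restrict_space borel torus) (\<lambda>x. \<chi> j. cis (x j))"
proof -
  have sets_eq: "sets (PiM (UNIV :: 'n set) (\<lambda>_. angle_measure)) = sets (PiM UNIV (\<lambda>_. borel))"
    by (intro sets_PiM_cong; simp)+
  have [measurable]: "vec_lambda \<in> borel_measurable (PiM (UNIV :: 'n set) (\<lambda>_. angle_measure))"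
    using measurable_vec_lambda_real by (simp cong: measurable_cong_sets add: sets_eq)
  show ?thesis
    unfolding torus_measure_def uniform_measure_cube
    by (subst distr_distr) (auto simp: o_def cis_vec_measurable)
qed

lemma cis_PiM_measurable [measurable]:
  "(\<lambda>x. \<chi> j. cis (x j)) \<in> measurable (PiM (UNIV :: 'n::finite set) (\<lambda>_. angle_measure)) (restrict_space borel torus)"
proof -
  have sets_eq: "sets (PiM (UNIV :: 'n set) (\<lambda>_. angle_measure)) = sets (PiM UNIV (\<lambda>_. borel))"
    by (intro sets_PiM_cong; simp)+
  have "vec_lambda \<in> borel_measurable (PiM (UNIV :: 'n set) (\<lambda>_. angle_measure))"
    using measurable_vec_lambda_real by (simp cong: measurable_cong_sets add: sets_eq)
  from measurable_compose[OF this cis_vec_measurable] show ?thesis by simp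
qed

lemma emeasure_torus [simp]: "emeasure (torus_measure :: (complex^'n) measure) torus = 1"
proof -
  have "(\<lambda>x. \<chi> j. cis (x j)) -` torus \<inter> space (PiM (UNIV :: 'n set) (\<lambda>_. angle_measure))
      = PiE UNIV (\<lambda>_. UNIV)"
    by (auto simp: torus_def space_PiM)
  moreover have "emeasure (PiM (UNIV :: 'n set) (\<lambda>_. angle_measure)) (PiE UNIV (\<lambda>_. UNIV)) = 1"
    by (subst angle_product.emeasure_PiM) auto
  moreover have "(torus :: (complex^'n) set) \<in> sets (restrict_space borel torus)"
    using closed_torus by (auto simp: sets_restrict_space)
  ultimately show ?thesis
    by (simp only: torus_measure_eq emeasure_distr cis_PiM_measurable)
qed

interpretation torus: finite_measure "torus_measure :: (complex^'n) measure"
  by standard simp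

lemma measure_torus [simp]: "measure (torus_measure :: (complex^'n) measure) torus = 1"
  by (simp add: measure_def)

lemma measurable_on_torus:
  assumes "continuous_on torus (u :: complex^'n \<Rightarrow> 'b::topological_space)"
  shows "u \<in> borel_measurable (restrict_space borel torus)"
  using assms by (rule borel_measurable_continuous_on_restrict)

lemma bounded_on_torus:
  assumes "continuous_on torus (u :: complex^'n \<Rightarrow> 'b::real_normed_vector)"
  obtains B where "\<And>\<zeta>. \<zeta> \<in> torus \<Longrightarrow> norm (u \<zeta>) \<le> B" "B > 0"
proof -
  have "bounded (u ` torus)"
    using compact_continuous_image[OF assms compact_torus] by (rule compact_imp_bounded)
  then show ?thesis using that unfolding bounded_pos by auto
qed

lemma integrable_on_torus:
  assumes u: "continuous_on torus (u :: complex^'n \<Rightarrow> 'b::{banach,second_countable_topology})"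
    and M: "finite_measure M" "sets M = sets (restrict_space borel torus)"
  shows "integrable M u"
proof -
  interpret finite_measure M by fact
  obtain B where B: "\<And>\<zeta>. \<zeta> \<in> torus \<Longrightarrow> norm (u \<zeta>) \<le> B"
    using bounded_on_torus[OF u] by metis
  have "space M = torus"
    using sets_eq_imp_space_eq[OF M(2)] by (simp add: space_restrict_space)
  then show ?thesis
    using measurable_on_torus[OF u] M(2) B
    by (intro integrable_const_bound[where B=B]) (auto simp: cong: measurable_cong_sets intro!: AE_I2)
qed

lemma L2_on_torus:
  assumes u: "continuous_on torus (u :: complex^'n \<Rightarrow> complex)"
    and M: "finite_measure M" "sets M = sets (restrict_space borel torus)"
  shows "u \<in> L2_functions M"
proof -
  have "continuous_on torus (\<lambda>\<zeta>. (norm (u \<zeta>))\<^sup>2)"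
    using u by (intro continuous_intros)
  from integrable_on_torus[OF this M] show ?thesis
    using measurable_on_torus[OF u] M(2)
    by (auto simp: L2_functions_def cong: measurable_cong_sets)
qed

lemma integral_torus:
  fixes u :: "complex^'n \<Rightarrow> complex"
  assumes "continuous_on torus u"
  shows "integrable (PiM UNIV (\<lambda>_. angle_measure)) (\<lambda>x. u (\<chi> j. cis (x j)))"
    and "(\<integral>\<zeta>. u \<zeta> \<partial>torus_measure) = (\<integral>x. u (\<chi> j. cis (x j)) \<partial>PiM UNIV (\<lambda>_. angle_measure))"
proof -
  have "integrable torus_measure u"
    by (rule integrable_on_torus[OF assms]) (simp_all add: torus.finite_measure_axioms)
  then show "integrable (PiM UNIV (\<lambda>_. angle_measure)) (\<lambda>x. u (\<chi> j. cis (x j)))"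
    unfolding torus_measure_eq by (rule integrable_distr[rotated]) measurable
  show "(\<integral>\<zeta>. u \<zeta> \<partial>torus_measure) = (\<integral>x. u (\<chi> j. cis (x j)) \<partial>PiM UNIV (\<lambda>_. angle_measure))"
    unfolding torus_measure_eq
    by (rule integral_distr) (use measurable_on_torus[OF assms] in simp_all)
qed

lemma integral_torus_prod:
  fixes h :: "'n::finite \<Rightarrow> complex \<Rightarrow> complex"
  assumes h: "\<And>j. continuous_on (sphere 0 1) (h j)"
  shows "(\<integral>\<zeta>. (\<Prod>j\<in>UNIV. h j (\<zeta> $ j)) \<partial>torus_measure)
    = (\<Prod>j\<in>UNIV. \<integral>t. h j (cis t) \<partial>angle_measure)"
proof -
  have "continuous_on torus (\<lambda>\<zeta>::complex^'n. \<Prod>j\<in>UNIV. h j (\<zeta> $ j))"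
    by (intro continuous_on_prod continuous_on_compose2[OF h] continuous_intros) (auto simp: torus_def)
  moreover have "integrable angle_measure (\<lambda>t. h j (cis t))" for j
  proof -
    have "continuous_on UNIV (\<lambda>t. h j (cis t))"
      by (intro continuous_on_compose2[OF h] continuous_intros) auto
    moreover obtain B where "\<And>z. z \<in> sphere 0 1 \<Longrightarrow> norm (h j z) \<le> B"
      using compact_imp_bounded[OF compact_continuous_image[OF h compact_sphere]]
      unfolding bounded_iff by (metis imageI)
    ultimately show ?thesis
      by (intro angle.integrable_const_bound[where B=B])
        (auto intro!: AE_I2 cong: measurable_cong_sets simp: borel_measurable_continuous_onI)
  qed
  ultimately show ?thesis
    using angle_product.product_integral_prod[of UNIV "\<lambda>j t. h j (cis t)"]
    by (subst integral_torus) simp_all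
qed

text \<open>Fubini with coordinate j singled out. It lets an integrand be changed one coordinate at
  a time, which is the induction step of the Cauchy formula on the polydisc.\<close>

lemma integral_torus_eqI:
  fixes u v :: "complex^'n \<Rightarrow> complex"
  assumes u: "continuous_on torus u" and v: "continuous_on torus v"
    and eq: "\<And>\<zeta>. \<zeta> \<in> torus \<Longrightarrow>
      (\<integral>t. u (\<chi> i. if i = j then cis t else \<zeta> $ i) \<partial>angle_measure)
        = (\<integral>t. v (\<chi> i. if i = j then cis t else \<zeta> $ i) \<partial>angle_measure)"
  shows "(\<integral>\<zeta>. u \<zeta> \<partial>torus_measure) = (\<integral>\<zeta>. v \<zeta> \<partial>torus_measure)"
proof -
  have *: "(\<integral>\<zeta>. w \<zeta> \<partial>torus_measure) =
      (\<integral>x. (\<integral>t. w (\<chi> i. if i = j then cis t else (\<chi> i. cis (x i)) $ i) \<partial>angle_measure)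
        \<partial>PiM (UNIV - {j}) (\<lambda>_. angle_measure))"
    if w: "continuous_on torus w" for w :: "complex^'n \<Rightarrow> complex"
  proof -
    have ins: "insert j (UNIV - {j}) = UNIV" by auto
    have "(\<integral>\<zeta>. w \<zeta> \<partial>torus_measure)
        = (\<integral>x. w (\<chi> i. cis (x i)) \<partial>PiM (insert j (UNIV - {j})) (\<lambda>_. angle_measure))"
      using integral_torus(2)[OF w] by (simp only: ins)
    also have "\<dots> = (\<integral>x. (\<integral>t. w (\<chi> i. cis ((x(j := t)) i)) \<partial>angle_measure)
        \<partial>PiM (UNIV - {j}) (\<lambda>_. angle_measure))"
      by (intro angle_product.product_integral_insert)
        (use integral_torus(1)[OF w] in \<open>simp_all only: ins\<close>, simp_all)
    also have "\<dots> = (\<integral>x. (\<integral>t. w (\<chi> i. if i = j then cis t else (\<chi> i. cis (x i)) $ i) \<partial>angle_measure)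
        \<partial>PiM (UNIV - {j}) (\<lambda>_. angle_measure))"
      by (intro Bochner_Integration.integral_cong refl arg_cong[where f=w]) (simp add: vec_eq_iff)
    finally show ?thesis .
  qed
  show ?thesis
    unfolding *[OF u] *[OF v]
    by (intro Bochner_Integration.integral_cong refl eq) (simp add: torus_def)
qed

section \<open>The Cauchy formula on the circle\<close>

lemma one_minus_mult_nonzero:
  fixes x y :: complex
  assumes "norm x < 1" "norm y \<le> 1"
  shows "1 - x * y \<noteq> 0"
proof -
  have "norm (x * y) < 1"
    using assms by (auto simp: norm_mult intro: le_less_trans[OF mult_right_le_one_le])
  then show ?thesis by (metis norm_one less_irrefl right_minus_eq)
qed

text \<open>On the circle y = cis t one has dy = \<i> y dt and cnj y = 1 / y, so dy / (y - w) is
  \<i> dt / (1 - w cnj y).\<close>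

lemma integral_circle_Cauchy:
  assumes F: "continuous_on (cball 0 1) F" "F holomorphic_on ball 0 1" and w: "norm w < 1"
  shows "(\<integral>t. F (cis t) / (1 - w * cnj (cis t)) \<partial>angle_measure) = F w"
proof -
  have nz: "1 - w * cnj (cis t) \<noteq> 0" for t
    using w by (intro one_minus_mult_nonzero) auto
  have c: "cis t * cnj (cis t) = 1" for t
    by (simp add: cis_cnj cis_mult)
  have cont: "continuous_on UNIV (\<lambda>t. F (cis t) / (1 - w * cnj (cis t)))"
    using nz by (intro continuous_intros continuous_on_compose2[OF F(1)]) auto
  have "((\<lambda>u. F u / (u - w)) has_contour_integral (2 * of_real pi * \<i> * F w)) (circlepath 0 1)"
    using Cauchy_integral_circlepath[OF F] w by simp
  then have "((\<lambda>t. F (cis t) / (cis t - w) * \<i> * cis t) has_integral (2 * of_real pi * \<i> * F w)) {0..2*pi}"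
    unfolding circlepath_def by (subst (asm) has_contour_integral_part_circlepath_iff) auto
  also have "(\<lambda>t. F (cis t) / (cis t - w) * \<i> * cis t) = (\<lambda>t. \<i> * (F (cis t) / (1 - w * cnj (cis t))))"
  proof
    fix t
    have "cis t * (1 - w * cnj (cis t)) = cis t - w" using c[of t] by (simp add: algebra_simps)
    moreover have "cis t - w \<noteq> 0" using w by auto
    ultimately show "F (cis t) / (cis t - w) * \<i> * cis t = \<i> * (F (cis t) / (1 - w * cnj (cis t)))"
      using nz[of t] by (metis (no_types, lifting) cis_neq_zero frac_eq_eq mult.assoc mult.commute
          nonzero_mult_divide_mult_cancel_left times_divide_eq_right)
  qed
  finally have "((\<lambda>t. - \<i> * (\<i> * (F (cis t) / (1 - w * cnj (cis t))))) has_integral (- \<i> * (2 * of_real pi * \<i> * F w))) {0..2*pi}"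
    by (rule has_integral_mult_right)
  then have "((\<lambda>t. F (cis t) / (1 - w * cnj (cis t))) has_integral (2 * of_real pi * F w)) {0..2*pi}"
    by (simp add: mult.assoc[symmetric]) (simp add: mult.commute mult.left_commute)
  then have "integral {0..2*pi} (\<lambda>t. F (cis t) / (1 - w * cnj (cis t))) = 2 * of_real pi * F w"
    by (rule integral_unique)
  then show ?thesis by (subst integral_angle_measure[OF cont]) simp
qed

section \<open>Cauchy and Poisson formulas on the polydisc\<close>

text \<open>\<open>holomorphic_several_on\<close> asks for a full derivative at every point, so a
  function holomorphic on this set is differentiable across the boundary points too. Cauchy kernels
  and dilates of radius below 1 are of this kind.\<close>

definition closed_polydisc :: "(complex^'n) set" where
  "closed_polydisc = {z. \<forall>j. norm (z $ j) \<le> 1}"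

lemma polydisc_subset_closed: "polydisc \<subseteq> closed_polydisc"
  by (auto simp: polydisc_def closed_polydisc_def less_imp_le)

lemma torus_subset_closed: "torus \<subseteq> closed_polydisc"
  by (auto simp: torus_def closed_polydisc_def)

lemma scale_polydisc:
  assumes "0 \<le> r" "r < 1" "z \<in> closed_polydisc"
  shows "r *\<^sub>R z \<in> polydisc"
  using assms unfolding polydisc_def closed_polydisc_def
  by (auto intro: le_less_trans[OF mult_left_le])

lemma scale_closed_polydisc:
  assumes "0 \<le> r" "r \<le> 1" "z \<in> closed_polydisc"
  shows "r *\<^sub>R z \<in> closed_polydisc"
  using assms unfolding closed_polydisc_def by (auto intro: mult_le_one)

lemma scale_polydisc_polydisc:
  assumes "0 \<le> r" "r \<le> 1" "z \<in> polydisc"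
  shows "r *\<^sub>R z \<in> polydisc"
  using assms unfolding polydisc_def by (auto intro: le_less_trans[OF mult_left_le_one_le])

section \<open>Holomorphic functions of several variables\<close>

lemma holomorphic_several_on_subset:
  "holomorphic_several_on f S \<Longrightarrow> T \<subseteq> S \<Longrightarrow> holomorphic_several_on f T"
  by (auto simp: holomorphic_several_on_def)

lemma holomorphic_several_on_imp_continuous_on:
  assumes "holomorphic_several_on f S"
  shows "continuous_on S f"
proof (rule continuous_at_imp_continuous_on, rule ballI)
  fix x assume "x \<in> S"
  then obtain f' where "(f has_derivative f') (at x)"
    using assms unfolding holomorphic_several_on_def by blast
  then show "isCont f x" by (rule has_derivative_continuous)
qed

lemma holomorphic_several_on_const: "holomorphic_several_on (\<lambda>z. c) S"
  unfolding holomorphic_several_on_def by (auto intro!: exI[of _ "\<lambda>_. 0"])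

lemma holomorphic_several_on_component: "holomorphic_several_on (\<lambda>z. z $ j) S"
  unfolding holomorphic_several_on_def
  by (auto intro!: exI[of _ "\<lambda>z. z $ j"] bounded_linear_imp_has_derivative)

lemma holomorphic_several_on_add:
  assumes "holomorphic_several_on f S" "holomorphic_several_on g S"
  shows "holomorphic_several_on (\<lambda>z. f z + g z) S"
  unfolding holomorphic_several_on_def
proof
  fix z assume "z \<in> S"
  with assms obtain f' g' where "(f has_derivative f') (at z)" "\<And>c v. f' (c *s v) = c * f' v"
      "(g has_derivative g') (at z)" "\<And>c v. g' (c *s v) = c * g' v"
    unfolding holomorphic_several_on_def by metis
  then show "\<exists>h. ((\<lambda>z. f z + g z) has_derivative h) (at z) \<and> (\<forall>c v. h (c *s v) = c * h v)"
    by (intro exI[of _ "\<lambda>v. f' v + g' v"] conjI has_derivative_add) (auto simp: distrib_left)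
qed

lemma holomorphic_several_on_mult:
  assumes "holomorphic_several_on f S" "holomorphic_several_on g S"
  shows "holomorphic_several_on (\<lambda>z. f z * g z) S"
  unfolding holomorphic_several_on_def
proof
  fix z assume "z \<in> S"
  with assms obtain f' g' where "(f has_derivative f') (at z)" "\<And>c v. f' (c *s v) = c * f' v"
      "(g has_derivative g') (at z)" "\<And>c v. g' (c *s v) = c * g' v"
    unfolding holomorphic_several_on_def by metis
  then show "\<exists>h. ((\<lambda>z. f z * g z) has_derivative h) (at z) \<and> (\<forall>c v. h (c *s v) = c * h v)"
    by (intro exI[of _ "\<lambda>v. f z * g' v + f' v * g z"] conjI has_derivative_mult)
      (auto simp: algebra_simps)
qed

lemma holomorphic_several_on_cmult:
  "holomorphic_several_on f S \<Longrightarrow> holomorphic_several_on (\<lambda>z. c * f z) S"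
  by (intro holomorphic_several_on_mult holomorphic_several_on_const)

lemma holomorphic_several_on_inverse:
  assumes "holomorphic_several_on f S" "\<And>z. z \<in> S \<Longrightarrow> f z \<noteq> 0"
  shows "holomorphic_several_on (\<lambda>z. inverse (f z)) S"
  unfolding holomorphic_several_on_def
proof
  fix z assume z: "z \<in> S"
  with assms obtain f' where "(f has_derivative f') (at z)" "\<And>c v. f' (c *s v) = c * f' v"
    unfolding holomorphic_several_on_def by metis
  then show "\<exists>h. ((\<lambda>z. inverse (f z)) has_derivative h) (at z) \<and> (\<forall>c v. h (c *s v) = c * h v)"
    using assms(2)[OF z]
    by (intro exI[of _ "\<lambda>v. - (inverse (f z) * f' v * inverse (f z))"] conjI
        Deriv.has_derivative_inverse) auto
qed

lemma holomorphic_several_on_prod: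
  assumes "finite A" "\<And>j. j \<in> A \<Longrightarrow> holomorphic_several_on (f j) S"
  shows "holomorphic_several_on (\<lambda>z. \<Prod>j\<in>A. f j z) S"
  using assms
  by (induction A rule: finite_induct)
    (auto intro: holomorphic_several_on_const holomorphic_several_on_mult)

lemma holomorphic_several_on_scale:
  fixes f :: "complex^'n \<Rightarrow> complex"
  assumes "holomorphic_several_on f S" "\<And>z. z \<in> T \<Longrightarrow> r *\<^sub>R z \<in> S"
  shows "holomorphic_several_on (\<lambda>z. f (r *\<^sub>R z)) T"
  unfolding holomorphic_several_on_def
proof
  fix z assume z: "z \<in> T"
  with assms obtain f' where f': "(f has_derivative f') (at (r *\<^sub>R z))"
      "\<And>c v. f' (c *s v) = c * f' v"
    unfolding holomorphic_several_on_def by metis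
  have "((\<lambda>z. r *\<^sub>R z) has_derivative (\<lambda>v. r *\<^sub>R v)) (at z)"
    by (auto intro!: derivative_eq_intros)
  then have "((\<lambda>z. f (r *\<^sub>R z)) has_derivative (\<lambda>v. f' (r *\<^sub>R v))) (at z)"
    using f'(1) by (rule has_derivative_compose)
  moreover have "f' (r *\<^sub>R (c *s v)) = c * f' (r *\<^sub>R v)" for c v
  proof -
    have "r *\<^sub>R (c *s v) = c *s (r *\<^sub>R v)" by (simp add: vec_eq_iff)
    then show ?thesis by (simp add: f'(2))
  qed
  ultimately show "\<exists>h. ((\<lambda>z. f (r *\<^sub>R z)) has_derivative h) (at z) \<and> (\<forall>c v. h (c *s v) = c * h v)"
    by blast
qed

text \<open>The chain rule gives the derivative h \<mapsto> f' (h b), and complex linearity of f'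
  makes it multiplication by f' b. This is the only bridge to one-variable theory, used for Cauchy's
  formula and for polarization.\<close>

lemma holomorphic_on_line:
  fixes f :: "complex^'n \<Rightarrow> complex" and a b :: "complex^'n"
  assumes "holomorphic_several_on f S" "\<And>y. y \<in> T \<Longrightarrow> a + y *s b \<in> S"
  shows "(\<lambda>y. f (a + y *s b)) holomorphic_on T"
  unfolding holomorphic_on_def
proof
  fix y assume y: "y \<in> T"
  with assms obtain f' where f': "(f has_derivative f') (at (a + y *s b))"
      "\<And>c v. f' (c *s v) = c * f' v"
    unfolding holomorphic_several_on_def by metis
  have "bounded_linear (\<lambda>y. y *s b)"
    by (rule linear_conv_bounded_linear[THEN iffD1], rule linearI)
      (simp_all add: vec_eq_iff distrib_right)
  then have "((\<lambda>y. a + y *s b) has_derivative (\<lambda>h. 0 + h *s b)) (at y)"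
    by (intro has_derivative_add has_derivative_const bounded_linear_imp_has_derivative)
  then have "((\<lambda>y. f (a + y *s b)) has_derivative (\<lambda>h. f' (0 + h *s b))) (at y)"
    using f'(1) by (rule has_derivative_compose)
  moreover have "(*) (f' b) = (\<lambda>h. f' (0 + h *s b))"
    by (auto simp: f'(2) mult.commute)
  ultimately have "((\<lambda>y. f (a + y *s b)) has_field_derivative f' b) (at y)"
    unfolding has_field_derivative_def by simp
  then show "(\<lambda>y. f (a + y *s b)) field_differentiable at y within T"
    using field_differentiable_at_within field_differentiable_def by blast
qed

section \<open>The Cauchy kernel and the Cauchy and Poisson formulas\<close>

lemma cauchy_kernel_cnj: "cnj (cauchy_kernel z w) = cauchy_kernel w z"
  by (simp add: cauchy_kernel_def mult.commute)

lemma cauchy_denom_nonzero: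
  assumes "w \<in> polydisc" "z \<in> closed_polydisc"
  shows "1 - z $ j * cnj (w $ j) \<noteq> 0" "1 - w $ j * cnj (z $ j) \<noteq> 0"
proof -
  have n: "norm (w $ j) < 1" "norm (z $ j) \<le> 1"
    using assms by (auto simp: polydisc_def closed_polydisc_def)
  show "1 - z $ j * cnj (w $ j) \<noteq> 0"
    using one_minus_mult_nonzero[of "cnj (w $ j)" "z $ j"] n by (simp add: mult.commute)
  show "1 - w $ j * cnj (z $ j) \<noteq> 0"
    using n by (intro one_minus_mult_nonzero) auto
qed

lemma cauchy_kernel_holomorphic:
  fixes w :: "complex^'n"
  assumes "w \<in> polydisc"
  shows "holomorphic_several_on (\<lambda>z. cauchy_kernel z w) closed_polydisc"
proof -
  have "holomorphic_several_on (\<lambda>z. \<Prod>j\<in>UNIV. inverse (1 + (- cnj (w $ j)) * z $ j)) closed_polydisc"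
    by (intro holomorphic_several_on_prod holomorphic_several_on_inverse holomorphic_several_on_add
        holomorphic_several_on_const holomorphic_several_on_cmult holomorphic_several_on_component)
      (use cauchy_denom_nonzero(1)[OF assms] in \<open>auto simp: mult.commute\<close>)
  then show ?thesis
    by (simp add: cauchy_kernel_def inverse_eq_divide mult.commute)
qed

lemma cauchy_kernel_continuous:
  assumes "w \<in> polydisc"
  shows "continuous_on closed_polydisc (\<lambda>z. cauchy_kernel z w)"
    "continuous_on closed_polydisc (\<lambda>z. cauchy_kernel w z)"
proof -
  show 1: "continuous_on closed_polydisc (\<lambda>z. cauchy_kernel z w)"
    using cauchy_kernel_holomorphic[OF assms] by (rule holomorphic_several_on_imp_continuous_on)
  show "continuous_on closed_polydisc (\<lambda>z. cauchy_kernel w z)"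
    by (subst cauchy_kernel_cnj[symmetric]) (intro continuous_intros 1)
qed

lemma cauchy_kernel_nonzero:
  assumes "w \<in> polydisc" "z \<in> closed_polydisc"
  shows "cauchy_kernel z w \<noteq> 0"
  using cauchy_denom_nonzero[OF assms] by (simp add: cauchy_kernel_def)

text \<open>S is the set of coordinates that are integrated, the others being frozen at w. The
  integral does not depend on S: it is f w for S empty and the claim for S = UNIV, and adding a
  coordinate is the one-variable formula.\<close>

lemma torus_Cauchy_formula:
  fixes f :: "complex^'n \<Rightarrow> complex"
  assumes f: "holomorphic_several_on f closed_polydisc" and w: "w \<in> polydisc"
  shows "(\<integral>\<eta>. f \<eta> * cauchy_kernel w \<eta> \<partial>torus_measure) = f w"
proof -
  define m :: "'n set \<Rightarrow> complex^'n \<Rightarrow> complex^'n" where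
    "m S \<eta> = (\<chi> i. if i \<in> S then \<eta> $ i else w $ i)" for S \<eta>
  define u where "u S \<eta> = f (m S \<eta>) * (\<Prod>j\<in>S. 1 / (1 - w $ j * cnj (\<eta> $ j)))" for S \<eta>
  have w1: "norm (w $ j) < 1" for j using w by (simp add: polydisc_def)
  have contf: "continuous_on closed_polydisc f"
    by (rule holomorphic_several_on_imp_continuous_on[OF f])
  have m_closed: "m S \<eta> \<in> closed_polydisc" if "\<eta> \<in> torus" for S \<eta>
    using that w1 by (auto simp: m_def closed_polydisc_def torus_def less_imp_le)
  have cont_m: "continuous_on A (m S)" for A S
    unfolding m_def
  proof (rule continuous_on_vec_lambda)
    fix i show "continuous_on A (\<lambda>\<eta>. if i \<in> S then \<eta> $ i else w $ i)"
      by (cases "i \<in> S") (auto intro!: continuous_intros)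
  qed
  have cont_u: "continuous_on torus (u S)" for S
    unfolding u_def using cauchy_denom_nonzero(2)[OF w] torus_subset_closed
    by (intro continuous_intros continuous_on_compose2[OF contf cont_m])
      (auto simp: m_closed subset_iff)
  have "(\<integral>\<eta>. u S \<eta> \<partial>torus_measure) = f w" if "finite S" for S
    using that
  proof (induction S rule: finite_induct)
    case empty
    have "m {} \<eta> = w" for \<eta> by (simp add: m_def vec_eq_iff)
    then show ?case by (simp add: u_def)
  next
    case (insert j S)
    have "(\<integral>\<eta>. u (insert j S) \<eta> \<partial>torus_measure) = (\<integral>\<eta>. u S \<eta> \<partial>torus_measure)"
    proof (rule integral_torus_eqI[OF cont_u cont_u, where j=j])
      fix \<zeta> :: "complex^'n" assume \<zeta>: "\<zeta> \<in> torus"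
      \<comment> \<open>The line through \<open>m S \<zeta>\<close> in direction j, normalized to
        have coordinate j equal to its parameter: the parameter cis t gives the integrand for
        \<open>insert j S\<close>, the parameter w_j the one for S.\<close>
      define a where "a = (\<chi> i. if i = j then 0 else m S \<zeta> $ i)"
      define F where "F y = f (a + y *s axis j 1)" for y
      define q where "q = (\<Prod>i\<in>S. 1 / (1 - w $ i * cnj (\<zeta> $ i)))"
      have line: "a + y *s axis j 1 = (\<chi> i. if i = j then y else m S \<zeta> $ i)" for y
        by (simp add: a_def vec_eq_iff axis_def)
      have in_closed: "a + y *s axis j 1 \<in> closed_polydisc" if "norm y \<le> 1" for y
        unfolding line using that m_closed[OF \<zeta>, of S] by (auto simp: closed_polydisc_def)
      have hol: "F holomorphic_on cball 0 1"
        unfolding F_def by (rule holomorphic_on_line[OF f]) (use in_closed in auto)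
      have 1: "u (insert j S) (\<chi> i. if i = j then cis t else \<zeta> $ i)
          = q * (F (cis t) / (1 - w $ j * cnj (cis t)))" for t
      proof -
        have "m (insert j S) (\<chi> i. if i = j then cis t else \<zeta> $ i) = a + cis t *s axis j 1"
          unfolding line by (auto simp: m_def vec_eq_iff)
        moreover have "(\<Prod>i\<in>S. 1 / (1 - w $ i * cnj ((\<chi> i. if i = j then cis t else \<zeta> $ i) $ i))) = q"
          unfolding q_def using insert.hyps by (intro prod.cong) auto
        ultimately show ?thesis using insert.hyps by (simp add: u_def F_def)
      qed
      have 2: "u S (\<chi> i. if i = j then cis t else \<zeta> $ i) = q * F (w $ j)" for t
      proof -
        have "m S (\<chi> i. if i = j then cis t else \<zeta> $ i) = a + (w $ j) *s axis j 1"
          unfolding line using insert.hyps by (auto simp: m_def vec_eq_iff)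
        moreover have "(\<Prod>i\<in>S. 1 / (1 - w $ i * cnj ((\<chi> i. if i = j then cis t else \<zeta> $ i) $ i))) = q"
          unfolding q_def using insert.hyps by (intro prod.cong) auto
        ultimately show ?thesis by (simp add: u_def F_def)
      qed
      have "(\<integral>t. F (cis t) / (1 - w $ j * cnj (cis t)) \<partial>angle_measure) = F (w $ j)"
        by (rule integral_circle_Cauchy)
          (use hol w1 in \<open>auto intro: holomorphic_on_imp_continuous_on holomorphic_on_subset\<close>)
      then show "(\<integral>t. u (insert j S) (\<chi> i. if i = j then cis t else \<zeta> $ i) \<partial>angle_measure) =
          (\<integral>t. u S (\<chi> i. if i = j then cis t else \<zeta> $ i) \<partial>angle_measure)"
        unfolding 1 2 by (simp only: integral_mult_right_zero) (simp add: measure_def)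
    qed
    with insert.IH show ?case by simp
  qed
  from this[of UNIV] show ?thesis
    by (simp add: u_def m_def cauchy_kernel_def)
qed

text \<open>Holds for every \<eta>, as a vanishing denominator makes both sides 0; so it can rewrite
  integrands without a side condition.\<close>

lemma poisson_cauchy:
  assumes w: "w \<in> polydisc"
  shows "complex_of_real (poisson_kernel w \<eta>) * cauchy_kernel w w = cauchy_kernel w \<eta> * cauchy_kernel \<eta> w"
proof -
  have *: "complex_of_real ((1 - (norm x)\<^sup>2) / (norm (1 - x * cnj y))\<^sup>2) * (1 / (1 - x * cnj x))
      = 1 / (1 - x * cnj y) * (1 / (1 - y * cnj x))" if x: "norm x < 1" for x y
  proof -
    have "(1 - complex_of_real ((norm x)\<^sup>2)) \<noteq> 0"
      using x by (metis abs_norm_cancel abs_square_less_1 diff_eq_diff_less_eq less_irrefl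
          of_real_1 of_real_eq_iff right_minus_eq)
    moreover have "x * cnj x = complex_of_real ((norm x)\<^sup>2)"
      by (rule complex_norm_square[symmetric])
    moreover have "complex_of_real ((norm (1 - x * cnj y))\<^sup>2) = (1 - x * cnj y) * (1 - y * cnj x)"
      by (subst complex_norm_square) (simp add: mult.commute)
    ultimately show ?thesis by simp
  qed
  show ?thesis
    unfolding poisson_kernel_def cauchy_kernel_def of_real_prod prod.distrib[symmetric]
    by (intro prod.cong refl *) (use w in \<open>simp add: polydisc_def\<close>)
qed

lemma poisson_kernel_continuous:
  assumes "w \<in> polydisc"
  shows "continuous_on closed_polydisc (\<lambda>\<eta>. poisson_kernel w \<eta>)"
  unfolding poisson_kernel_def
  by (intro continuous_intros) (use cauchy_denom_nonzero(2)[OF assms] in auto)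

text \<open>The Poisson formula is the Cauchy formula for \<open>f\<close> times the Cauchy kernel.\<close>

lemma torus_Poisson_formula:
  fixes f :: "complex^'n \<Rightarrow> complex"
  assumes f: "holomorphic_several_on f closed_polydisc" and w: "w \<in> polydisc"
  shows "(\<integral>\<eta>. complex_of_real (poisson_kernel w \<eta>) * f \<eta> \<partial>torus_measure) = f w"
proof -
  have "(\<integral>\<eta>. (f \<eta> * cauchy_kernel \<eta> w) * cauchy_kernel w \<eta> \<partial>torus_measure)
      = f w * cauchy_kernel w w"
    by (rule torus_Cauchy_formula[OF _ w])
      (intro holomorphic_several_on_mult f cauchy_kernel_holomorphic w)
  also have "(\<integral>\<eta>. (f \<eta> * cauchy_kernel \<eta> w) * cauchy_kernel w \<eta> \<partial>torus_measure)
      = (\<integral>\<eta>. (complex_of_real (poisson_kernel w \<eta>) * f \<eta>) * cauchy_kernel w w \<partial>torus_measure)"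
    by (intro Bochner_Integration.integral_cong refl)
      (metis poisson_cauchy[OF w] mult.commute mult.assoc)
  finally show ?thesis
    using cauchy_kernel_nonzero[OF w, of w] w polydisc_subset_closed by (auto simp: subset_iff)
qed

section \<open>The circle Poisson kernel: semigroup law and domination\<close>

definition circle_poisson :: "complex \<Rightarrow> complex \<Rightarrow> real" where
  "circle_poisson x y = (1 - (norm x)\<^sup>2) / (norm (1 - x * cnj y))\<^sup>2"

lemma poisson_kernel_prod: "poisson_kernel z w = (\<Prod>j\<in>UNIV. circle_poisson (z $ j) (w $ j))"
  by (simp add: poisson_kernel_def circle_poisson_def)

lemma circle_poisson_nonneg: "norm x \<le> 1 \<Longrightarrow> 0 \<le> circle_poisson x y"
  by (simp add: circle_poisson_def power_le_one)

text \<open>|1 - w cnj y|^2 is the Cauchy denominator times 1 - cnj w * y. The second factor is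
  holomorphic in y and is absorbed into F; at y = w it cancels the numerator 1 - |w|^2.\<close>

lemma circle_poisson_formula:
  assumes F: "F holomorphic_on cball 0 1" and w: "norm w < 1"
  shows "(\<integral>t. complex_of_real (circle_poisson w (cis t)) * F (cis t) \<partial>angle_measure) = F w"
proof -
  have nz: "1 - cnj w * y \<noteq> 0" if "norm y \<le> 1" for y
    using w that by (intro one_minus_mult_nonzero) auto
  define G where "G y = F y / (1 - cnj w * y)" for y
  have G: "G holomorphic_on cball 0 1"
    unfolding G_def using nz by (intro holomorphic_intros F) auto
  have "(\<integral>t. G (cis t) / (1 - w * cnj (cis t)) \<partial>angle_measure) = G w"
    by (rule integral_circle_Cauchy)
      (use G w in \<open>auto intro: holomorphic_on_imp_continuous_on holomorphic_on_subset\<close>)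
  moreover have "complex_of_real (circle_poisson w y) * F y
      = (1 - complex_of_real ((norm w)\<^sup>2)) * (G y / (1 - w * cnj y))" for y
  proof -
    have "complex_of_real ((norm (1 - w * cnj y))\<^sup>2) = (1 - w * cnj y) * (1 - cnj w * y)"
      by (subst complex_norm_square) simp
    then show ?thesis by (simp add: circle_poisson_def G_def)
  qed
  ultimately have "(\<integral>t. complex_of_real (circle_poisson w (cis t)) * F (cis t) \<partial>angle_measure)
      = (1 - complex_of_real ((norm w)\<^sup>2)) * G w"
    by (simp only: integral_mult_right_zero)
  moreover have "1 - complex_of_real ((norm w)\<^sup>2) = 1 - cnj w * w"
    by (subst complex_norm_square) (simp add: mult.commute)
  ultimately show ?thesis using nz[of w] w by (simp add: G_def)
qed

text \<open>For fixed \<omega> the kernel is harmonic in its first argument, being the real part of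
  (1 + c y) / (1 - c y) with c = b cnj \<omega>. This function is holomorphic on the closed disc
  because |c| = b < 1, so the Poisson formula reproduces it at x.\<close>

lemma circle_poisson_semigroup:
  assumes a: "norm x < 1" and b: "0 \<le> b" "b < 1" and \<omega>: "norm \<omega> = 1"
  shows "(\<integral>t. complex_of_real (circle_poisson x (cis t) * circle_poisson (b *\<^sub>R cis t) \<omega>) \<partial>angle_measure)
    = complex_of_real (circle_poisson (b *\<^sub>R x) \<omega>)"
proof -
  define c where "c = of_real b * cnj \<omega>"
  have c1: "norm c < 1" using b \<omega> by (simp add: c_def norm_mult)
  define F where "F y = (1 + c * y) / (1 - c * y)" for y
  have nz: "1 - c * y \<noteq> 0" if "norm y \<le> 1" for y
    using c1 that by (rule one_minus_mult_nonzero)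
  have F: "F holomorphic_on cball 0 1"
    unfolding F_def using nz by (intro holomorphic_intros) auto
  have Re_F: "Re (F y) = circle_poisson (b *\<^sub>R y) \<omega>" for y
  proof -
    have "b *\<^sub>R y * cnj \<omega> = c * y" by (simp add: c_def scaleR_conv_of_real mult.commute mult.left_commute)
    moreover have "norm (b *\<^sub>R y) = norm (c * y)" using b \<omega> by (simp add: c_def norm_mult)
    moreover have "Re ((1 + u) / (1 - u)) = (1 - (norm u)\<^sup>2) / (norm (1 - u))\<^sup>2" for u
      unfolding Re_divide cmod_power2 by (simp add: power2_eq_square algebra_simps)
    ultimately show ?thesis by (simp add: F_def circle_poisson_def)
  qed
  have cont: "continuous_on (sphere 0 1) (\<lambda>y. complex_of_real (circle_poisson x y) * F y)"
  proof -
    have "continuous_on (sphere 0 1) F"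
      using F by (auto intro: holomorphic_on_imp_continuous_on continuous_on_subset)
    moreover have "1 - x * cnj y \<noteq> 0" if "norm y = 1" for y
      using a that by (intro one_minus_mult_nonzero) auto
    ultimately show ?thesis
      unfolding circle_poisson_def by (intro continuous_intros) auto
  qed
  have int: "integrable angle_measure (\<lambda>t. complex_of_real (circle_poisson x (cis t)) * F (cis t))"
  proof -
    have "continuous_on UNIV (\<lambda>t. complex_of_real (circle_poisson x (cis t)) * F (cis t))"
      by (intro continuous_on_compose2[OF cont] continuous_intros) auto
    moreover obtain B where "\<And>z. z \<in> sphere 0 1 \<Longrightarrow> norm (complex_of_real (circle_poisson x z) * F z) \<le> B"
      using compact_imp_bounded[OF compact_continuous_image[OF cont compact_sphere]]
      unfolding bounded_iff by (metis imageI)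
    ultimately show ?thesis
      by (intro angle.integrable_const_bound[where B=B])
        (auto intro!: AE_I2 cong: measurable_cong_sets simp: borel_measurable_continuous_onI)
  qed
  have "(\<integral>t. circle_poisson x (cis t) * circle_poisson (b *\<^sub>R cis t) \<omega> \<partial>angle_measure)
      = (\<integral>t. Re (complex_of_real (circle_poisson x (cis t)) * F (cis t)) \<partial>angle_measure)"
    by (simp add: Re_F)
  also have "\<dots> = Re (F x)"
    using integral_Re[OF int] circle_poisson_formula[OF F a] by simp
  finally show ?thesis by (simp only: integral_complex_of_real Re_F)
qed

lemma circle_poisson_continuous:
  assumes "norm x < 1"
  shows "continuous_on (sphere 0 1) (circle_poisson x)"
proof -
  have "1 - x * cnj y \<noteq> 0" if "norm y = 1" for y
    using assms that by (intro one_minus_mult_nonzero) auto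
  then show ?thesis
    unfolding circle_poisson_def by (intro continuous_intros) auto
qed

lemma circle_poisson_continuous2:
  assumes "0 \<le> b" "b < 1" "norm \<omega> = 1"
  shows "continuous_on (sphere 0 1) (\<lambda>y. circle_poisson (b *\<^sub>R y) \<omega>)"
proof -
  have "1 - b *\<^sub>R y * cnj \<omega> \<noteq> 0" if "norm y = 1" for y
    using assms that by (intro one_minus_mult_nonzero) auto
  then show ?thesis
    unfolding circle_poisson_def by (intro continuous_intros) auto
qed

text \<open>The numerators depend on a alone, and interchanging \<zeta> and \<eta> conjugates the
  denominators. This is what makes the Poisson operators symmetric.\<close>

lemma poisson_kernel_sym:
  assumes "\<zeta> \<in> torus" "\<eta> \<in> torus"
  shows "poisson_kernel (a *\<^sub>R \<zeta>) \<eta> = poisson_kernel (a *\<^sub>R \<eta>) \<zeta>"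
  unfolding poisson_kernel_prod
proof (intro prod.cong refl)
  fix j
  have "cnj (1 - (a *\<^sub>R \<zeta>) $ j * cnj (\<eta> $ j)) = 1 - (a *\<^sub>R \<eta>) $ j * cnj (\<zeta> $ j)"
    by (simp add: scaleR_conv_of_real[where 'a=complex] mult.commute mult.left_commute)
  then have "norm (1 - (a *\<^sub>R \<zeta>) $ j * cnj (\<eta> $ j)) = norm (1 - (a *\<^sub>R \<eta>) $ j * cnj (\<zeta> $ j))"
    by (metis complex_mod_cnj)
  with assms show "circle_poisson ((a *\<^sub>R \<zeta>) $ j) (\<eta> $ j) = circle_poisson ((a *\<^sub>R \<eta>) $ j) (\<zeta> $ j)"
    by (simp add: circle_poisson_def torus_def)
qed

lemma poisson_kernel_nonneg: "w \<in> polydisc \<Longrightarrow> 0 \<le> poisson_kernel w \<eta>"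
  unfolding poisson_kernel_prod
  by (intro prod_nonneg circle_poisson_nonneg) (auto simp: polydisc_def less_imp_le)

lemma scaled_torus_polydisc: "0 \<le> a \<Longrightarrow> a < 1 \<Longrightarrow> \<zeta> \<in> torus \<Longrightarrow> a *\<^sub>R \<zeta> \<in> polydisc"
  using scale_polydisc torus_subset_closed by blast

lemma nn_integral_torus_continuous:
  assumes "continuous_on torus (u :: complex^'n \<Rightarrow> real)" "\<And>\<eta>. \<eta> \<in> torus \<Longrightarrow> 0 \<le> u \<eta>"
    and "(\<integral>\<eta>. complex_of_real (u \<eta>) \<partial>torus_measure) = complex_of_real c"
  shows "(\<integral>\<^sup>+\<eta>. ennreal (u \<eta>) \<partial>torus_measure) = ennreal c"
proof -
  have "(\<integral>\<eta>. u \<eta> \<partial>torus_measure) = c" using assms(3) by (simp only: integral_complex_of_real of_real_eq_iff)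
  then show ?thesis
    using assms(2) by (subst nn_integral_eq_integral)
      (auto intro!: integrable_on_torus[OF assms(1)] AE_I2 simp: torus.finite_measure_axioms)
qed

lemma poisson_kernel_mass:
  assumes "w \<in> polydisc"
  shows "(\<integral>\<^sup>+\<eta>. ennreal (poisson_kernel w \<eta>) \<partial>torus_measure) = 1"
proof -
  have "continuous_on torus (\<lambda>\<eta>. poisson_kernel w \<eta>)"
    using poisson_kernel_continuous[OF assms] torus_subset_closed continuous_on_subset by blast
  from nn_integral_torus_continuous[OF this, of 1] show ?thesis
    using torus_Poisson_formula[OF holomorphic_several_on_const[of 1] assms] poisson_kernel_nonneg[OF assms]
    by simp
qed

text \<open>Both kernels are products over the coordinates, so the integral factors into circle
  integrals.\<close>

lemma poisson_kernel_semigroup: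
  fixes \<zeta> \<omega> :: "complex^'n"
  assumes a: "0 \<le> a" "a < 1" and b: "0 \<le> b" "b < 1" and \<zeta>: "\<zeta> \<in> torus" and \<omega>: "\<omega> \<in> torus"
  shows "(\<integral>\<^sup>+\<eta>. ennreal (poisson_kernel (a *\<^sub>R \<zeta>) \<eta>) * ennreal (poisson_kernel (b *\<^sub>R \<eta>) \<omega>) \<partial>torus_measure)
    = ennreal (poisson_kernel ((a * b) *\<^sub>R \<zeta>) \<omega>)"
proof -
  define u :: "complex^'n \<Rightarrow> real" where "u \<eta> = poisson_kernel (a *\<^sub>R \<zeta>) \<eta> * poisson_kernel (b *\<^sub>R \<eta>) \<omega>" for \<eta>
  define h where "h j y = complex_of_real (circle_poisson (a *\<^sub>R (\<zeta> $ j)) y * circle_poisson (b *\<^sub>R y) (\<omega> $ j))" for j y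
  have n: "norm (a *\<^sub>R (\<zeta> $ j)) < 1" "norm (\<omega> $ j) = 1" for j
    using a \<zeta> \<omega> by (auto simp: torus_def)
  have cont_h: "continuous_on (sphere 0 1) (h j)" for j
    unfolding h_def by (intro continuous_intros circle_poisson_continuous circle_poisson_continuous2 n b)
  have uh: "complex_of_real (u \<eta>) = (\<Prod>j\<in>UNIV. h j (\<eta> $ j))" for \<eta>
    by (simp add: u_def h_def poisson_kernel_prod prod.distrib)
  have int: "(\<integral>\<eta>. complex_of_real (u \<eta>) \<partial>torus_measure) = complex_of_real (poisson_kernel ((a * b) *\<^sub>R \<zeta>) \<omega>)"
    unfolding uh integral_torus_prod[OF cont_h] unfolding h_def
    by (subst circle_poisson_semigroup[OF n(1) b n(2)])
      (simp add: poisson_kernel_prod mult.commute)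
  have u0: "0 \<le> u \<eta>" if "\<eta> \<in> torus" for \<eta>
    unfolding u_def
    by (intro mult_nonneg_nonneg poisson_kernel_nonneg scaled_torus_polydisc a b \<zeta> that)
  have "continuous_on torus (\<lambda>\<eta>. complex_of_real (u \<eta>))"
    unfolding uh
    by (intro continuous_on_prod continuous_on_compose2[OF cont_h] continuous_intros) (auto simp: torus_def)
  then have "continuous_on torus (\<lambda>\<eta>. Re (complex_of_real (u \<eta>)))"
    by (rule continuous_on_Re)
  then have "continuous_on torus u" by (simp only: Re_complex_of_real)
  then have "(\<integral>\<^sup>+\<eta>. ennreal (u \<eta>) \<partial>torus_measure) = ennreal (poisson_kernel ((a * b) *\<^sub>R \<zeta>) \<omega>)"
    using u0 int by (intro nn_integral_torus_continuous) auto
  moreover have "(\<integral>\<^sup>+\<eta>. ennreal (poisson_kernel (a *\<^sub>R \<zeta>) \<eta>) * ennreal (poisson_kernel (b *\<^sub>R \<eta>) \<omega>) \<partial>torus_measure)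
      = (\<integral>\<^sup>+\<eta>. ennreal (u \<eta>) \<partial>torus_measure)"
  proof (rule nn_integral_cong)
    fix \<eta> :: "complex^'n" assume "\<eta> \<in> space torus_measure"
    then show "ennreal (poisson_kernel (a *\<^sub>R \<zeta>) \<eta>) * ennreal (poisson_kernel (b *\<^sub>R \<eta>) \<omega>) = ennreal (u \<eta>)"
      unfolding u_def using scaled_torus_polydisc[OF a \<zeta>]
      by (intro ennreal_mult'[symmetric] poisson_kernel_nonneg) auto
  qed
  ultimately show ?thesis by simp
qed

text \<open>With s = a b the constant is 2 * 4. The numerators satisfy 1 - s^2 \<le> 1 - a^4 \<le> 2
  (1 - a^2), since s \<ge> a^2. For the denominators, |1 - a u| \<le> |1 - s u| + (a - s), and a - s
  \<le> 1 - s \<le> |1 - s u|; squaring the factor 2 gives 4.\<close>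

lemma circle_poisson_dominated:
  assumes a: "0 \<le> a" "a \<le> b" "b < 1" and y: "norm y = 1" and z: "norm z = 1"
  shows "circle_poisson ((a * b) *\<^sub>R y) z \<le> 8 * circle_poisson (a *\<^sub>R y) z"
proof -
  define u where "u = y * cnj z"
  define s where "s = a * b"
  have u: "norm u = 1" using y z by (simp add: u_def norm_mult)
  have s: "a * a \<le> s" "s \<le> a" "0 \<le> s" "s < 1"
    using a unfolding s_def by (auto intro: mult_left_mono mult_left_le order_le_less_trans[OF mult_left_le])
  have P: "circle_poisson (c *\<^sub>R y) z = (1 - c\<^sup>2) / (norm (1 - c *\<^sub>R u))\<^sup>2" for c
    using y by (simp add: circle_poisson_def u_def)
  have lower: "1 - c \<le> norm (1 - c *\<^sub>R u)" if "0 \<le> c" for c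
    using norm_triangle_ineq2[of 1 "c *\<^sub>R u"] u that by simp
  have "norm (1 - a *\<^sub>R u) \<le> norm (1 - s *\<^sub>R u) + norm ((s - a) *\<^sub>R u)"
    using norm_triangle_ineq[of "1 - s *\<^sub>R u" "(s - a) *\<^sub>R u"] by (simp add: algebra_simps)
  also have "norm ((s - a) *\<^sub>R u) = a - s" using s u by simp
  also have "a - s \<le> 1 - s" using a by simp
  also have "1 - s \<le> norm (1 - s *\<^sub>R u)" using lower s by simp
  finally have le2: "norm (1 - a *\<^sub>R u) \<le> 2 * norm (1 - s *\<^sub>R u)" by simp
  have pa: "0 < norm (1 - a *\<^sub>R u)" using lower[of a] a by linarith
  have ps: "0 < norm (1 - s *\<^sub>R u)" using lower[of s] s by linarith
  have "1 - s\<^sup>2 \<le> 1 - (a\<^sup>2)\<^sup>2"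
    using power_mono[OF s(1), of 2] a by (simp add: power2_eq_square)
  also have "\<dots> = (1 - a\<^sup>2) * (1 + a\<^sup>2)" by (simp add: algebra_simps power2_eq_square)
  also have "\<dots> \<le> (1 - a\<^sup>2) * 2"
    using a by (intro mult_left_mono) (auto simp: power_le_one)
  finally have num: "1 - s\<^sup>2 \<le> 2 * (1 - a\<^sup>2)" by simp
  have a2: "0 \<le> 1 - a\<^sup>2" using a by (simp add: power_le_one)
  have "(norm (1 - a *\<^sub>R u))\<^sup>2 \<le> 4 * (norm (1 - s *\<^sub>R u))\<^sup>2"
    using power_mono[OF le2, of 2] by (simp add: power_mult_distrib)
  then have "(1 - s\<^sup>2) * (norm (1 - a *\<^sub>R u))\<^sup>2 \<le> (2 * (1 - a\<^sup>2)) * (4 * (norm (1 - s *\<^sub>R u))\<^sup>2)"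
    using num a2 by (intro mult_mono) auto
  then have "(1 - s\<^sup>2) / (norm (1 - s *\<^sub>R u))\<^sup>2 \<le> 8 * ((1 - a\<^sup>2) / (norm (1 - a *\<^sub>R u))\<^sup>2)"
    using pa ps by (simp add: field_simps)
  then show ?thesis unfolding P s_def .
qed

text \<open>The kernel of the smaller radius alone dominates; the sum makes the bound symmetric in a
  and b. As that radius is the same in all coordinates, the product of the one-variable bounds is
  again a Poisson kernel.\<close>

lemma poisson_kernel_dominated:
  fixes \<zeta> \<eta> :: "complex^'n"
  assumes a: "0 \<le> a" "a < 1" and b: "0 \<le> b" "b < 1" and \<zeta>: "\<zeta> \<in> torus" and \<eta>: "\<eta> \<in> torus"
  shows "poisson_kernel ((a * b) *\<^sub>R \<zeta>) \<eta> \<le> 8 ^ CARD('n) * (poisson_kernel (a *\<^sub>R \<zeta>) \<eta> + poisson_kernel (b *\<^sub>R \<zeta>) \<eta>)"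
proof -
  have *: "poisson_kernel ((a * b) *\<^sub>R \<zeta>) \<eta> \<le> 8 ^ CARD('n) * poisson_kernel (a *\<^sub>R \<zeta>) \<eta>"
    if "0 \<le> a" "a \<le> b" "b < 1" for a b
  proof -
    have "poisson_kernel ((a * b) *\<^sub>R \<zeta>) \<eta> \<le> (\<Prod>j\<in>UNIV. 8 * circle_poisson ((a *\<^sub>R \<zeta>) $ j) (\<eta> $ j))"
      unfolding poisson_kernel_prod
    proof (intro prod_mono conjI)
      fix j
      have "a * b \<le> 1" using that by (intro mult_le_one) auto
      then show "0 \<le> circle_poisson (((a * b) *\<^sub>R \<zeta>) $ j) (\<eta> $ j)"
        using \<zeta> that by (intro circle_poisson_nonneg) (simp add: torus_def)
      show "circle_poisson (((a * b) *\<^sub>R \<zeta>) $ j) (\<eta> $ j) \<le> 8 * circle_poisson ((a *\<^sub>R \<zeta>) $ j) (\<eta> $ j)"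
        using circle_poisson_dominated[OF that] \<zeta> \<eta> by (simp add: torus_def)
    qed
    then show ?thesis by (simp add: poisson_kernel_prod prod.distrib)
  qed
  have "0 \<le> poisson_kernel (a *\<^sub>R \<zeta>) \<eta>" "0 \<le> poisson_kernel (b *\<^sub>R \<zeta>) \<eta>"
    using poisson_kernel_nonneg scaled_torus_polydisc a b \<zeta> by blast+
  then show ?thesis
    using *[of a b] *[of b a] a b by (cases "a \<le> b") (auto simp: distrib_left mult.commute[of b a] intro: order_trans)
qed

section \<open>The Poisson semigroup and its maximal inequality\<close>

interpretation torus_pair: pair_sigma_finite
    "torus_measure :: (complex^'n) measure" "torus_measure :: (complex^'n) measure"
  by standard

lemma measurable_torus_id [measurable]: "(\<lambda>x. x) \<in> borel_measurable (torus_measure :: (complex^'n) measure)"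
  by (subst measurable_cong_sets[OF sets_torus_measure refl], rule measurable_restrict_space1) simp

lemma poisson_kernel_measurable [measurable]:
  assumes [measurable]: "f \<in> borel_measurable N" "g \<in> borel_measurable N"
  shows "(\<lambda>x. poisson_kernel (f x) (g x)) \<in> borel_measurable N"
proof -
  have nth[measurable]: "(\<lambda>z::complex^'n. z $ j) \<in> borel_measurable borel" for j
    by (intro borel_measurable_continuous_onI continuous_intros)
  show ?thesis unfolding poisson_kernel_def by measurable
qed

lemma poisson_kernel_le:
  fixes \<zeta> \<eta> :: "complex^'n"
  assumes "0 \<le> q" "q < 1" "\<zeta> \<in> torus" "\<eta> \<in> torus"
  shows "poisson_kernel (q *\<^sub>R \<zeta>) \<eta> \<le> (1 / (1 - q)\<^sup>2) ^ CARD('n)"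
proof -
  have "circle_poisson ((q *\<^sub>R \<zeta>) $ j) (\<eta> $ j) \<le> 1 / (1 - q)\<^sup>2" for j
  proof -
    have "norm ((q *\<^sub>R \<zeta>) $ j * cnj (\<eta> $ j)) = q"
      using assms by (simp add: norm_mult torus_def)
    then have "1 - q \<le> norm (1 - (q *\<^sub>R \<zeta>) $ j * cnj (\<eta> $ j))"
      using norm_triangle_ineq2[of 1 "(q *\<^sub>R \<zeta>) $ j * cnj (\<eta> $ j)"] by simp
    then have "(1 - q)\<^sup>2 \<le> (norm (1 - (q *\<^sub>R \<zeta>) $ j * cnj (\<eta> $ j)))\<^sup>2"
      using assms by (intro power_mono) auto
    then show ?thesis
      unfolding circle_poisson_def using assms by (intro frac_le) auto
  qed
  then have "poisson_kernel (q *\<^sub>R \<zeta>) \<eta> \<le> (\<Prod>j\<in>(UNIV::'n set). 1 / (1 - q)\<^sup>2)"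
    unfolding poisson_kernel_prod
    using assms by (intro prod_mono conjI circle_poisson_nonneg) (auto simp: torus_def)
  then show ?thesis by simp
qed

text \<open>Values in \<open>ennreal\<close> let Tonelli's theorem be used with measurability as the
  only condition.\<close>

definition poisson_op :: "real \<Rightarrow> (complex^'n \<Rightarrow> ennreal) \<Rightarrow> complex^'n \<Rightarrow> ennreal" where
  "poisson_op q g \<zeta> = (\<integral>\<^sup>+\<eta>. ennreal (poisson_kernel (q *\<^sub>R \<zeta>) \<eta>) * g \<eta> \<partial>torus_measure)"

lemma poisson_op_measurable [measurable]:
  assumes [measurable]: "g \<in> borel_measurable torus_measure"
  shows "poisson_op q g \<in> borel_measurable torus_measure"
  unfolding poisson_op_def by measurable

lemma poisson_op_symmetric:
  fixes g h :: "complex^'n \<Rightarrow> ennreal"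
  assumes [measurable]: "g \<in> borel_measurable torus_measure" "h \<in> borel_measurable torus_measure"
  shows "(\<integral>\<^sup>+\<zeta>. g \<zeta> * poisson_op q h \<zeta> \<partial>torus_measure) = (\<integral>\<^sup>+\<zeta>. poisson_op q g \<zeta> * h \<zeta> \<partial>torus_measure)"
proof -
  have "(\<integral>\<^sup>+\<zeta>. g \<zeta> * poisson_op q h \<zeta> \<partial>torus_measure)
      = (\<integral>\<^sup>+\<zeta>. (\<integral>\<^sup>+\<eta>. g \<zeta> * (ennreal (poisson_kernel (q *\<^sub>R \<zeta>) \<eta>) * h \<eta>) \<partial>torus_measure) \<partial>torus_measure)"
    unfolding poisson_op_def by (intro nn_integral_cong nn_integral_cmult[symmetric]) measurable
  also have "\<dots> = (\<integral>\<^sup>+\<eta>. (\<integral>\<^sup>+\<zeta>. g \<zeta> * (ennreal (poisson_kernel (q *\<^sub>R \<zeta>) \<eta>) * h \<eta>) \<partial>torus_measure) \<partial>torus_measure)"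
    by (rule torus_pair.Fubini') measurable
  also have "\<dots> = (\<integral>\<^sup>+\<eta>. (\<integral>\<^sup>+\<zeta>. ennreal (poisson_kernel (q *\<^sub>R \<eta>) \<zeta>) * g \<zeta> * h \<eta> \<partial>torus_measure) \<partial>torus_measure)"
  proof (intro nn_integral_cong)
    fix \<zeta> \<eta> :: "complex^'n" assume "\<zeta> \<in> space torus_measure" "\<eta> \<in> space torus_measure"
    then show "g \<zeta> * (ennreal (poisson_kernel (q *\<^sub>R \<zeta>) \<eta>) * h \<eta>) = ennreal (poisson_kernel (q *\<^sub>R \<eta>) \<zeta>) * g \<zeta> * h \<eta>"
      using poisson_kernel_sym[of \<zeta> \<eta> q] by (simp add: mult_ac)
  qed
  also have "\<dots> = (\<integral>\<^sup>+\<zeta>. poisson_op q g \<zeta> * h \<zeta> \<partial>torus_measure)"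
    unfolding poisson_op_def by (intro nn_integral_cong nn_integral_multc) measurable
  finally show ?thesis .
qed

lemma poisson_op_semigroup:
  fixes g :: "complex^'n \<Rightarrow> ennreal"
  assumes [measurable]: "g \<in> borel_measurable torus_measure"
    and a: "0 \<le> a" "a < 1" and b: "0 \<le> b" "b < 1" and \<zeta>: "\<zeta> \<in> torus"
  shows "poisson_op a (poisson_op b g) \<zeta> = poisson_op (a * b) g \<zeta>"
proof -
  have "poisson_op a (poisson_op b g) \<zeta>
      = (\<integral>\<^sup>+\<eta>. (\<integral>\<^sup>+\<omega>. ennreal (poisson_kernel (a *\<^sub>R \<zeta>) \<eta>) * (ennreal (poisson_kernel (b *\<^sub>R \<eta>) \<omega>) * g \<omega>) \<partial>torus_measure) \<partial>torus_measure)"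
    unfolding poisson_op_def by (intro nn_integral_cong nn_integral_cmult[symmetric]) measurable
  also have "\<dots> = (\<integral>\<^sup>+\<omega>. (\<integral>\<^sup>+\<eta>. ennreal (poisson_kernel (a *\<^sub>R \<zeta>) \<eta>) * (ennreal (poisson_kernel (b *\<^sub>R \<eta>) \<omega>) * g \<omega>) \<partial>torus_measure) \<partial>torus_measure)"
    by (rule torus_pair.Fubini') measurable
  also have "\<dots> = (\<integral>\<^sup>+\<omega>. (\<integral>\<^sup>+\<eta>. ennreal (poisson_kernel (a *\<^sub>R \<zeta>) \<eta>) * ennreal (poisson_kernel (b *\<^sub>R \<eta>) \<omega>) \<partial>torus_measure) * g \<omega> \<partial>torus_measure)"
    by (simp add: mult.assoc[symmetric] nn_integral_multc)
  also have "\<dots> = poisson_op (a * b) g \<zeta>"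
    unfolding poisson_op_def
    by (intro nn_integral_cong) (simp add: poisson_kernel_semigroup[OF a b \<zeta>])
  finally show ?thesis .
qed

lemma poisson_op_dominated:
  fixes g :: "complex^'n \<Rightarrow> ennreal"
  assumes [measurable]: "g \<in> borel_measurable torus_measure"
    and a: "0 \<le> a" "a < 1" and b: "0 \<le> b" "b < 1" and \<zeta>: "\<zeta> \<in> torus"
  shows "poisson_op (a * b) g \<zeta> \<le> 8 ^ CARD('n) * (poisson_op a g \<zeta> + poisson_op b g \<zeta>)"
proof -
  have "poisson_op (a * b) g \<zeta> \<le> (\<integral>\<^sup>+\<eta>. 8 ^ CARD('n) * (ennreal (poisson_kernel (a *\<^sub>R \<zeta>) \<eta>) * g \<eta>
      + ennreal (poisson_kernel (b *\<^sub>R \<zeta>) \<eta>) * g \<eta>) \<partial>torus_measure)"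
    unfolding poisson_op_def
  proof (rule nn_integral_mono)
    fix \<eta> :: "complex^'n" assume "\<eta> \<in> space torus_measure"
    then have \<eta>: "\<eta> \<in> torus" by simp
    have nn: "0 \<le> poisson_kernel (a *\<^sub>R \<zeta>) \<eta>" "0 \<le> poisson_kernel (b *\<^sub>R \<zeta>) \<eta>"
      by (intro poisson_kernel_nonneg scaled_torus_polydisc a b \<zeta>)+
    have "ennreal (poisson_kernel ((a * b) *\<^sub>R \<zeta>) \<eta>)
        \<le> ennreal (8 ^ CARD('n) * (poisson_kernel (a *\<^sub>R \<zeta>) \<eta> + poisson_kernel (b *\<^sub>R \<zeta>) \<eta>))"
      by (intro ennreal_leI poisson_kernel_dominated a b \<zeta> \<eta>)
    also have "\<dots> = 8 ^ CARD('n) * (ennreal (poisson_kernel (a *\<^sub>R \<zeta>) \<eta>) + ennreal (poisson_kernel (b *\<^sub>R \<zeta>) \<eta>))"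
      using nn by (simp add: ennreal_mult' ennreal_plus flip: ennreal_power)
    finally have "ennreal (poisson_kernel ((a * b) *\<^sub>R \<zeta>) \<eta>) * g \<eta> \<le> \<dots> * g \<eta>"
      by (rule mult_right_mono) simp
    then show "ennreal (poisson_kernel ((a * b) *\<^sub>R \<zeta>) \<eta>) * g \<eta> \<le> 8 ^ CARD('n) * (ennreal (poisson_kernel (a *\<^sub>R \<zeta>) \<eta>) * g \<eta>
      + ennreal (poisson_kernel (b *\<^sub>R \<zeta>) \<eta>) * g \<eta>)"
      by (simp add: mult.assoc distrib_right)
  qed
  also have "\<dots> = 8 ^ CARD('n) * (poisson_op a g \<zeta> + poisson_op b g \<zeta>)"
    unfolding poisson_op_def by (simp add: nn_integral_cmult nn_integral_add)
  finally show ?thesis .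
qed

lemma poisson_op_const:
  assumes "0 \<le> q" "q < 1" "\<zeta> \<in> torus"
  shows "poisson_op q (\<lambda>_. c) \<zeta> = c"
  unfolding poisson_op_def
  by (simp add: nn_integral_multc poisson_kernel_mass[OF scaled_torus_polydisc[OF assms]])

lemma poisson_op_mono:
  "(\<And>\<eta>. \<eta> \<in> torus \<Longrightarrow> g \<eta> \<le> h \<eta>) \<Longrightarrow> poisson_op q g \<zeta> \<le> poisson_op q h \<zeta>"
  unfolding poisson_op_def by (intro nn_integral_mono mult_left_mono) auto

lemma poisson_op_Jensen:
  fixes g :: "complex^'n \<Rightarrow> ennreal"
  assumes [measurable]: "g \<in> borel_measurable torus_measure"
    and q: "0 \<le> q" "q < 1" and \<zeta>: "\<zeta> \<in> torus"
  shows "(poisson_op q g \<zeta>)\<^sup>2 \<le> poisson_op q (\<lambda>\<eta>. (g \<eta>)\<^sup>2) \<zeta>"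
proof -
  \<comment> \<open>The kernel is split into two square roots; Cauchy-Schwarz then leaves its total
    mass 1 as one factor.\<close>
  define s where "s \<eta> = ennreal (sqrt (poisson_kernel (q *\<^sub>R \<zeta>) \<eta>))" for \<eta>
  have s[measurable]: "s \<in> borel_measurable torus_measure" unfolding s_def by measurable
  have ss: "s \<eta> * s \<eta> = ennreal (poisson_kernel (q *\<^sub>R \<zeta>) \<eta>)" for \<eta>
    using poisson_kernel_nonneg[OF scaled_torus_polydisc[OF q \<zeta>], of \<eta>]
    by (simp add: s_def ennreal_mult'[symmetric])
  have "(poisson_op q g \<zeta>)\<^sup>2 = (\<integral>\<^sup>+\<eta>. s \<eta> * (s \<eta> * g \<eta>) \<partial>torus_measure)\<^sup>2"
    by (simp add: poisson_op_def ss mult.assoc[symmetric])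
  also have "\<dots> \<le> (\<integral>\<^sup>+\<eta>. (s \<eta>)\<^sup>2 \<partial>torus_measure) * (\<integral>\<^sup>+\<eta>. (s \<eta> * g \<eta>)\<^sup>2 \<partial>torus_measure)"
    by (rule Cauchy_Schwarz_nn_integral) measurable
  also have "(\<integral>\<^sup>+\<eta>. (s \<eta>)\<^sup>2 \<partial>torus_measure) = 1"
    by (simp add: power2_eq_square ss poisson_kernel_mass[OF scaled_torus_polydisc[OF q \<zeta>]])
  also have "(\<integral>\<^sup>+\<eta>. (s \<eta> * g \<eta>)\<^sup>2 \<partial>torus_measure) = poisson_op q (\<lambda>\<eta>. (g \<eta>)\<^sup>2) \<zeta>"
    by (simp add: poisson_op_def power_mult_distrib power2_eq_square[of "s _"] ss)
  finally show ?thesis by simp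
qed

text \<open>Symmetry, tested against A_q 1 = 1.\<close>

lemma poisson_op_nn_integral:
  fixes g :: "complex^'n \<Rightarrow> ennreal"
  assumes [measurable]: "g \<in> borel_measurable torus_measure" and q: "0 \<le> q" "q < 1"
  shows "(\<integral>\<^sup>+\<zeta>. poisson_op q g \<zeta> \<partial>torus_measure) = (\<integral>\<^sup>+\<zeta>. g \<zeta> \<partial>torus_measure)"
proof -
  have "(\<integral>\<^sup>+\<zeta>. poisson_op q g \<zeta> * 1 \<partial>torus_measure) = (\<integral>\<^sup>+\<zeta>. g \<zeta> * poisson_op q (\<lambda>_. 1) \<zeta> \<partial>torus_measure)"
    by (rule poisson_op_symmetric[symmetric]) measurable
  also have "\<dots> = (\<integral>\<^sup>+\<zeta>. g \<zeta> \<partial>torus_measure)"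
    by (intro nn_integral_cong) (simp add: poisson_op_const[OF q])
  finally show ?thesis by simp
qed

text \<open>The \<open>T T\<^sup>*\<close> method: let \<open>A\<^sub>i\<close> be the Poisson operator of radius \<open>r i\<close>, \<open>e\<^sub>i\<close> the indicator of \<open>E i\<close>
  and \<open>e\<close> their sum. For \<open>H = \<Sum>\<^sub>i A\<^sub>i e\<^sub>i\<close>, the adjoint of the linearized maximal operator applied to \<open>e\<close>,
  the semigroup law and the domination of the kernels give
  \<open>\<parallel>H\<parallel>\<^sup>2 = \<Sum>\<^sub>i\<^sub>j \<langle>A\<^sub>i A\<^sub>j e\<^sub>j, e\<^sub>i\<rangle> \<le> C \<langle>H, e\<rangle>\<close>.\<close>

lemma poisson_maximal_disjoint:
  fixes u :: "complex^'n \<Rightarrow> ennreal" and E :: "nat \<Rightarrow> (complex^'n) set"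
  assumes [measurable]: "u \<in> borel_measurable torus_measure"
    and r: "\<And>i. 0 \<le> r i" "\<And>i. r i < 1"
    and E[measurable]: "\<And>i. E i \<in> sets torus_measure" and disj: "disjoint_family E"
    and lower: "\<And>i \<zeta>. i < N \<Longrightarrow> \<zeta> \<in> E i \<Longrightarrow> l \<le> poisson_op (r i) u \<zeta>"
  shows "l\<^sup>2 * emeasure torus_measure (\<Union>i<N. E i)
    \<le> 4 * (8 ^ CARD('n))\<^sup>2 * (\<integral>\<^sup>+\<zeta>. (u \<zeta>)\<^sup>2 \<partial>torus_measure)"
proof -
  define e where "e i = (indicator (E i) :: complex^'n \<Rightarrow> ennreal)" for i
  define H where "H \<zeta> = (\<Sum>i<N. poisson_op (r i) (e i) \<zeta>)" for \<zeta>
  define ee where "ee = (indicator (\<Union>i<N. E i) :: complex^'n \<Rightarrow> ennreal)"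
  define c :: ennreal where "c = 8 ^ CARD('n)"
  define mE where "mE = emeasure torus_measure (\<Union>i<N. E i)"
  define HH where "HH = (\<integral>\<^sup>+\<zeta>. (H \<zeta>)\<^sup>2 \<partial>torus_measure)"
  have e[measurable]: "e i \<in> borel_measurable torus_measure" for i unfolding e_def by measurable
  have [measurable]: "H \<in> borel_measurable torus_measure" unfolding H_def by measurable
  have [measurable]: "ee \<in> borel_measurable torus_measure" unfolding ee_def by measurable
  have ee_sum: "ee \<zeta> = (\<Sum>i<N. e i \<zeta>)" for \<zeta>
    unfolding ee_def e_def
    by (rule indicator_UN_disjoint) (use disj in \<open>auto simp: disjoint_family_on_def\<close>)
  have mE_eq: "mE = (\<integral>\<^sup>+\<zeta>. ee \<zeta> \<partial>torus_measure)"
    unfolding mE_def ee_def by (rule nn_integral_indicator[symmetric]) measurable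
  have mE_fin: "mE \<noteq> \<infinity>" by (simp add: mE_def)
  \<comment> \<open>Finiteness of \<open>HH\<close>, as of \<open>mE\<close>, is what permits
    cancelling it from inequalities in \<open>ennreal\<close>.\<close>
  have HH_fin: "HH \<noteq> \<infinity>"
  proof -
    have "H \<zeta> \<le> of_nat N" if "\<zeta> \<in> torus" for \<zeta>
    proof -
      have "poisson_op (r i) (e i) \<zeta> \<le> 1" for i
        using poisson_op_mono[of "e i" "\<lambda>_. 1" "r i" \<zeta>] poisson_op_const[OF r(1,2) that, of _ 1]
        by (simp add: e_def indicator_def split: if_splits)
      then have "H \<zeta> \<le> (\<Sum>i<N. 1)" unfolding H_def by (intro sum_mono)
      then show ?thesis by simp
    qed
    then have "HH \<le> (\<integral>\<^sup>+\<zeta>. (of_nat N)\<^sup>2 \<partial>(torus_measure :: (complex^'n) measure))"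
      unfolding HH_def by (intro nn_integral_mono power_mono) auto
    also have "\<dots> < \<infinity>" by (simp add: ennreal_of_nat_eq_real_of_nat power_less_top_ennreal)
    finally show ?thesis by simp
  qed
  have "HH = (\<integral>\<^sup>+\<zeta>. (\<Sum>i<N. \<Sum>j<N. poisson_op (r i) (e i) \<zeta> * poisson_op (r j) (e j) \<zeta>) \<partial>torus_measure)"
    unfolding HH_def H_def power2_eq_square sum_product ..
  also have "\<dots> = (\<Sum>i<N. \<Sum>j<N. \<integral>\<^sup>+\<zeta>. poisson_op (r i) (e i) \<zeta> * poisson_op (r j) (e j) \<zeta> \<partial>torus_measure)"
    by (simp add: nn_integral_sum)
  also have "\<dots> \<le> (\<Sum>i<N. \<Sum>j<N. c * ((\<integral>\<^sup>+\<zeta>. e j \<zeta> * poisson_op (r i) (e i) \<zeta> \<partial>torus_measure)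
      + (\<integral>\<^sup>+\<zeta>. e i \<zeta> * poisson_op (r j) (e j) \<zeta> \<partial>torus_measure)))"
  proof (intro sum_mono)
    fix i j
    have "(\<integral>\<^sup>+\<zeta>. poisson_op (r i) (e i) \<zeta> * poisson_op (r j) (e j) \<zeta> \<partial>torus_measure)
       = (\<integral>\<^sup>+\<zeta>. e i \<zeta> * poisson_op (r i) (poisson_op (r j) (e j)) \<zeta> \<partial>torus_measure)"
      by (rule poisson_op_symmetric[symmetric]) measurable
    also have "\<dots> \<le> (\<integral>\<^sup>+\<zeta>. c * (e i \<zeta> * poisson_op (r i) (e j) \<zeta> + e i \<zeta> * poisson_op (r j) (e j) \<zeta>) \<partial>torus_measure)"
    proof (rule nn_integral_mono)
      fix \<zeta> :: "complex^'n" assume "\<zeta> \<in> space torus_measure"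
      then have \<zeta>: "\<zeta> \<in> torus" by simp
      have "poisson_op (r i) (poisson_op (r j) (e j)) \<zeta> = poisson_op (r i * r j) (e j) \<zeta>"
        by (rule poisson_op_semigroup[OF e r r \<zeta>])
      also have "\<dots> \<le> c * (poisson_op (r i) (e j) \<zeta> + poisson_op (r j) (e j) \<zeta>)"
        unfolding c_def by (rule poisson_op_dominated[OF e r r \<zeta>])
      finally have "e i \<zeta> * poisson_op (r i) (poisson_op (r j) (e j)) \<zeta>
          \<le> e i \<zeta> * (c * (poisson_op (r i) (e j) \<zeta> + poisson_op (r j) (e j) \<zeta>))"
        by (rule mult_left_mono) simp
      then show "e i \<zeta> * poisson_op (r i) (poisson_op (r j) (e j)) \<zeta>
          \<le> c * (e i \<zeta> * poisson_op (r i) (e j) \<zeta> + e i \<zeta> * poisson_op (r j) (e j) \<zeta>)"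
        by (simp add: distrib_left mult_ac)
    qed
    also have "\<dots> = c * ((\<integral>\<^sup>+\<zeta>. e i \<zeta> * poisson_op (r i) (e j) \<zeta> \<partial>torus_measure)
      + (\<integral>\<^sup>+\<zeta>. e i \<zeta> * poisson_op (r j) (e j) \<zeta> \<partial>torus_measure))"
      by (simp add: nn_integral_cmult nn_integral_add)
    \<comment> \<open>Symmetry puts each operator back on its own indicator; the two double sums
      then differ only in the names of i and j, hence the factor 2 c.\<close>
    also have "(\<integral>\<^sup>+\<zeta>. e i \<zeta> * poisson_op (r i) (e j) \<zeta> \<partial>torus_measure)
        = (\<integral>\<^sup>+\<zeta>. e j \<zeta> * poisson_op (r i) (e i) \<zeta> \<partial>torus_measure)"
      by (subst poisson_op_symmetric) (simp_all add: mult.commute)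
    finally show "(\<integral>\<^sup>+\<zeta>. poisson_op (r i) (e i) \<zeta> * poisson_op (r j) (e j) \<zeta> \<partial>torus_measure)
        \<le> c * ((\<integral>\<^sup>+\<zeta>. e j \<zeta> * poisson_op (r i) (e i) \<zeta> \<partial>torus_measure)
      + (\<integral>\<^sup>+\<zeta>. e i \<zeta> * poisson_op (r j) (e j) \<zeta> \<partial>torus_measure))" .
  qed
  also have "\<dots> = c * ((\<Sum>i<N. \<Sum>j<N. \<integral>\<^sup>+\<zeta>. e j \<zeta> * poisson_op (r i) (e i) \<zeta> \<partial>torus_measure)
      + (\<Sum>i<N. \<Sum>j<N. \<integral>\<^sup>+\<zeta>. e i \<zeta> * poisson_op (r j) (e j) \<zeta> \<partial>torus_measure))"
    by (simp add: sum_distrib_left[symmetric] sum.distrib)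
  also have "(\<Sum>i<N. \<Sum>j<N. \<integral>\<^sup>+\<zeta>. e j \<zeta> * poisson_op (r i) (e i) \<zeta> \<partial>torus_measure)
      = (\<Sum>i<N. \<Sum>j<N. \<integral>\<^sup>+\<zeta>. e i \<zeta> * poisson_op (r j) (e j) \<zeta> \<partial>torus_measure)"
    by (rule sum.swap)
  also have "(\<Sum>i<N. \<Sum>j<N. \<integral>\<^sup>+\<zeta>. e i \<zeta> * poisson_op (r j) (e j) \<zeta> \<partial>torus_measure)
      = (\<integral>\<^sup>+\<zeta>. ee \<zeta> * H \<zeta> \<partial>torus_measure)"
    unfolding ee_sum H_def sum_product by (simp add: nn_integral_sum)
  finally have HH1: "HH \<le> 2 * c * (\<integral>\<^sup>+\<zeta>. ee \<zeta> * H \<zeta> \<partial>torus_measure)"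
    by (simp add: mult_2[symmetric] mult_ac)
  have ee2: "(ee \<zeta>)\<^sup>2 = ee \<zeta>" for \<zeta> by (simp add: ee_def indicator_def)
  \<comment> \<open>Cauchy-Schwarz and e^2 = e bound <e, H>^2 by \<open>mE * HH\<close>, and one
    factor \<open>HH\<close> cancels.\<close>
  have "HH\<^sup>2 \<le> (2 * c)\<^sup>2 * (\<integral>\<^sup>+\<zeta>. ee \<zeta> * H \<zeta> \<partial>torus_measure)\<^sup>2"
    using power_mono[OF HH1, of 2] by (simp add: power_mult_distrib)
  also have "\<dots> \<le> (2 * c)\<^sup>2 * ((\<integral>\<^sup>+\<zeta>. (ee \<zeta>)\<^sup>2 \<partial>torus_measure) * HH)"
    unfolding HH_def by (intro mult_left_mono Cauchy_Schwarz_nn_integral) auto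
  finally have "HH * HH \<le> HH * ((2 * c)\<^sup>2 * mE)"
    by (simp add: ee2 mE_eq power2_eq_square[of HH] mult_ac)
  then have HH2: "HH \<le> (2 * c)\<^sup>2 * mE"
    using HH_fin by (cases "HH = 0") (auto simp: ennreal_mult_le_mult_iff)
  \<comment> \<open>Duality: on E i the value of A_i u is at least l, and moving every A_i onto e_i
    turns the sum into <H, u>.\<close>
  have "l * mE = (\<integral>\<^sup>+\<zeta>. l * ee \<zeta> \<partial>torus_measure)"
    by (simp add: mE_eq nn_integral_cmult)
  also have "\<dots> \<le> (\<integral>\<^sup>+\<zeta>. (\<Sum>i<N. e i \<zeta> * poisson_op (r i) u \<zeta>) \<partial>torus_measure)"
    unfolding ee_sum sum_distrib_left
  proof (intro nn_integral_mono sum_mono)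
    fix \<zeta> i assume "i \<in> {..<N}"
    then show "l * e i \<zeta> \<le> e i \<zeta> * poisson_op (r i) u \<zeta>"
      using lower[of i \<zeta>] by (auto simp: e_def indicator_def)
  qed
  also have "\<dots> = (\<Sum>i<N. \<integral>\<^sup>+\<zeta>. poisson_op (r i) (e i) \<zeta> * u \<zeta> \<partial>torus_measure)"
    by (simp add: nn_integral_sum poisson_op_symmetric)
  also have "\<dots> = (\<integral>\<^sup>+\<zeta>. H \<zeta> * u \<zeta> \<partial>torus_measure)"
    unfolding H_def by (simp add: nn_integral_sum sum_distrib_right)
  finally have "(l * mE)\<^sup>2 \<le> (\<integral>\<^sup>+\<zeta>. H \<zeta> * u \<zeta> \<partial>torus_measure)\<^sup>2"
    by (rule power_mono) simp
  also have "\<dots> \<le> HH * (\<integral>\<^sup>+\<zeta>. (u \<zeta>)\<^sup>2 \<partial>torus_measure)"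
    unfolding HH_def by (rule Cauchy_Schwarz_nn_integral) measurable
  also have "\<dots> \<le> ((2 * c)\<^sup>2 * mE) * (\<integral>\<^sup>+\<zeta>. (u \<zeta>)\<^sup>2 \<partial>torus_measure)"
    by (rule mult_right_mono[OF HH2]) simp
  finally have "mE * (l\<^sup>2 * mE) \<le> mE * ((2 * c)\<^sup>2 * (\<integral>\<^sup>+\<zeta>. (u \<zeta>)\<^sup>2 \<partial>torus_measure))"
    by (simp add: power_mult_distrib power2_eq_square[of mE] mult_ac)
  then have "l\<^sup>2 * mE \<le> (2 * c)\<^sup>2 * (\<integral>\<^sup>+\<zeta>. (u \<zeta>)\<^sup>2 \<partial>torus_measure)"
    using mE_fin by (cases "mE = 0") (auto simp: ennreal_mult_le_mult_iff)
  then show ?thesis by (simp add: mE_def c_def power_mult_distrib)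
qed

section \<open>Dilates of holomorphic functions in L2\<close>

abbreviation dilate :: "(complex^'n \<Rightarrow> complex) \<Rightarrow> real \<Rightarrow> complex^'n \<Rightarrow> complex" where
  "dilate f r \<equiv> (\<lambda>\<zeta>. f (r *\<^sub>R \<zeta>))"

lemma dilate_continuous:
  assumes f: "holomorphic_several_on f polydisc" and r: "0 \<le> r" "r < 1"
  shows "continuous_on closed_polydisc (dilate f r)"
  by (rule continuous_on_compose2[OF holomorphic_several_on_imp_continuous_on[OF f]])
    (auto intro!: continuous_intros scale_polydisc r)

lemma dilate_continuous_torus:
  assumes "holomorphic_several_on f polydisc" "0 \<le> r" "r < 1"
  shows "continuous_on torus (dilate f r)"
  using dilate_continuous[OF assms] torus_subset_closed continuous_on_subset by blast

lemma dilate_L2: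
  assumes "holomorphic_several_on f polydisc" "0 \<le> r" "r < 1"
  shows "dilate f r \<in> L2_functions torus_measure"
  by (rule L2_on_torus[OF dilate_continuous_torus[OF assms]]) (simp_all add: torus.finite_measure_axioms)

lemma dilate_Poisson:
  fixes f :: "complex^'n \<Rightarrow> complex"
  assumes f: "holomorphic_several_on f polydisc" and r: "0 \<le> r" "r < 1" and q: "0 \<le> q" "q < 1"
    and \<zeta>: "\<zeta> \<in> torus"
  shows "f ((q * r) *\<^sub>R \<zeta>) = (\<integral>\<eta>. complex_of_real (poisson_kernel (q *\<^sub>R \<zeta>) \<eta>) * f (r *\<^sub>R \<eta>) \<partial>torus_measure)"
proof -
  have "holomorphic_several_on (\<lambda>z. f (r *\<^sub>R z)) closed_polydisc"
    by (rule holomorphic_several_on_scale[OF f]) (rule scale_polydisc[OF r])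
  from torus_Poisson_formula[OF this scaled_torus_polydisc[OF q \<zeta>]] show ?thesis
    by (simp add: mult.commute)
qed

text \<open>The dilate of radius q r is A_q of the dilate of radius r, and absolute values pass
  under the integral because the kernel is nonnegative.\<close>

lemma dilate_norm_le:
  fixes f :: "complex^'n \<Rightarrow> complex"
  assumes f: "holomorphic_several_on f polydisc" and r: "0 \<le> r" "r < 1" and q: "0 \<le> q" "q < 1"
    and \<zeta>: "\<zeta> \<in> torus"
  shows "ennreal (norm (f ((q * r) *\<^sub>R \<zeta>))) \<le> poisson_op q (\<lambda>\<eta>. ennreal (norm (f (r *\<^sub>R \<eta>)))) \<zeta>"
proof -
  have "continuous_on torus (\<lambda>\<eta>. complex_of_real (poisson_kernel (q *\<^sub>R \<zeta>) \<eta>) * f (r *\<^sub>R \<eta>))"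
    by (intro continuous_intros dilate_continuous_torus f r
        continuous_on_subset[OF poisson_kernel_continuous[OF scaled_torus_polydisc[OF q \<zeta>]] torus_subset_closed])
  then have "integrable torus_measure (\<lambda>\<eta>. complex_of_real (poisson_kernel (q *\<^sub>R \<zeta>) \<eta>) * f (r *\<^sub>R \<eta>))"
    by (rule integrable_on_torus) (simp_all add: torus.finite_measure_axioms)
  then have "ennreal (norm (f ((q * r) *\<^sub>R \<zeta>)))
      \<le> (\<integral>\<^sup>+\<eta>. ennreal (norm (complex_of_real (poisson_kernel (q *\<^sub>R \<zeta>) \<eta>) * f (r *\<^sub>R \<eta>))) \<partial>torus_measure)"
    unfolding dilate_Poisson[OF assms] by (rule integral_norm_bound_ennreal)
  also have "\<dots> = poisson_op q (\<lambda>\<eta>. ennreal (norm (f (r *\<^sub>R \<eta>)))) \<zeta>"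
    unfolding poisson_op_def
    using poisson_kernel_nonneg[OF scaled_torus_polydisc[OF q \<zeta>]]
    by (intro nn_integral_cong) (simp add: norm_mult ennreal_mult')
  finally show ?thesis .
qed

text \<open>With s = q r, Jensen's inequality gives |f_s|^2 \<le> A_q |f_r|^2 pointwise, and A_q
  preserves integrals.\<close>

lemma dilate_norm_mono:
  fixes f :: "complex^'n \<Rightarrow> complex"
  assumes f: "holomorphic_several_on f polydisc" and s: "0 \<le> s" "s \<le> r" "r < 1"
  shows "L2_norm torus_measure (dilate f s) \<le> L2_norm torus_measure (dilate f r)"
proof (cases "s = r")
  case False
  define q where "q = s / r"
  have q: "0 \<le> q" "q < 1" "q * r = s" using s False by (auto simp: q_def)
  have r: "0 \<le> r" "r < 1" using s by auto
  have [measurable]: "dilate f r \<in> borel_measurable torus_measure" "dilate f s \<in> borel_measurable torus_measure"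
    using dilate_L2[OF f] s by (auto simp: L2_functions_def)
  have "(\<integral>\<^sup>+\<zeta>. ennreal ((norm (f (s *\<^sub>R \<zeta>)))\<^sup>2) \<partial>torus_measure)
      \<le> (\<integral>\<^sup>+\<zeta>. poisson_op q (\<lambda>\<eta>. (ennreal (norm (f (r *\<^sub>R \<eta>))))\<^sup>2) \<zeta> \<partial>torus_measure)"
  proof (rule nn_integral_mono)
    fix \<zeta> :: "complex^'n" assume "\<zeta> \<in> space torus_measure"
    then have \<zeta>: "\<zeta> \<in> torus" by simp
    have "(ennreal (norm (f (s *\<^sub>R \<zeta>))))\<^sup>2 \<le> (poisson_op q (\<lambda>\<eta>. ennreal (norm (f (r *\<^sub>R \<eta>)))) \<zeta>)\<^sup>2"
      using dilate_norm_le[OF f r q(1,2) \<zeta>] q(3) by (intro power_mono) auto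
    also have "\<dots> \<le> poisson_op q (\<lambda>\<eta>. (ennreal (norm (f (r *\<^sub>R \<eta>))))\<^sup>2) \<zeta>"
      by (rule poisson_op_Jensen) (use q \<zeta> in auto)
    finally show "ennreal ((norm (f (s *\<^sub>R \<zeta>)))\<^sup>2) \<le> poisson_op q (\<lambda>\<eta>. (ennreal (norm (f (r *\<^sub>R \<eta>))))\<^sup>2) \<zeta>"
      by (simp add: ennreal_power)
  qed
  also have "\<dots> = (\<integral>\<^sup>+\<zeta>. ennreal ((norm (f (r *\<^sub>R \<zeta>)))\<^sup>2) \<partial>torus_measure)"
    by (subst poisson_op_nn_integral) (use q in \<open>auto simp: ennreal_power\<close>)
  also have "\<dots> = ennreal ((L2_norm torus_measure (dilate f r))\<^sup>2)"
    by (rule L2_nn_integral[OF dilate_L2[OF f r]])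
  finally show ?thesis by (rule L2_nn_integral_le(2)[rotated]) auto
qed simp

text \<open>This is <g, A A g> = <A g, A g> for the symmetric operator A = A_q and g = f_r. The
  radius q * (q * r) is chosen so that the mixed term is a norm.\<close>

lemma dilate_inner:
  fixes f :: "complex^'n \<Rightarrow> complex"
  assumes f: "holomorphic_several_on f polydisc" and r: "0 \<le> r" "r < 1" and q: "0 \<le> q" "q < 1"
  shows "L2_inner torus_measure (dilate f r) (dilate f (q * (q * r)))
    = complex_of_real ((L2_norm torus_measure (dilate f (q * r)))\<^sup>2)"
proof -
  have qr: "0 \<le> q * r" "q * r < 1" using r q by (auto intro: order_le_less_trans[OF mult_left_le_one_le])
  \<comment> \<open>The second dilate is expanded by its Poisson integral. Integrating over \<zeta>
    first moves the kernel onto the first dilate; Fubini applies since K is bounded for q <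
    1.\<close>
  define K where "K \<zeta> \<eta> = f (r *\<^sub>R \<zeta>) * (complex_of_real (poisson_kernel (q *\<^sub>R \<zeta>) \<eta>) * cnj (f ((q * r) *\<^sub>R \<eta>)))" for \<zeta> \<eta>
  have meas[measurable]: "dilate f r \<in> borel_measurable torus_measure" "dilate f (q * r) \<in> borel_measurable torus_measure"
    using dilate_L2[OF f r] dilate_L2[OF f qr] by (auto simp: L2_functions_def)
  obtain B1 where B1: "\<And>\<zeta>. \<zeta> \<in> torus \<Longrightarrow> norm (f (r *\<^sub>R \<zeta>)) \<le> B1" "B1 > 0"
    using bounded_on_torus[OF dilate_continuous_torus[OF f r]] by blast
  obtain B2 where B2: "\<And>\<zeta>. \<zeta> \<in> torus \<Longrightarrow> norm (f ((q * r) *\<^sub>R \<zeta>)) \<le> B2" "B2 > 0"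
    using bounded_on_torus[OF dilate_continuous_torus[OF f qr]] by blast
  interpret P: finite_measure "torus_measure \<Otimes>\<^sub>M torus_measure :: ((complex^'n) \<times> (complex^'n)) measure"
    by (rule finite_measure_pair_measure) (simp_all add: torus.finite_measure_axioms)
  have int: "integrable (torus_measure \<Otimes>\<^sub>M torus_measure) (\<lambda>(\<zeta>, \<eta>). K \<zeta> \<eta>)"
  proof (rule P.integrable_const_bound)
    show "AE x in torus_measure \<Otimes>\<^sub>M torus_measure. norm (case x of (\<zeta>, \<eta>) \<Rightarrow> K \<zeta> \<eta>)
        \<le> B1 * ((1 / (1 - q)\<^sup>2) ^ CARD('n) * B2)"
    proof (rule AE_I2)
      fix x :: "(complex^'n) \<times> (complex^'n)" assume "x \<in> space (torus_measure \<Otimes>\<^sub>M torus_measure)"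
      then obtain \<zeta> \<eta> where x: "x = (\<zeta>, \<eta>)" "\<zeta> \<in> torus" "\<eta> \<in> torus"
        by (auto simp: space_pair_measure)
      have "0 \<le> poisson_kernel (q *\<^sub>R \<zeta>) \<eta>"
        by (intro poisson_kernel_nonneg scaled_torus_polydisc q x)
      then show "norm (case x of (\<zeta>, \<eta>) \<Rightarrow> K \<zeta> \<eta>) \<le> B1 * ((1 / (1 - q)\<^sup>2) ^ CARD('n) * B2)"
        unfolding x K_def case_prod_conv norm_mult
        using B1 B2 x poisson_kernel_le[OF q x(2,3)] by (intro mult_mono) auto
    qed
    show "(\<lambda>(\<zeta>, \<eta>). K \<zeta> \<eta>) \<in> borel_measurable (torus_measure \<Otimes>\<^sub>M torus_measure)"
      unfolding K_def by measurable
  qed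
  have "L2_inner torus_measure (dilate f r) (dilate f (q * (q * r))) = (\<integral>\<zeta>. (\<integral>\<eta>. K \<zeta> \<eta> \<partial>torus_measure) \<partial>torus_measure)"
    unfolding L2_inner_def
  proof (intro Bochner_Integration.integral_cong refl)
    fix \<zeta> :: "complex^'n" assume "\<zeta> \<in> space torus_measure"
    then have \<zeta>: "\<zeta> \<in> torus" by simp
    show "f (r *\<^sub>R \<zeta>) * cnj (f ((q * (q * r)) *\<^sub>R \<zeta>)) = (\<integral>\<eta>. K \<zeta> \<eta> \<partial>torus_measure)"
      unfolding dilate_Poisson[OF f qr q \<zeta>] K_def
      by (simp only: integral_mult_right_zero Bochner_Integration.integral_cnj[symmetric]
          complex_cnj_mult complex_cnj_complex_of_real)
  qed
  also have "\<dots> = (\<integral>\<eta>. (\<integral>\<zeta>. K \<zeta> \<eta> \<partial>torus_measure) \<partial>torus_measure)"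
    by (rule torus_pair.Fubini_integral[OF int, symmetric])
  also have "\<dots> = (\<integral>\<eta>. f ((q * r) *\<^sub>R \<eta>) * cnj (f ((q * r) *\<^sub>R \<eta>)) \<partial>torus_measure)"
  proof (intro Bochner_Integration.integral_cong refl)
    fix \<eta> :: "complex^'n" assume "\<eta> \<in> space torus_measure"
    then have \<eta>: "\<eta> \<in> torus" by simp
    have "(\<integral>\<zeta>. K \<zeta> \<eta> \<partial>torus_measure)
        = (\<integral>\<zeta>. (complex_of_real (poisson_kernel (q *\<^sub>R \<eta>) \<zeta>) * f (r *\<^sub>R \<zeta>)) * cnj (f ((q * r) *\<^sub>R \<eta>)) \<partial>torus_measure)"
      unfolding K_def using \<eta> poisson_kernel_sym[of \<eta> _ q]
      by (intro Bochner_Integration.integral_cong refl) simp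
    also have "\<dots> = f ((q * r) *\<^sub>R \<eta>) * cnj (f ((q * r) *\<^sub>R \<eta>))"
      unfolding dilate_Poisson[OF f r q \<eta>] by (simp only: integral_mult_left_zero)
    finally show "(\<integral>\<zeta>. K \<zeta> \<eta> \<partial>torus_measure) = f ((q * r) *\<^sub>R \<eta>) * cnj (f ((q * r) *\<^sub>R \<eta>))" .
  qed
  also have "\<dots> = complex_of_real ((L2_norm torus_measure (dilate f (q * r)))\<^sup>2)"
    using L2_inner_self[of torus_measure "dilate f (q * r)"] by (simp add: L2_inner_def)
  finally show ?thesis .
qed

text \<open>Expanding the square gives |f_r|^2 + |f_qqr|^2 - 2 |f_qr|^2, and |f_qqr| \<le> |f_qr| by
  monotonicity.\<close>

lemma dilate_diff_le:
  fixes f :: "complex^'n \<Rightarrow> complex"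
  assumes f: "holomorphic_several_on f polydisc" and r: "0 \<le> r" "r < 1" and q: "0 \<le> q" "q < 1"
  shows "(L2_norm torus_measure (\<lambda>\<zeta>. f (r *\<^sub>R \<zeta>) - f ((q * (q * r)) *\<^sub>R \<zeta>)))\<^sup>2
    \<le> (L2_norm torus_measure (dilate f r))\<^sup>2 - (L2_norm torus_measure (dilate f (q * r)))\<^sup>2"
proof -
  have qr: "0 \<le> q * r" "q * r < 1" using r q by (auto intro: order_le_less_trans[OF mult_left_le_one_le])
  have qqr: "0 \<le> q * (q * r)" "q * (q * r) < 1" "q * (q * r) \<le> q * r"
    using qr q by (auto intro: order_le_less_trans[OF mult_left_le_one_le] mult_left_le_one_le)
  have "(L2_norm torus_measure (\<lambda>\<zeta>. f (r *\<^sub>R \<zeta>) + (-1) * f ((q * (q * r)) *\<^sub>R \<zeta>)))\<^sup>2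
     = (L2_norm torus_measure (dilate f r))\<^sup>2 + (L2_norm torus_measure (dilate f (q * (q * r))))\<^sup>2
       - 2 * (L2_norm torus_measure (dilate f (q * r)))\<^sup>2"
    by (subst L2_norm_add_sq)
      (use dilate_L2[OF f r] dilate_L2[OF f qqr(1,2)] in
        \<open>simp_all only: L2_cmult L2_norm_cmult L2_inner_cmult_right dilate_inner[OF f r q]\<close>, simp)
  moreover have "(L2_norm torus_measure (dilate f (q * (q * r))))\<^sup>2 \<le> (L2_norm torus_measure (dilate f (q * r)))\<^sup>2"
    using dilate_norm_mono[OF f qqr(1,3) qr(2)] by (intro power_mono) auto
  ultimately show ?thesis by simp
qed

section \<open>Radial boundary values\<close>

lemma hardy_spaceI:
  assumes "holomorphic_several_on f polydisc"
    and "\<And>r. 0 < r \<Longrightarrow> r < 1 \<Longrightarrow> (L2_norm torus_measure (dilate f r))\<^sup>2 \<le> B"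
  shows "f \<in> hardy_space"
  using assms unfolding hardy_space_def L2_norm_sq by (auto intro!: bdd_aboveI2[where M=B])

lemma hardy_holomorphic: "f \<in> hardy_space \<Longrightarrow> holomorphic_several_on f polydisc"
  by (simp add: hardy_space_def)

lemma hardy_sup:
  fixes f :: "complex^'n \<Rightarrow> complex"
  assumes f: "f \<in> hardy_space"
  obtains B where "\<And>r. 0 \<le> r \<Longrightarrow> r < 1 \<Longrightarrow> (L2_norm torus_measure (dilate f r))\<^sup>2 \<le> B"
    "\<And>e. e > 0 \<Longrightarrow> \<exists>s. 0 < s \<and> s < 1 \<and> (L2_norm torus_measure (dilate f s))\<^sup>2 > B - e"
proof
  let ?S = "\<lambda>r. (L2_norm torus_measure (dilate f r))\<^sup>2"
  define B where "B = (SUP r\<in>{0<..<1}. ?S r)"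
  have bdd: "bdd_above (?S ` {0<..<1})"
    using f unfolding hardy_space_def L2_norm_sq by simp
  have 1: "?S r \<le> B" if "0 < r" "r < 1" for r
    unfolding B_def using bdd that by (intro cSUP_upper) auto
  show "?S r \<le> B" if "0 \<le> r" "r < 1" for r
  proof -
    \<comment> \<open>The supremum is taken over 0 < r < 1; going to the midpoint of r and 1 covers
      r = 0.\<close>
    have "?S r \<le> ?S ((1 + r) / 2)"
      using that by (intro power_mono dilate_norm_mono hardy_holomorphic f) auto
    also have "\<dots> \<le> B" using that by (intro 1) auto
    finally show ?thesis .
  qed
  show "\<exists>s. 0 < s \<and> s < 1 \<and> ?S s > B - e" if "e > 0" for e
  proof -
    have "B - e < (SUP r\<in>{0<..<1}. ?S r)" using that by (simp add: B_def)
    then have "\<exists>s\<in>{0<..<1}. B - e < ?S s"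
      using bdd by (subst (asm) less_cSUP_iff) auto
    then show ?thesis by auto
  qed
qed

text \<open>The squared norms increase to their supremum B, so from the radius s on they vary by
  less than e, and \<open>dilate_diff_le\<close> converts this into closeness of the
  dilates.\<close>

lemma hardy_Cauchy:
  fixes f :: "complex^'n \<Rightarrow> complex"
  assumes f: "f \<in> hardy_space" and e: "e > 0"
  obtains s where "0 < s" "s < 1"
    "\<And>t r. s \<le> t \<Longrightarrow> t \<le> r \<Longrightarrow> r < 1 \<Longrightarrow>
      (L2_norm torus_measure (\<lambda>\<zeta>. f (r *\<^sub>R \<zeta>) - f (t *\<^sub>R \<zeta>)))\<^sup>2 \<le> e"
proof -
  let ?S = "\<lambda>r. (L2_norm torus_measure (dilate f r))\<^sup>2"
  obtain B where
    B: "\<And>r. 0 \<le> r \<Longrightarrow> r < 1 \<Longrightarrow> ?S r \<le> B" "\<And>e. e > 0 \<Longrightarrow> \<exists>s. 0 < s \<and> s < 1 \<and> ?S s > B - e"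
    by (rule hardy_sup[OF f]) blast
  obtain s where s: "0 < s" "s < 1" "?S s > B - e" using B(2)[OF e] by blast
  show ?thesis
  proof (rule that[OF s(1,2)])
    fix t r assume tr: "s \<le> t" "t \<le> r" "r < 1"
    show "(L2_norm torus_measure (\<lambda>\<zeta>. f (r *\<^sub>R \<zeta>) - f (t *\<^sub>R \<zeta>)))\<^sup>2 \<le> e"
    proof (cases "t = r")
      case True
      then show ?thesis using e by (simp add: L2_norm_def)
    next
      case False
      \<comment> \<open>Two steps of ratio q lead from r to t; the intermediate radius q r is still
        at least s.\<close>
      define q where "q = sqrt (t / r)"
      have q: "0 \<le> q" "q < 1" "q * (q * r) = t"
        using tr s False by (auto simp: q_def real_sqrt_lt_1_iff mult.assoc[symmetric])
      have "t \<le> q * r"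
        using q tr s by (metis less_eq_real_def mult_left_le_one_le mult_nonneg_nonneg order_trans)
      then have "?S s \<le> ?S (q * r)"
        using q tr s by (intro power_mono dilate_norm_mono hardy_holomorphic f)
          (auto intro: order_le_less_trans[OF mult_left_le_one_le])
      moreover have "(L2_norm torus_measure (\<lambda>\<zeta>. f (r *\<^sub>R \<zeta>) - f (t *\<^sub>R \<zeta>)))\<^sup>2 \<le> ?S r - ?S (q * r)"
        using dilate_diff_le[OF hardy_holomorphic[OF f], of r q] q tr s by auto
      moreover have "?S r \<le> B" using tr s by (intro B) auto
      ultimately show ?thesis using s(3) by linarith
    qed
  qed
qed

text \<open>One \<rho> serves all radii: f - f(\<rho> z) is itself holomorphic, so its norms
  increase with r and only radii near 1 have to be controlled. This uniformity is what the maximal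
  inequality takes as input.\<close>

lemma hardy_dilate_approx:
  fixes f :: "complex^'n \<Rightarrow> complex"
  assumes f: "f \<in> hardy_space" and e: "e > 0"
  obtains \<rho> where "0 < \<rho>" "\<rho> < 1"
    "\<And>r. 0 \<le> r \<Longrightarrow> r < 1 \<Longrightarrow>
      (L2_norm torus_measure (\<lambda>\<zeta>. f (r *\<^sub>R \<zeta>) - f (\<rho> *\<^sub>R (r *\<^sub>R \<zeta>))))\<^sup>2 \<le> e"
proof -
  obtain s where s: "0 < s" "s < 1"
    "\<And>t r. s \<le> t \<Longrightarrow> t \<le> r \<Longrightarrow> r < 1 \<Longrightarrow>
      (L2_norm torus_measure (\<lambda>\<zeta>. f (r *\<^sub>R \<zeta>) - f (t *\<^sub>R \<zeta>)))\<^sup>2 \<le> e"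
    by (rule hardy_Cauchy[OF f e]) blast
  \<comment> \<open>For r' \<ge> \<rho> both r' and \<rho> r' are then at least s, where the Cauchy
    bound holds.\<close>
  define \<rho> where "\<rho> = sqrt s"
  have \<rho>: "0 < \<rho>" "\<rho> < 1" "\<rho> * \<rho> = s" using s by (auto simp: \<rho>_def)
  have hol: "holomorphic_several_on (\<lambda>z. f z + (-1) * f (\<rho> *\<^sub>R z)) polydisc"
    using \<rho> by (intro holomorphic_several_on_add holomorphic_several_on_cmult
        holomorphic_several_on_scale[OF hardy_holomorphic[OF f]] hardy_holomorphic[OF f]
        scale_polydisc_polydisc) auto
  show ?thesis
  proof (rule that[OF \<rho>(1,2)])
    fix r :: real assume r: "0 \<le> r" "r < 1"
    define r' where "r' = max r \<rho>"
    have r': "r \<le> r'" "r' < 1" "0 \<le> r'" "\<rho> \<le> r'" using r \<rho> by (auto simp: r'_def)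
    have "L2_norm torus_measure (\<lambda>\<zeta>. f (r *\<^sub>R \<zeta>) - f (\<rho> *\<^sub>R (r *\<^sub>R \<zeta>)))
        \<le> L2_norm torus_measure (\<lambda>\<zeta>. f (r' *\<^sub>R \<zeta>) - f (\<rho> *\<^sub>R (r' *\<^sub>R \<zeta>)))"
      using dilate_norm_mono[OF hol r(1) r'(1,2)] by simp
    then have "(L2_norm torus_measure (\<lambda>\<zeta>. f (r *\<^sub>R \<zeta>) - f (\<rho> *\<^sub>R (r *\<^sub>R \<zeta>))))\<^sup>2
        \<le> (L2_norm torus_measure (\<lambda>\<zeta>. f (r' *\<^sub>R \<zeta>) - f (\<rho> *\<^sub>R (r' *\<^sub>R \<zeta>))))\<^sup>2"
      by (intro power_mono) auto
    also have "\<dots> \<le> e"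
    proof -
      have "s \<le> \<rho> * r'" using r' \<rho> by (metis less_eq_real_def mult_left_mono)
      then show ?thesis
        using s(3)[of "\<rho> * r'" r'] r' \<rho> by (auto intro: mult_left_le_one_le)
    qed
    finally show "(L2_norm torus_measure (\<lambda>\<zeta>. f (r *\<^sub>R \<zeta>) - f (\<rho> *\<^sub>R (r *\<^sub>R \<zeta>))))\<^sup>2 \<le> e" .
  qed
qed

section \<open>Almost everywhere existence of radial limits\<close>

lemma radial_rationals:
  obtains q :: "nat \<Rightarrow> real" where "range q = \<rat> \<inter> {0<..<1}"
proof -
  have "\<rat> \<inter> {0<..<1::real} \<noteq> {}" using Rats_dense_in_real[of 0 1] by auto
  moreover have "countable (\<rat> \<inter> {0<..<1::real})" by (simp add: countable_rat countable_Int1)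
  ultimately show ?thesis using that range_from_nat_into by metis
qed

text \<open>Weak type bound for the supremum over all radii. Rational radii suffice, since |f| > l
  is an open condition on the radius. \<open>disjointed\<close> assigns to each point of E the first
  radius in the enumeration that exceeds l, which linearizes the supremum.\<close>

lemma radial_maximal:
  fixes f :: "complex^'n \<Rightarrow> complex"
  assumes f: "holomorphic_several_on f polydisc" and l: "0 < l"
    and B: "\<And>r. 0 \<le> r \<Longrightarrow> r < 1 \<Longrightarrow> (L2_norm torus_measure (dilate f r))\<^sup>2 \<le> B"
  obtains E where "E \<in> sets torus_measure"
    "ennreal (l\<^sup>2) * emeasure torus_measure E \<le> 4 * (8 ^ CARD('n))\<^sup>2 * ennreal B"
    "\<And>\<zeta> r. \<zeta> \<in> torus \<Longrightarrow> \<zeta> \<notin> E \<Longrightarrow> 0 < r \<Longrightarrow> r < 1 \<Longrightarrow> norm (f (r *\<^sub>R \<zeta>)) \<le> l"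
proof -
  obtain q :: "nat \<Rightarrow> real" where q: "range q = \<rat> \<inter> {0<..<1}" by (rule radial_rationals)
  then have q01: "0 < q i" "q i < 1" for i by auto
  define F where "F i = {\<zeta>\<in>torus. l < norm (f (q i *\<^sub>R \<zeta>))}" for i
  have F_sets: "F i \<in> sets torus_measure" for i
  proof -
    have "dilate f (q i) \<in> borel_measurable torus_measure"
      using dilate_L2[OF f] q01[of i] by (auto simp: L2_functions_def)
    then have "{\<zeta>\<in>space torus_measure. l < norm (f (q i *\<^sub>R \<zeta>))} \<in> sets torus_measure" by measurable
    then show ?thesis by (simp add: F_def)
  qed
  have D_sets: "disjointed F i \<in> sets torus_measure" for i
    using sets.range_disjointed_sets[of F torus_measure] F_sets by blast
  have bound: "(ennreal l)\<^sup>2 * emeasure torus_measure (\<Union>i<N. disjointed F i)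
      \<le> 4 * (8 ^ CARD('n))\<^sup>2 * ennreal B" for N
  proof -
    \<comment> \<open>Finitely many radii lie below a common R < 1, so all values f(q_i \<zeta>) are
      Poisson operators of radius q_i / R applied to the one function f_R. Inserting 0 keeps the
      maximum meaningful for N = 0.\<close>
    define m where "m = Max (insert 0 (q ` {..<N}))"
    define R where "R = (1 + m) / 2"
    have m: "m < 1" unfolding m_def using q01 by (subst Max_less_iff) auto
    have m0: "0 \<le> m" unfolding m_def by (rule Max_ge) auto
    have qm: "q i \<le> m" if "i < N" for i
      unfolding m_def using that by (intro Max_ge) auto
    have R: "0 < R" "R < 1" using m m0 by (simp_all add: R_def)
    have Rq: "q i < R" if "i < N" for i using qm[OF that] m by (simp add: R_def)
    \<comment> \<open>Beyond N the radius 0 is a filler, as \<open>poisson_maximal_disjoint\<close>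
      wants every radius in [0,1).\<close>
    define r where "r i = (if i < N then q i / R else 0)" for i
    have r: "0 \<le> r i" "r i < 1" for i
      using R Rq[of i] q01[of i] by (auto simp: r_def)
    have meas[measurable]: "dilate f R \<in> borel_measurable torus_measure"
      using dilate_L2[OF f] R by (auto simp: L2_functions_def)
    have "(ennreal l)\<^sup>2 * emeasure torus_measure (\<Union>i<N. disjointed F i)
      \<le> 4 * (8 ^ CARD('n))\<^sup>2 * (\<integral>\<^sup>+\<zeta>. (ennreal (norm (f (R *\<^sub>R \<zeta>))))\<^sup>2 \<partial>torus_measure)"
    proof (rule poisson_maximal_disjoint[OF _ r D_sets disjoint_family_disjointed])
      fix i and \<zeta> :: "complex^'n" assume i: "i < N" and "\<zeta> \<in> disjointed F i"
      then have \<zeta>: "\<zeta> \<in> torus" "l < norm (f (q i *\<^sub>R \<zeta>))"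
        using disjointed_subset[of F i] by (auto simp: F_def)
      have "ennreal l \<le> ennreal (norm (f ((r i * R) *\<^sub>R \<zeta>)))"
        using \<zeta> i R by (intro ennreal_leI) (simp add: r_def)
      also have "\<dots> \<le> poisson_op (r i) (\<lambda>\<eta>. ennreal (norm (f (R *\<^sub>R \<eta>)))) \<zeta>"
        using R by (intro dilate_norm_le f r \<zeta>) auto
      finally show "ennreal l \<le> poisson_op (r i) (\<lambda>\<eta>. ennreal (norm (f (R *\<^sub>R \<eta>)))) \<zeta>" .
    qed measurable
    also have "(\<integral>\<^sup>+\<zeta>. (ennreal (norm (f (R *\<^sub>R \<zeta>))))\<^sup>2 \<partial>torus_measure) = ennreal ((L2_norm torus_measure (dilate f R))\<^sup>2)"
      using L2_nn_integral[OF dilate_L2[OF f, of R]] R by (simp add: ennreal_power)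
    also have "\<dots> \<le> ennreal B" using R by (intro ennreal_leI B) auto
    finally show ?thesis by (simp add: mult_left_mono)
  qed
  define E where "E = (\<Union>N. \<Union>i<N. disjointed F i)"
  have E_F: "E = (\<Union>i. F i)" 
  proof -
    have "E = (\<Union>i. disjointed F i)" unfolding E_def by blast
    then show ?thesis by (simp add: UN_disjointed_eq)
  qed
  show ?thesis
  proof
    show "E \<in> sets torus_measure" unfolding E_F using F_sets by auto
    have "emeasure torus_measure E = (SUP N. emeasure torus_measure (\<Union>i<N. disjointed F i))"
      unfolding E_def
      by (rule SUP_emeasure_incseq[symmetric])
        (use D_sets in \<open>auto simp: incseq_def intro: order_less_le_trans\<close>)
    then have "ennreal (l\<^sup>2) * emeasure torus_measure E
        = (SUP N. (ennreal l)\<^sup>2 * emeasure torus_measure (\<Union>i<N. disjointed F i))"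
      using l by (simp add: SUP_mult_left_ennreal ennreal_power)
    also have "\<dots> \<le> 4 * (8 ^ CARD('n))\<^sup>2 * ennreal B" by (intro SUP_least bound)
    finally show "ennreal (l\<^sup>2) * emeasure torus_measure E \<le> 4 * (8 ^ CARD('n))\<^sup>2 * ennreal B" .
    fix \<zeta> :: "complex^'n" and r :: real
    assume \<zeta>: "\<zeta> \<in> torus" "\<zeta> \<notin> E" and r: "0 < r" "r < 1"
    show "norm (f (r *\<^sub>R \<zeta>)) \<le> l"
    proof (rule ccontr)
      assume neg: "\<not> norm (f (r *\<^sub>R \<zeta>)) \<le> l"
      have cont: "continuous_on {0<..<1} (\<lambda>t. norm (f (t *\<^sub>R \<zeta>)))"
        by (intro continuous_intros continuous_on_compose2[OF holomorphic_several_on_imp_continuous_on[OF f]])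
          (auto intro!: scaled_torus_polydisc \<zeta>)
      have "open {t\<in>{0<..<1}. norm (f (t *\<^sub>R \<zeta>)) \<in> {l<..}}"
        by (rule continuous_open_preimage[OF cont, unfolded vimage_def Int_def, simplified mem_Collect_eq])
          auto
      then obtain d where d: "d > 0" "ball r d \<subseteq> {t\<in>{0<..<1}. norm (f (t *\<^sub>R \<zeta>)) \<in> {l<..}}"
        using neg r unfolding open_contains_ball by force
      obtain p where p: "p \<in> \<rat>" "r < p" "p < r + d" using Rats_dense_in_real[of r "r + d"] d by auto
      then have "p \<in> ball r d" by (simp add: dist_real_def)
      with d have p2: "p \<in> {0<..<1}" "l < norm (f (p *\<^sub>R \<zeta>))" by auto
      then obtain i where "q i = p" using p q by (metis Int_iff rangeE)
      then have "\<zeta> \<in> F i" using p2 \<zeta> by (simp add: F_def)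
      then show False using \<zeta> by (auto simp: E_F)
    qed
  qed
qed

text \<open>Outside a set of small measure f stays within l of f(\<rho> z) along the whole radius,
  by the maximal inequality for the difference. The function f(\<rho> z) is continuous up to the
  torus, so it contributes no more than l near radius 1.\<close>

lemma radial_oscillation_AE:
  fixes f :: "complex^'n \<Rightarrow> complex"
  assumes f: "f \<in> hardy_space" and l: "0 < l"
  shows "AE \<zeta> in torus_measure. \<exists>d<1. \<forall>r s. d < r \<longrightarrow> r < 1 \<longrightarrow> d < s \<longrightarrow> s < 1 \<longrightarrow>
     norm (f (r *\<^sub>R \<zeta>) - f (s *\<^sub>R \<zeta>)) \<le> 3 * l"
proof -
  define C where "C = 4 * (8 ^ CARD('n))\<^sup>2 / l\<^sup>2"
  have C: "C > 0" using l by (simp add: C_def)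
  have "\<exists>E \<rho>. E \<in> sets torus_measure \<and> emeasure torus_measure E \<le> ennreal (1 / real (Suc k)) \<and>
      0 < \<rho> \<and> \<rho> < 1 \<and> (\<forall>\<zeta>\<in>torus - E. \<forall>r. 0 < r \<longrightarrow> r < 1 \<longrightarrow> norm (f (r *\<^sub>R \<zeta>) - f (\<rho> *\<^sub>R (r *\<^sub>R \<zeta>))) \<le> l)" for k
  proof -
    \<comment> \<open>By the weak type bound the exceptional set has measure at most C e, which is 1
      / (k + 1).\<close>
    define e where "e = 1 / (C * real (Suc k))"
    have e: "e > 0" using C by (simp add: e_def)
    obtain \<rho> where \<rho>: "0 < \<rho>" "\<rho> < 1"
      "\<And>r. 0 \<le> r \<Longrightarrow> r < 1 \<Longrightarrow>
        (L2_norm torus_measure (\<lambda>\<zeta>. f (r *\<^sub>R \<zeta>) - f (\<rho> *\<^sub>R (r *\<^sub>R \<zeta>))))\<^sup>2 \<le> e"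
      by (rule hardy_dilate_approx[OF f e]) blast
    define h where "h z = f z + (-1) * f (\<rho> *\<^sub>R z)" for z
    have hol: "holomorphic_several_on h polydisc"
      unfolding h_def using \<rho>
      by (intro holomorphic_several_on_add holomorphic_several_on_cmult
        holomorphic_several_on_scale[OF hardy_holomorphic[OF f]] hardy_holomorphic[OF f]
        scale_polydisc_polydisc) auto
    have hB: "(L2_norm torus_measure (dilate h r))\<^sup>2 \<le> e" if "0 \<le> r" "r < 1" for r
      using \<rho>(3)[OF that] by (simp add: h_def)
    obtain E where E: "E \<in> sets torus_measure"
      "ennreal (l\<^sup>2) * emeasure torus_measure E \<le> 4 * (8 ^ CARD('n))\<^sup>2 * ennreal e"
      "\<And>\<zeta> r. \<zeta> \<in> torus \<Longrightarrow> \<zeta> \<notin> E \<Longrightarrow> 0 < r \<Longrightarrow> r < 1 \<Longrightarrow> norm (h (r *\<^sub>R \<zeta>)) \<le> l"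
      by (rule radial_maximal[OF hol l hB], assumption, assumption, blast)
    have "4 * (8 ^ CARD('n))\<^sup>2 * ennreal e = ennreal (4 * (8 ^ CARD('n))\<^sup>2 * e)"
      using e by (simp add: ennreal_mult' flip: ennreal_power)
    also have "4 * (8 ^ CARD('n))\<^sup>2 * e = l\<^sup>2 * (1 / real (Suc k))"
      using l by (simp add: e_def C_def)
    also have "ennreal \<dots> = ennreal (l\<^sup>2) * ennreal (1 / real (Suc k))"
      by (rule ennreal_mult') simp
    finally have "ennreal (l\<^sup>2) * emeasure torus_measure E \<le> ennreal (l\<^sup>2) * ennreal (1 / real (Suc k))"
      using E(2) by simp
    then have "emeasure torus_measure E \<le> ennreal (1 / real (Suc k))"
      using l by (subst (asm) ennreal_mult_le_mult_iff) auto
    then show ?thesis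
      using E(1,3) \<rho>(1,2) by (intro exI[of _ E] exI[of _ \<rho>]) (auto simp: h_def)
  qed
  then obtain E \<rho> where E: "\<And>k. E k \<in> sets torus_measure"
    "\<And>k. emeasure torus_measure (E k) \<le> ennreal (1 / real (Suc k))"
    "\<And>k. 0 < \<rho> k" "\<And>k. \<rho> k < 1"
    "\<And>k \<zeta> r. \<zeta> \<in> torus \<Longrightarrow> \<zeta> \<notin> E k \<Longrightarrow> 0 < r \<Longrightarrow> r < 1 \<Longrightarrow>
      norm (f (r *\<^sub>R \<zeta>) - f (\<rho> k *\<^sub>R (r *\<^sub>R \<zeta>))) \<le> l"
    by (metis DiffI)
  \<comment> \<open>The intersection is enough as exceptional set: a point outside a single E k
    already has small oscillation.\<close>
  have null: "(\<Inter>k. E k) \<in> null_sets torus_measure"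
  proof (rule null_setsI)
    show "(\<Inter>k. E k) \<in> sets torus_measure" using E(1) by auto
    have "emeasure torus_measure (\<Inter>k. E k) \<le> ennreal (1 / real (Suc k))" for k
      using emeasure_mono[of "\<Inter>k. E k" "E k" torus_measure] E(1,2)[of k] by (auto intro: order_trans)
    moreover have "(\<lambda>k. ennreal (1 / real (Suc k))) \<longlonglongrightarrow> ennreal 0"
      by (intro tendsto_ennrealI LIMSEQ_Suc lim_1_over_n)
    ultimately have "emeasure torus_measure (\<Inter>k. E k) \<le> ennreal 0"
      by (intro LIMSEQ_le_const) auto
    then show "emeasure torus_measure (\<Inter>k. E k) = 0" by simp
  qed
  show ?thesis
  proof (rule AE_I'[OF null], intro subsetI INT_I)
    fix \<zeta> :: "complex^'n" and k
    assume "\<zeta> \<in> {\<zeta>\<in>space torus_measure. \<not> (\<exists>d<1. \<forall>r s. d < r \<longrightarrow> r < 1 \<longrightarrow> d < s \<longrightarrow> s < 1 \<longrightarrow>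
     norm (f (r *\<^sub>R \<zeta>) - f (s *\<^sub>R \<zeta>)) \<le> 3 * l)}"
    then have \<zeta>: "\<zeta> \<in> torus" and neg: "\<not> (\<exists>d<1. \<forall>r s. d < r \<longrightarrow> r < 1 \<longrightarrow> d < s \<longrightarrow> s < 1 \<longrightarrow>
     norm (f (r *\<^sub>R \<zeta>) - f (s *\<^sub>R \<zeta>)) \<le> 3 * l)"
      by (simp_all del: not_ex not_all)
    show "\<zeta> \<in> E k"
    proof (rule ccontr)
      assume nE: "\<zeta> \<notin> E k"
      have "isCont (\<lambda>r. f (\<rho> k *\<^sub>R (r *\<^sub>R \<zeta>))) 1"
      proof -
        have "\<rho> k *\<^sub>R (1 *\<^sub>R \<zeta>) \<in> polydisc"
          using scaled_torus_polydisc[of "\<rho> k" \<zeta>] E(3,4)[of k] \<zeta> by simp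
        then obtain f' where "(f has_derivative f') (at (\<rho> k *\<^sub>R (1 *\<^sub>R \<zeta>)))"
          using hardy_holomorphic[OF f] unfolding holomorphic_several_on_def by blast
        then have "isCont f (\<rho> k *\<^sub>R (1 *\<^sub>R \<zeta>))" by (rule has_derivative_continuous)
        then show ?thesis
          by (rule isCont_o2[where f="\<lambda>r. \<rho> k *\<^sub>R (r *\<^sub>R \<zeta>)" and g=f, rotated])
            (intro continuous_intros)
      qed
      then obtain d where d: "d > 0"
        "\<And>r. dist r 1 < d \<Longrightarrow> dist (f (\<rho> k *\<^sub>R (r *\<^sub>R \<zeta>))) (f (\<rho> k *\<^sub>R (1 *\<^sub>R \<zeta>))) < l / 2"
        unfolding continuous_at_eps_delta using l by (metis half_gt_zero)
      \<comment> \<open>The total is l + l for the two approximations plus l/2 + l/2 from continuity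
        at radius 1.\<close>
      have "norm (f (r *\<^sub>R \<zeta>) - f (s *\<^sub>R \<zeta>)) \<le> 3 * l"
        if "max 0 (1 - d) < r" "r < 1" "max 0 (1 - d) < s" "s < 1" for r s
      proof -
        let ?g = "\<lambda>r. f (\<rho> k *\<^sub>R (r *\<^sub>R \<zeta>))"
        have "norm (f (r *\<^sub>R \<zeta>) - ?g r) \<le> l" "norm (f (s *\<^sub>R \<zeta>) - ?g s) \<le> l"
          using E(5)[OF \<zeta> nE] that by auto
        moreover have "dist (?g r) (?g 1) < l / 2" "dist (?g s) (?g 1) < l / 2"
          using that by (intro d(2); simp add: dist_real_def)+
        moreover have "norm (f (r *\<^sub>R \<zeta>) - f (s *\<^sub>R \<zeta>)) \<le> norm (f (r *\<^sub>R \<zeta>) - ?g r)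
            + norm (f (s *\<^sub>R \<zeta>) - ?g s) + dist (?g r) (?g 1) + dist (?g s) (?g 1)"
          using dist_triangle[of "f (r *\<^sub>R \<zeta>)" "f (s *\<^sub>R \<zeta>)" "?g r"]
            dist_triangle2[of "?g r" "f (s *\<^sub>R \<zeta>)" "?g 1"]
            dist_triangle[of "f (s *\<^sub>R \<zeta>)" "?g 1" "?g s"]
          unfolding dist_norm by linarith
        ultimately show ?thesis by linarith
      qed
      moreover have "max 0 (1 - d) < 1" using d by simp
      ultimately show False using neg by blast
    qed
  qed
qed

text \<open>Cauchy's criterion, in the form that \<open>radial_oscillation_AE\<close> yields for l =
  1 / (k + 1).\<close>

lemma left_limit_exists:
  fixes g :: "real \<Rightarrow> complex"
  assumes "\<And>k. \<exists>d<1. \<forall>r s. d < r \<longrightarrow> r < 1 \<longrightarrow> d < s \<longrightarrow> s < 1 \<longrightarrow> norm (g r - g s) \<le> 3 * (1 / real (Suc k))"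
  shows "\<exists>l. (g \<longlongrightarrow> l) (at_left 1)"
proof -
  have "\<exists>d<1. \<forall>r s. d < r \<longrightarrow> r < 1 \<longrightarrow> d < s \<longrightarrow> s < 1 \<longrightarrow> norm (g r - g s) < e" if e: "e > 0" for e
  proof -
    obtain k where "1 / real (Suc k) < e / 3"
      using e by (metis nat_approx_posE zero_less_divide_iff zero_less_numeral)
    then have "3 * (1 / real (Suc k)) < e" by linarith
    then show ?thesis using assms[of k] by (meson le_less_trans)
  qed
  then obtain d where d: "\<And>e. e > 0 \<Longrightarrow> d e < 1"
    "\<And>e r s. e > 0 \<Longrightarrow> d e < r \<Longrightarrow> r < 1 \<Longrightarrow> d e < s \<Longrightarrow> s < 1 \<Longrightarrow> norm (g r - g s) < e"
    by metis
  define x where "x n = 1 - 1 / real (Suc n)" for n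
  have x1: "x n < 1" for n by (simp add: x_def)
  have "x \<longlonglongrightarrow> 1 - 0"
    unfolding x_def by (intro tendsto_diff tendsto_const LIMSEQ_Suc lim_1_over_n)
  then have x: "x \<longlonglongrightarrow> 1" by simp
  have ev: "eventually (\<lambda>n. d e < x n) sequentially" if "e > 0" for e
    using order_tendstoD(1)[OF x d(1)[OF that]] .
  have "Cauchy (\<lambda>n. g (x n))"
  proof (rule metric_CauchyI)
    fix e :: real assume e: "e > 0"
    obtain N where "\<And>n. n \<ge> N \<Longrightarrow> d e < x n" using ev[OF e] unfolding eventually_sequentially by blast
    then show "\<exists>M. \<forall>m\<ge>M. \<forall>n\<ge>M. dist (g (x m)) (g (x n)) < e"
      using d(2)[OF e] x1 by (intro exI[of _ N]) (auto simp: dist_norm)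
  qed
  then obtain l where l: "(\<lambda>n. g (x n)) \<longlonglongrightarrow> l" by (auto simp: Cauchy_convergent_iff convergent_def)
  have "(g \<longlongrightarrow> l) (at_left 1)"
  proof (rule tendstoI)
    fix e :: real assume e: "e > 0"
    have "dist (g r) l < e" if r: "d (e/2) < r" "r < 1" for r
    proof -
      have e2: "e / 2 > 0" using e by simp
      have "eventually (\<lambda>n. norm (g r - g (x n)) \<le> e/2) sequentially"
        using ev[OF e2] by eventually_elim (rule less_imp_le, rule d(2)[OF e2 r _ x1])
      moreover have "(\<lambda>n. norm (g r - g (x n))) \<longlonglongrightarrow> norm (g r - l)"
        by (intro tendsto_intros l)
      ultimately have "norm (g r - l) \<le> e/2"
        by (intro tendsto_upperbound[where F=sequentially]) auto
      then show ?thesis using e by (simp add: dist_norm)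
    qed
    then show "eventually (\<lambda>r. dist (g r) l < e) (at_left 1)"
      unfolding eventually_at_left_field using d(1)[of "e/2"] e by auto
  qed
  then show ?thesis ..
qed

lemma hardy_radial_limit_AE:
  fixes f :: "complex^'n \<Rightarrow> complex"
  assumes f: "f \<in> hardy_space"
  shows "AE \<zeta> in torus_measure. ((\<lambda>r. f (r *\<^sub>R \<zeta>)) \<longlongrightarrow> boundary_value f \<zeta>) (at_left 1)"
proof -
  have "AE \<zeta> in torus_measure. \<forall>k::nat. \<exists>d<1. \<forall>r s. d < r \<longrightarrow> r < 1 \<longrightarrow> d < s \<longrightarrow> s < 1 \<longrightarrow>
     norm (f (r *\<^sub>R \<zeta>) - f (s *\<^sub>R \<zeta>)) \<le> 3 * (1 / real (Suc k))"
    unfolding AE_all_countable by (intro allI radial_oscillation_AE f) simp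
  then show ?thesis
  proof eventually_elim
    case (elim \<zeta>)
    then obtain l where l: "((\<lambda>r. f (r *\<^sub>R \<zeta>)) \<longlongrightarrow> l) (at_left 1)"
      using left_limit_exists[of "\<lambda>r. f (r *\<^sub>R \<zeta>)"] by blast
    then have "boundary_value f \<zeta> = l"
      unfolding boundary_value_def by (intro tendsto_Lim) auto
    with l show ?case by simp
  qed
qed

section \<open>Boundary values as L2 functions\<close>

lemma boundary_value_eqI:
  "((\<lambda>r. f (r *\<^sub>R \<zeta>)) \<longlongrightarrow> l) (at_left 1) \<Longrightarrow> boundary_value f \<zeta> = l"
  unfolding boundary_value_def by (intro tendsto_Lim) auto

text \<open>\<open>Lim\<close> has a value also where no limit exists, so measurability involves two
  facts: the set of convergence is measurable, and off that set the value is one fixed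
  constant.\<close>

lemma boundary_value_measurable:
  fixes f :: "complex^'n \<Rightarrow> complex"
  assumes f: "holomorphic_several_on f polydisc"
  shows "boundary_value f \<in> borel_measurable torus_measure"
proof -
  obtain q :: "nat \<Rightarrow> real" where q: "range q = \<rat> \<inter> {0<..<1}" by (rule radial_rationals)
  then have q01: "0 < q i" "q i < 1" for i by auto
  have dil: "dilate f r \<in> borel_measurable torus_measure" if "0 \<le> r" "r < 1" for r
    using dilate_L2[OF f that] by (simp add: L2_functions_def)
  have qm[measurable]: "dilate f (q i) \<in> borel_measurable torus_measure" for i
    using q01[of i] by (intro dil) auto
  define x where "x n = 1 - 1 / real (Suc n)" for n
  have x01: "0 \<le> x n" "x n < 1" for n by (simp_all add: x_def)
  have xm[measurable]: "dilate f (x n) \<in> borel_measurable torus_measure" for n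
    by (intro dil x01)
  have "x \<longlonglongrightarrow> 1 - 0"
    unfolding x_def by (intro tendsto_diff tendsto_const LIMSEQ_Suc lim_1_over_n)
  then have xlim: "filterlim x (at_left 1) sequentially"
    using x01 by (auto simp: filterlim_at intro!: always_eventually less_imp_neq)
  \<comment> \<open>Cauchy's criterion with countable quantifiers only, hence measurable: the radii
    are rational and the thresholds are the x n.\<close>
  define P where "P \<zeta> \<longleftrightarrow> (\<forall>k. \<exists>n. \<forall>i j. x n < q i \<longrightarrow> x n < q j \<longrightarrow>
      norm (f (q i *\<^sub>R \<zeta>) - f (q j *\<^sub>R \<zeta>)) \<le> 3 * (1 / real (Suc k)))" for \<zeta>
  have [measurable]: "Measurable.pred torus_measure P" unfolding P_def by measurable
  have P_iff: "P \<zeta> \<longleftrightarrow> (\<exists>l. ((\<lambda>r. f (r *\<^sub>R \<zeta>)) \<longlongrightarrow> l) (at_left 1))" if \<zeta>: "\<zeta> \<in> torus" for \<zeta>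
  proof
    assume P: "P \<zeta>"
    show "\<exists>l. ((\<lambda>r. f (r *\<^sub>R \<zeta>)) \<longlongrightarrow> l) (at_left 1)"
    proof (rule left_limit_exists)
      fix k
      obtain n where n: "\<And>i j. x n < q i \<Longrightarrow> x n < q j \<Longrightarrow>
          norm (f (q i *\<^sub>R \<zeta>) - f (q j *\<^sub>R \<zeta>)) \<le> 3 * (1 / real (Suc k))"
        using P unfolding P_def by blast
      have cont: "continuous_on {x n<..<1} (\<lambda>t. f (t *\<^sub>R \<zeta>))"
        using x01[of n]
        by (intro continuous_intros continuous_on_compose2[OF holomorphic_several_on_imp_continuous_on[OF f]])
          (auto intro!: scaled_torus_polydisc \<zeta>)
      \<comment> \<open>Approximation from the right keeps the rational radii above the threshold x
        n.\<close>
      have approx: "\<exists>s. (\<forall>m. s m \<in> range q \<and> x n < s m) \<and> s \<longlonglongrightarrow> r" if r: "x n < r" "r < 1" for r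
      proof -
        have "\<exists>p\<in>\<rat>. r < p \<and> p < min 1 (r + 1 / real (Suc m))" for m
          using r by (intro Rats_dense_in_real) auto
        then obtain s where s: "\<And>m. s m \<in> \<rat>" "\<And>m. r < s m" "\<And>m. s m < min 1 (r + 1 / real (Suc m))" by metis
        have "(\<lambda>m. r + 1 / real (Suc m)) \<longlonglongrightarrow> r + 0"
          by (intro tendsto_add tendsto_const LIMSEQ_Suc lim_1_over_n)
        then have "s \<longlonglongrightarrow> r"
          using s by (intro tendsto_sandwich[of "\<lambda>_. r" s sequentially "\<lambda>m. r + 1 / real (Suc m)"])
            (auto intro!: always_eventually less_imp_le)
        moreover have "s m \<in> range q \<and> x n < s m" for m
          using s(1,2,3)[of m] r x01[of n] unfolding q by auto
        ultimately show ?thesis by blast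
      qed
      have "norm (f (r *\<^sub>R \<zeta>) - f (s *\<^sub>R \<zeta>)) \<le> 3 * (1 / real (Suc k))"
        if rs: "x n < r" "r < 1" "x n < s" "s < 1" for r s
      proof -
        obtain a where a: "\<And>m. a m \<in> range q" "\<And>m. x n < a m" "a \<longlonglongrightarrow> r" using approx[OF rs(1,2)] by blast
        obtain b where b: "\<And>m. b m \<in> range q" "\<And>m. x n < b m" "b \<longlonglongrightarrow> s" using approx[OF rs(3,4)] by blast
        have ab1: "a m < 1" "b m < 1" for m using a(1)[of m] b(1)[of m] unfolding q by auto
        have "(\<lambda>m. norm (f (a m *\<^sub>R \<zeta>) - f (b m *\<^sub>R \<zeta>))) \<longlonglongrightarrow> norm (f (r *\<^sub>R \<zeta>) - f (s *\<^sub>R \<zeta>))"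
          using rs a b ab1
          by (intro tendsto_intros continuous_on_tendsto_compose[OF cont]) (auto intro!: always_eventually)
        moreover have "norm (f (a m *\<^sub>R \<zeta>) - f (b m *\<^sub>R \<zeta>)) \<le> 3 * (1 / real (Suc k))" for m
          using n a(1,2)[of m] b(1,2)[of m] by auto
        ultimately show ?thesis by (intro LIMSEQ_le_const2) auto
      qed
      then show "\<exists>d<1. \<forall>r s. d < r \<longrightarrow> r < 1 \<longrightarrow> d < s \<longrightarrow> s < 1 \<longrightarrow>
          norm (f (r *\<^sub>R \<zeta>) - f (s *\<^sub>R \<zeta>)) \<le> 3 * (1 / real (Suc k))"
        using x01[of n] by blast
    qed
  next
    assume "\<exists>l. ((\<lambda>r. f (r *\<^sub>R \<zeta>)) \<longlongrightarrow> l) (at_left 1)"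
    then obtain l where l: "((\<lambda>r. f (r *\<^sub>R \<zeta>)) \<longlongrightarrow> l) (at_left 1)" by blast
    show "P \<zeta>"
      unfolding P_def
    proof
      fix k
      have "eventually (\<lambda>r. dist (f (r *\<^sub>R \<zeta>)) l < 1 / real (Suc k)) (at_left 1)"
        using l by (rule tendstoD) simp
      then obtain d where d: "d < 1" "\<And>r. d < r \<Longrightarrow> r < 1 \<Longrightarrow> dist (f (r *\<^sub>R \<zeta>)) l < 1 / real (Suc k)"
        unfolding eventually_at_left_field by blast
      obtain n where n: "1 / real (Suc n) < 1 - d" using d(1) by (metis nat_approx_posE diff_gt_0_iff_gt)
      show "\<exists>n. \<forall>i j. x n < q i \<longrightarrow> x n < q j \<longrightarrow>
          norm (f (q i *\<^sub>R \<zeta>) - f (q j *\<^sub>R \<zeta>)) \<le> 3 * (1 / real (Suc k))"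
      proof (intro exI[of _ n] allI impI)
        fix i j assume "x n < q i" "x n < q j"
        then have "dist (f (q i *\<^sub>R \<zeta>)) l < 1 / real (Suc k)" "dist (f (q j *\<^sub>R \<zeta>)) l < 1 / real (Suc k)"
          using n q01 by (intro d(2); simp add: x_def)+
        then have "dist (f (q i *\<^sub>R \<zeta>)) (f (q j *\<^sub>R \<zeta>)) < 2 * (1 / real (Suc k))"
          using dist_triangle2[of "f (q i *\<^sub>R \<zeta>)" "f (q j *\<^sub>R \<zeta>)" l] by linarith
        moreover have "0 < 1 / real (Suc k)" by simp
        ultimately show "norm (f (q i *\<^sub>R \<zeta>) - f (q j *\<^sub>R \<zeta>)) \<le> 3 * (1 / real (Suc k))"
          unfolding dist_norm by linarith
      qed
    qed
  qed
  \<comment> \<open>Where no limit exists, \<open>Lim\<close> unfolds to this description of an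
    object that does not exist, the same at every point.\<close>
  define c :: complex where "c = (THE l. False)"
  have "boundary_value f \<zeta> = (if P \<zeta> then lim (\<lambda>n. f (x n *\<^sub>R \<zeta>)) else c)" if \<zeta>: "\<zeta> \<in> torus" for \<zeta>
  proof (cases "P \<zeta>")
    case True
    then obtain l where l: "((\<lambda>r. f (r *\<^sub>R \<zeta>)) \<longlongrightarrow> l) (at_left 1)" using P_iff[OF \<zeta>] by blast
    have "(\<lambda>n. f (x n *\<^sub>R \<zeta>)) \<longlonglongrightarrow> l" by (rule filterlim_compose[OF l xlim])
    then show ?thesis using True boundary_value_eqI[OF l] by (simp add: limI)
  next
    case False
    then have "((\<lambda>r. f (r *\<^sub>R \<zeta>)) \<longlongrightarrow> l) (at_left 1) \<longleftrightarrow> False" for l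
      using P_iff[OF \<zeta>] by blast
    then have "boundary_value f \<zeta> = c"
      unfolding boundary_value_def Topological_Spaces.Lim_def c_def by presburger
    with False show ?thesis by simp
  qed
  moreover have "(\<lambda>\<zeta>. if P \<zeta> then lim (\<lambda>n. f (x n *\<^sub>R \<zeta>)) else c) \<in> borel_measurable torus_measure"
    by (intro measurable_If borel_measurable_lim_metric) measurable
  ultimately show ?thesis
    by (subst measurable_cong) auto
qed

text \<open>Fatou along x_n, applied to f(x_n \<zeta>) - f(r \<zeta>), carries the Cauchy bound to
  the radial limit; adding back one dilate shows membership in L2.\<close>

lemma hardy_boundary:
  fixes f :: "complex^'n \<Rightarrow> complex"
  assumes f: "f \<in> hardy_space"
  shows hardy_boundary_L2: "boundary_value f \<in> L2_functions torus_measure"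
    and hardy_dilate_tendsto:
      "((\<lambda>r. L2_norm torus_measure (\<lambda>\<zeta>. boundary_value f \<zeta> - f (r *\<^sub>R \<zeta>))) \<longlongrightarrow> 0) (at_left 1)"
proof -
  note hol = hardy_holomorphic[OF f]
  note [measurable] = boundary_value_measurable[OF hol]
  define x where "x n = 1 - 1 / real (Suc n)" for n
  have x01: "0 \<le> x n" "x n < 1" for n by (simp_all add: x_def)
  have "x \<longlonglongrightarrow> 1 - 0"
    unfolding x_def by (intro tendsto_diff tendsto_const LIMSEQ_Suc lim_1_over_n)
  then have x1: "x \<longlonglongrightarrow> 1" by simp
  then have xlim: "filterlim x (at_left 1) sequentially"
    using x01 by (auto simp: filterlim_at intro!: always_eventually less_imp_neq)
  have main: "(\<lambda>\<zeta>. boundary_value f \<zeta> - f (r *\<^sub>R \<zeta>)) \<in> L2_functions torus_measure \<and>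
      L2_norm torus_measure (\<lambda>\<zeta>. boundary_value f \<zeta> - f (r *\<^sub>R \<zeta>)) \<le> e"
    if e: "e > 0" and s: "0 < s" "\<And>t r. s \<le> t \<Longrightarrow> t \<le> r \<Longrightarrow> r < 1 \<Longrightarrow>
      (L2_norm torus_measure (\<lambda>\<zeta>. f (r *\<^sub>R \<zeta>) - f (t *\<^sub>R \<zeta>)))\<^sup>2 \<le> e\<^sup>2" and r: "s \<le> r" "r < 1" for e s r
  proof -
    have r0: "0 \<le> r" using s r by simp
    have [measurable]: "dilate f r \<in> borel_measurable torus_measure"
      using dilate_L2[OF hol r0 r(2)] by (simp add: L2_functions_def)
    have 1: "(\<lambda>\<zeta>. f (x n *\<^sub>R \<zeta>) - f (r *\<^sub>R \<zeta>)) \<in> L2_functions torus_measure" for n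
      by (intro L2_diff dilate_L2 hol x01 r0 r)
    have 2: "AE \<zeta> in torus_measure. (\<lambda>n. f (x n *\<^sub>R \<zeta>) - f (r *\<^sub>R \<zeta>)) \<longlonglongrightarrow> boundary_value f \<zeta> - f (r *\<^sub>R \<zeta>)"
      using hardy_radial_limit_AE[OF f]
    proof eventually_elim
      case (elim \<zeta>)
      show ?case by (intro tendsto_intros filterlim_compose[OF elim xlim])
    qed
    have 3: "eventually (\<lambda>n. L2_norm torus_measure (\<lambda>\<zeta>. f (x n *\<^sub>R \<zeta>) - f (r *\<^sub>R \<zeta>)) \<le> e) sequentially"
      using order_tendstoD(1)[OF x1 r(2)]
    proof eventually_elim
      case (elim n)
      have "(L2_norm torus_measure (\<lambda>\<zeta>. f (x n *\<^sub>R \<zeta>) - f (r *\<^sub>R \<zeta>)))\<^sup>2 \<le> e\<^sup>2"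
        using elim r x01 by (intro s) auto
      then show ?case using e by (auto intro: power2_le_imp_le)
    qed
    have 4: "(\<lambda>\<zeta>. boundary_value f \<zeta> - f (r *\<^sub>R \<zeta>)) \<in> borel_measurable torus_measure" by measurable
    show ?thesis using L2_Fatou[OF 1 4 2 3] by simp
  qed
  show "((\<lambda>r. L2_norm torus_measure (\<lambda>\<zeta>. boundary_value f \<zeta> - f (r *\<^sub>R \<zeta>))) \<longlongrightarrow> 0) (at_left 1)"
  proof (rule tendstoI)
    fix e :: real assume e: "e > 0"
    have e2: "(e/2)\<^sup>2 > 0" using e by simp
    obtain s where s: "0 < s" "s < 1" "\<And>t r. s \<le> t \<Longrightarrow> t \<le> r \<Longrightarrow> r < 1 \<Longrightarrow>
      (L2_norm torus_measure (\<lambda>\<zeta>. f (r *\<^sub>R \<zeta>) - f (t *\<^sub>R \<zeta>)))\<^sup>2 \<le> (e/2)\<^sup>2"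
      by (rule hardy_Cauchy[OF f e2]) blast
    have "dist (L2_norm torus_measure (\<lambda>\<zeta>. boundary_value f \<zeta> - f (r *\<^sub>R \<zeta>))) 0 < e" if "s < r" "r < 1" for r
      using main[of "e/2" s r] s e that by (auto intro: le_less_trans)
    then show "eventually (\<lambda>r. dist (L2_norm torus_measure (\<lambda>\<zeta>. boundary_value f \<zeta> - f (r *\<^sub>R \<zeta>))) 0 < e) (at_left 1)"
      unfolding eventually_at_left_field using s by blast
  qed
  obtain s where s: "0 < s" "s < 1" "\<And>t r. s \<le> t \<Longrightarrow> t \<le> r \<Longrightarrow> r < 1 \<Longrightarrow>
      (L2_norm torus_measure (\<lambda>\<zeta>. f (r *\<^sub>R \<zeta>) - f (t *\<^sub>R \<zeta>)))\<^sup>2 \<le> 1\<^sup>2"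
    by (rule hardy_Cauchy[OF f, of "1\<^sup>2"], simp, blast)
  have "(\<lambda>\<zeta>. (boundary_value f \<zeta> - f (s *\<^sub>R \<zeta>)) + f (s *\<^sub>R \<zeta>)) \<in> L2_functions torus_measure"
    using main[of 1 s s] s by (intro L2_add dilate_L2 hol) auto
  then show "boundary_value f \<in> L2_functions torus_measure" by simp
qed

section \<open>The Hardy space and the model space\<close>

lemma hardy_add:
  fixes f g :: "complex^'n \<Rightarrow> complex"
  assumes f: "f \<in> hardy_space" and g: "g \<in> hardy_space"
  shows "(\<lambda>z. f z + g z) \<in> hardy_space"
proof -
  obtain B1 where B1: "\<And>r. 0 \<le> r \<Longrightarrow> r < 1 \<Longrightarrow> (L2_norm torus_measure (dilate f r))\<^sup>2 \<le> B1"
    by (rule hardy_sup[OF f]) blast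
  obtain B2 where B2: "\<And>r. 0 \<le> r \<Longrightarrow> r < 1 \<Longrightarrow> (L2_norm torus_measure (dilate g r))\<^sup>2 \<le> B2"
    by (rule hardy_sup[OF g]) blast
  show ?thesis
  proof (rule hardy_spaceI)
    show "holomorphic_several_on (\<lambda>z. f z + g z) polydisc"
      by (intro holomorphic_several_on_add hardy_holomorphic f g)
    fix r :: real assume r: "0 < r" "r < 1"
    have "L2_norm torus_measure (\<lambda>\<zeta>. f (r *\<^sub>R \<zeta>) + g (r *\<^sub>R \<zeta>))
        \<le> L2_norm torus_measure (dilate f r) + L2_norm torus_measure (dilate g r)"
      using r by (intro L2_triangle dilate_L2 hardy_holomorphic f g) auto
    also have "\<dots> \<le> sqrt B1 + sqrt B2"
      using B1[of r] B2[of r] r by (intro add_mono real_le_rsqrt) auto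
    finally show "(L2_norm torus_measure (\<lambda>\<zeta>. f (r *\<^sub>R \<zeta>) + g (r *\<^sub>R \<zeta>)))\<^sup>2 \<le> (sqrt B1 + sqrt B2)\<^sup>2"
      by (intro power_mono) auto
  qed
qed

lemma hardy_cmult:
  fixes f :: "complex^'n \<Rightarrow> complex"
  assumes f: "f \<in> hardy_space"
  shows "(\<lambda>z. c * f z) \<in> hardy_space"
proof -
  obtain B where B: "\<And>r. 0 \<le> r \<Longrightarrow> r < 1 \<Longrightarrow> (L2_norm torus_measure (dilate f r))\<^sup>2 \<le> B"
    by (rule hardy_sup[OF f]) blast
  show ?thesis
  proof (rule hardy_spaceI[where B="(norm c)\<^sup>2 * B"])
    show "holomorphic_several_on (\<lambda>z. c * f z) polydisc"
      by (intro holomorphic_several_on_cmult hardy_holomorphic f)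
  qed (auto simp: L2_norm_cmult power_mult_distrib intro!: mult_left_mono B)
qed

lemma hardy_diff:
  fixes f g :: "complex^'n \<Rightarrow> complex"
  assumes "f \<in> hardy_space" "g \<in> hardy_space"
  shows "(\<lambda>z. f z - g z) \<in> hardy_space"
  using hardy_add[OF assms(1) hardy_cmult[OF assms(2), of "-1"]] by simp

lemma hardy_mult_bounded:
  fixes f g :: "complex^'n \<Rightarrow> complex"
  assumes f: "holomorphic_several_on f polydisc" "\<And>z. z \<in> polydisc \<Longrightarrow> norm (f z) \<le> 1"
    and g: "g \<in> hardy_space"
  shows "(\<lambda>z. f z * g z) \<in> hardy_space"
proof -
  obtain B where B: "\<And>r. 0 \<le> r \<Longrightarrow> r < 1 \<Longrightarrow> (L2_norm torus_measure (dilate g r))\<^sup>2 \<le> B"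
    by (rule hardy_sup[OF g]) blast
  have hol: "holomorphic_several_on (\<lambda>z. f z * g z) polydisc"
    by (intro holomorphic_several_on_mult hardy_holomorphic f g)
  show ?thesis
  proof (rule hardy_spaceI[OF hol])
    fix r :: real assume r: "0 < r" "r < 1"
    have "L2_norm torus_measure (dilate (\<lambda>z. f z * g z) r) \<le> L2_norm torus_measure (dilate g r)"
      using r by (intro L2_norm_mono dilate_L2 hol hardy_holomorphic g)
        (auto simp: norm_mult intro!: mult_left_le_one_le f scaled_torus_polydisc)
    then have "(L2_norm torus_measure (dilate (\<lambda>z. f z * g z) r))\<^sup>2 \<le> (L2_norm torus_measure (dilate g r))\<^sup>2"
      by (intro power_mono) auto
    also have "\<dots> \<le> B" using r by (intro B) auto
    finally show "(L2_norm torus_measure (dilate (\<lambda>z. f z * g z) r))\<^sup>2 \<le> B" .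
  qed
qed

lemma hardy_one: "(\<lambda>z::complex^'n. 1) \<in> hardy_space"
  by (rule hardy_spaceI[where B=1]) (auto simp: L2_norm_def holomorphic_several_on_const)

lemma hardy_cauchy_kernel:
  fixes w :: "complex^'n"
  assumes w: "w \<in> polydisc"
  shows "(\<lambda>z. cauchy_kernel z w) \<in> hardy_space"
proof -
  have hol: "holomorphic_several_on (\<lambda>z. cauchy_kernel z w) polydisc"
    by (rule holomorphic_several_on_subset[OF cauchy_kernel_holomorphic[OF w] polydisc_subset_closed])
  have "compact (closed_polydisc :: (complex^'n) set)"
  proof -
    have "closed_polydisc = (\<Inter>j. {z::complex^'n. norm (z $ j) \<le> 1})" by (auto simp: closed_polydisc_def)
    moreover have "closed (\<Inter>j. {z::complex^'n. norm (z $ j) \<le> 1})"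
      by (intro closed_INT ballI closed_Collect_le continuous_intros)
    moreover have "bounded (closed_polydisc :: (complex^'n) set)"
      unfolding bounded_iff
    proof (intro exI ballI)
      fix z :: "complex^'n" assume "z \<in> closed_polydisc"
      then have "(\<Sum>i\<in>UNIV. norm (z $ i)) \<le> (\<Sum>i\<in>(UNIV::'n set). 1)"
        by (intro sum_mono) (simp add: closed_polydisc_def)
      then show "norm z \<le> real CARD('n)"
        using L2_set_le_sum[of UNIV "\<lambda>i. norm (z $ i)"] by (simp add: norm_vec_def)
    qed
    ultimately show ?thesis by (simp add: compact_eq_bounded_closed)
  qed
  then have "bounded ((\<lambda>z. cauchy_kernel z w) ` closed_polydisc)"
    by (intro compact_imp_bounded compact_continuous_image cauchy_kernel_continuous w)
  then obtain B where B: "B > 0" "\<And>z. z \<in> closed_polydisc \<Longrightarrow> norm (cauchy_kernel z w) \<le> B"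
    unfolding bounded_pos by auto
  show ?thesis
  proof (rule hardy_spaceI[OF hol])
    fix r :: real assume r: "0 < r" "r < 1"
    have "L2_norm torus_measure (\<lambda>\<zeta>. cauchy_kernel (r *\<^sub>R \<zeta>) w) \<le> L2_norm torus_measure (\<lambda>\<zeta>::complex^'n. complex_of_real B)"
    proof (intro L2_norm_mono torus.L2_const)
      show "(\<lambda>\<zeta>. cauchy_kernel (r *\<^sub>R \<zeta>) w) \<in> L2_functions torus_measure"
        using dilate_L2[OF hol] r by simp
      show "norm (cauchy_kernel (r *\<^sub>R \<zeta>) w) \<le> norm (complex_of_real B)" if "\<zeta> \<in> space torus_measure" for \<zeta>
        using that r B scaled_torus_polydisc[of r \<zeta>] polydisc_subset_closed by auto
    qed
    also have "\<dots> = B" using B by (simp add: L2_norm_def)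
    finally show "(L2_norm torus_measure (\<lambda>\<zeta>. cauchy_kernel (r *\<^sub>R \<zeta>) w))\<^sup>2 \<le> B\<^sup>2"
      by (intro power_mono) auto
  qed
qed

section \<open>The inner product and the norm of the Hardy space\<close>

lemma boundary_value_add_AE:
  fixes f g :: "complex^'n \<Rightarrow> complex"
  assumes "f \<in> hardy_space" "g \<in> hardy_space"
  shows "AE \<zeta> in torus_measure. boundary_value (\<lambda>z. f z + g z) \<zeta> = boundary_value f \<zeta> + boundary_value g \<zeta>"
  using hardy_radial_limit_AE[OF assms(1)] hardy_radial_limit_AE[OF assms(2)]
  by eventually_elim (intro boundary_value_eqI tendsto_intros)

lemma boundary_value_cmult_AE:
  fixes f :: "complex^'n \<Rightarrow> complex"
  assumes "f \<in> hardy_space"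
  shows "AE \<zeta> in torus_measure. boundary_value (\<lambda>z. c * f z) \<zeta> = c * boundary_value f \<zeta>"
  using hardy_radial_limit_AE[OF assms]
  by eventually_elim (intro boundary_value_eqI tendsto_intros)

lemma boundary_value_mult_AE:
  fixes f g :: "complex^'n \<Rightarrow> complex"
  assumes "f \<in> hardy_space" "g \<in> hardy_space"
  shows "AE \<zeta> in torus_measure. boundary_value (\<lambda>z. f z * g z) \<zeta> = boundary_value f \<zeta> * boundary_value g \<zeta>"
  using hardy_radial_limit_AE[OF assms(1)] hardy_radial_limit_AE[OF assms(2)]
  by eventually_elim (intro boundary_value_eqI tendsto_intros)

lemma boundary_value_cauchy_kernel:
  fixes w \<zeta> :: "complex^'n"
  assumes w: "w \<in> polydisc" and \<zeta>: "\<zeta> \<in> torus"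
  shows "boundary_value (\<lambda>z. cauchy_kernel z w) \<zeta> = cauchy_kernel \<zeta> w"
proof (rule boundary_value_eqI)
  have "continuous_on {0..1} (\<lambda>r. cauchy_kernel (r *\<^sub>R \<zeta>) w)"
    using \<zeta> torus_subset_closed
    by (intro continuous_on_compose2[OF cauchy_kernel_continuous(1)[OF w]] continuous_intros)
      (auto intro!: scale_closed_polydisc)
  then have "((\<lambda>r. cauchy_kernel (r *\<^sub>R \<zeta>) w) \<longlongrightarrow> cauchy_kernel (1 *\<^sub>R \<zeta>) w) (at 1 within {0..1})"
    unfolding continuous_on_def by (drule_tac x=1 in bspec) auto
  moreover have "at 1 within {0..1} = at_left (1::real)"
    by (rule at_within_Icc_at_left) simp
  ultimately show "((\<lambda>r. cauchy_kernel (r *\<^sub>R \<zeta>) w) \<longlongrightarrow> cauchy_kernel \<zeta> w) (at_left 1)" by simp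
qed

lemma hardy_bv_measurable:
  "f \<in> hardy_space \<Longrightarrow> boundary_value f \<in> borel_measurable torus_measure"
  by (rule boundary_value_measurable[OF hardy_holomorphic])

lemma hardy_inner_add_left:
  fixes f g h :: "complex^'n \<Rightarrow> complex"
  assumes f: "f \<in> hardy_space" and g: "g \<in> hardy_space" and h: "h \<in> hardy_space"
  shows "hardy_inner (\<lambda>z. f z + g z) h = hardy_inner f h + hardy_inner g h"
proof -
  have "hardy_inner (\<lambda>z. f z + g z) h
      = L2_inner torus_measure (\<lambda>\<zeta>. boundary_value f \<zeta> + boundary_value g \<zeta>) (boundary_value h)"
    unfolding hardy_inner_def
    using L2_add[OF hardy_boundary_L2[OF f] hardy_boundary_L2[OF g]]
    by (intro L2_inner_cong_AE boundary_value_add_AE f g hardy_bv_measurable hardy_add h)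
      (auto simp: L2_functions_def)
  then show ?thesis
    by (simp add: hardy_inner_def L2_inner_add_left hardy_boundary_L2 f g h)
qed

lemma hardy_inner_cmult_left:
  fixes f h :: "complex^'n \<Rightarrow> complex"
  assumes f: "f \<in> hardy_space" and h: "h \<in> hardy_space"
  shows "hardy_inner (\<lambda>z. c * f z) h = c * hardy_inner f h"
proof -
  have "hardy_inner (\<lambda>z. c * f z) h = L2_inner torus_measure (\<lambda>\<zeta>. c * boundary_value f \<zeta>) (boundary_value h)"
    unfolding hardy_inner_def
    using L2_cmult[OF hardy_boundary_L2[OF f], of c]
    by (intro L2_inner_cong_AE boundary_value_cmult_AE f hardy_bv_measurable hardy_cmult h)
      (auto simp: L2_functions_def)
  then show ?thesis by (simp add: hardy_inner_def L2_inner_cmult_left)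
qed

lemma hardy_inner_cnj: "hardy_inner g f = cnj (hardy_inner f g)"
  unfolding hardy_inner_def by (rule L2_inner_cnj)

lemma hardy_inner_add_right:
  fixes f g h :: "complex^'n \<Rightarrow> complex"
  assumes "f \<in> hardy_space" "g \<in> hardy_space" "h \<in> hardy_space"
  shows "hardy_inner h (\<lambda>z. f z + g z) = hardy_inner h f + hardy_inner h g"
  using hardy_inner_add_left[OF assms] by (subst (1 2 3) hardy_inner_cnj) simp

lemma hardy_inner_cmult_right:
  fixes f h :: "complex^'n \<Rightarrow> complex"
  assumes "f \<in> hardy_space" "h \<in> hardy_space"
  shows "hardy_inner h (\<lambda>z. c * f z) = cnj c * hardy_inner h f"
  by (subst (1 2) hardy_inner_cnj) (simp add: hardy_inner_cmult_left[OF assms])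

lemma hardy_inner_self: "hardy_inner f f = complex_of_real ((hardy_norm f)\<^sup>2)"
  unfolding hardy_inner_def hardy_norm_def by (rule L2_inner_self)

lemma hardy_norm_nonneg [simp]: "0 \<le> hardy_norm f"
  by (simp add: hardy_norm_def)

lemma hardy_norm_cmult:
  fixes f :: "complex^'n \<Rightarrow> complex"
  assumes f: "f \<in> hardy_space"
  shows "hardy_norm (\<lambda>z. c * f z) = norm c * hardy_norm f"
proof -
  have "hardy_norm (\<lambda>z. c * f z) = L2_norm torus_measure (\<lambda>\<zeta>. c * boundary_value f \<zeta>)"
    unfolding hardy_norm_def
    using L2_cmult[OF hardy_boundary_L2[OF f], of c]
    by (intro L2_norm_cong_AE boundary_value_cmult_AE f hardy_bv_measurable hardy_cmult)
      (auto simp: L2_functions_def)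
  then show ?thesis by (simp add: hardy_norm_def L2_norm_cmult)
qed

lemma hardy_norm_add:
  fixes f g :: "complex^'n \<Rightarrow> complex"
  assumes f: "f \<in> hardy_space" and g: "g \<in> hardy_space"
  shows "hardy_norm (\<lambda>z. f z + g z)
    = L2_norm torus_measure (\<lambda>\<zeta>. boundary_value f \<zeta> + boundary_value g \<zeta>)"
  unfolding hardy_norm_def
  using L2_add[OF hardy_boundary_L2[OF f] hardy_boundary_L2[OF g]]
  by (intro L2_norm_cong_AE boundary_value_add_AE f g hardy_bv_measurable hardy_add)
    (auto simp: L2_functions_def)

lemma hardy_norm_triangle:
  fixes f g :: "complex^'n \<Rightarrow> complex"
  assumes "f \<in> hardy_space" "g \<in> hardy_space"
  shows "hardy_norm (\<lambda>z. f z + g z) \<le> hardy_norm f + hardy_norm g"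
  unfolding hardy_norm_add[OF assms] unfolding hardy_norm_def
  by (intro L2_triangle hardy_boundary_L2 assms)

lemma hardy_norm_add_sq:
  fixes f g :: "complex^'n \<Rightarrow> complex"
  assumes "f \<in> hardy_space" "g \<in> hardy_space"
  shows "(hardy_norm (\<lambda>z. f z + g z))\<^sup>2 = (hardy_norm f)\<^sup>2 + (hardy_norm g)\<^sup>2 + 2 * Re (hardy_inner f g)"
  unfolding hardy_norm_add[OF assms] unfolding hardy_norm_def hardy_inner_def
  by (intro L2_norm_add_sq hardy_boundary_L2 assms)

lemma hardy_Cauchy_Schwarz:
  fixes f g :: "complex^'n \<Rightarrow> complex"
  assumes "f \<in> hardy_space" "g \<in> hardy_space"
  shows "norm (hardy_inner f g) \<le> hardy_norm f * hardy_norm g"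
  unfolding hardy_norm_def hardy_inner_def by (intro L2_Cauchy_Schwarz hardy_boundary_L2 assms)

lemma hardy_norm_diff_commute:
  fixes f g :: "complex^'n \<Rightarrow> complex"
  assumes "f \<in> hardy_space" "g \<in> hardy_space"
  shows "hardy_norm (\<lambda>z. f z - g z) = hardy_norm (\<lambda>z. g z - f z)"
  using hardy_norm_cmult[OF hardy_diff[OF assms], of "-1"] by simp

text \<open>The norms of the dilates increase with r, and the dilates converge in L2 to the boundary
  value.\<close>

lemma dilate_norm_le_hardy_norm:
  fixes f :: "complex^'n \<Rightarrow> complex"
  assumes f: "f \<in> hardy_space" and r: "0 \<le> r" "r < 1"
  shows "L2_norm torus_measure (dilate f r) \<le> hardy_norm f"
proof (rule field_le_epsilon)
  fix e :: real assume e: "e > 0"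
  have "eventually (\<lambda>s. dist (L2_norm torus_measure (\<lambda>\<zeta>. boundary_value f \<zeta> - f (s *\<^sub>R \<zeta>))) 0 < e) (at_left 1)"
    using hardy_dilate_tendsto[OF f] e by (rule tendstoD)
  moreover have "eventually (\<lambda>s. r < s \<and> s < 1) (at_left (1::real))"
    unfolding eventually_at_left_field using r by blast
  ultimately have "eventually (\<lambda>s. dist (L2_norm torus_measure (\<lambda>\<zeta>. boundary_value f \<zeta> - f (s *\<^sub>R \<zeta>))) 0 < e
      \<and> r < s \<and> s < 1) (at_left 1)"
    by (rule eventually_conj)
  then obtain s where s: "L2_norm torus_measure (\<lambda>\<zeta>. boundary_value f \<zeta> - f (s *\<^sub>R \<zeta>)) < e" "r < s" "s < 1"
    by (auto dest!: eventually_happens)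
  have "L2_norm torus_measure (dilate f r) \<le> L2_norm torus_measure (dilate f s)"
    using r s by (intro dilate_norm_mono hardy_holomorphic f) auto
  also have "L2_norm torus_measure (dilate f s)
      = L2_norm torus_measure (\<lambda>\<zeta>. boundary_value f \<zeta> + (f (s *\<^sub>R \<zeta>) - boundary_value f \<zeta>))" by simp
  also have "\<dots> \<le> hardy_norm f + L2_norm torus_measure (\<lambda>\<zeta>. f (s *\<^sub>R \<zeta>) - boundary_value f \<zeta>)"
    unfolding hardy_norm_def using r s
    by (intro L2_triangle L2_diff hardy_boundary_L2 dilate_L2 hardy_holomorphic f) auto
  also have "\<dots> \<le> hardy_norm f + e"
    using s(1) by (subst L2_norm_diff_commute) simp
  finally show "L2_norm torus_measure (dilate f r) \<le> hardy_norm f + e" .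
qed

text \<open>For the dilate of radius r this is the Cauchy formula, with value f(r w). As r tends to
  1 the values converge by continuity at w and the inner products by L2 convergence of the
  dilates.\<close>

lemma hardy_reproducing:
  fixes f :: "complex^'n \<Rightarrow> complex"
  assumes f: "f \<in> hardy_space" and w: "w \<in> polydisc"
  shows "hardy_inner f (\<lambda>z. cauchy_kernel z w) = f w"
proof -
  let ?C = "\<lambda>\<zeta>. cauchy_kernel \<zeta> w"
  note hol = hardy_holomorphic[OF f]
  have CL: "?C \<in> L2_functions torus_measure"
    by (rule L2_on_torus)
      (use cauchy_kernel_continuous(1)[OF w] torus_subset_closed continuous_on_subset in
        \<open>auto simp: torus.finite_measure_axioms\<close>)
  have "hardy_inner f ?C = L2_inner torus_measure (boundary_value f) ?C"
    unfolding hardy_inner_def L2_inner_def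
    by (intro Bochner_Integration.integral_cong refl) (simp add: boundary_value_cauchy_kernel[OF w])
  moreover have "L2_inner torus_measure (boundary_value f) ?C = f w"
  proof (rule tendsto_unique[of "at_left (1::real)" "\<lambda>r. f (r *\<^sub>R w)"])
    have ev: "eventually (\<lambda>r. 0 < r \<and> r < 1) (at_left (1::real))"
      unfolding eventually_at_left_field by (intro exI[of _ 0]) auto
    show "((\<lambda>r. f (r *\<^sub>R w)) \<longlongrightarrow> f w) (at_left 1)"
    proof -
      have "continuous_on {0..1} (\<lambda>r. f (r *\<^sub>R w))"
        using w by (intro continuous_on_compose2[OF holomorphic_several_on_imp_continuous_on[OF hol]] continuous_intros)
          (auto intro!: scale_polydisc_polydisc)
      then have "((\<lambda>r. f (r *\<^sub>R w)) \<longlongrightarrow> f (1 *\<^sub>R w)) (at 1 within {0..1})"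
        unfolding continuous_on_def by (drule_tac x=1 in bspec) auto
      moreover have "at 1 within {0..1} = at_left (1::real)"
        by (rule at_within_Icc_at_left) simp
      ultimately show ?thesis by simp
    qed
    have "((\<lambda>r. f (r *\<^sub>R w) - L2_inner torus_measure (boundary_value f) ?C) \<longlongrightarrow> 0) (at_left 1)"
    proof (rule Lim_null_comparison)
      show "((\<lambda>r. L2_norm torus_measure (\<lambda>\<zeta>. boundary_value f \<zeta> - f (r *\<^sub>R \<zeta>)) * L2_norm torus_measure ?C) \<longlongrightarrow> 0) (at_left 1)"
        by (rule tendsto_mult_left_zero[OF hardy_dilate_tendsto[OF f]])
      show "eventually (\<lambda>r. norm (f (r *\<^sub>R w) - L2_inner torus_measure (boundary_value f) ?C)
          \<le> L2_norm torus_measure (\<lambda>\<zeta>. boundary_value f \<zeta> - f (r *\<^sub>R \<zeta>)) * L2_norm torus_measure ?C) (at_left 1)"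
        using ev
      proof eventually_elim
        case (elim r)
        then have r: "0 \<le> r" "r < 1" by auto
        have holr: "holomorphic_several_on (dilate f r) closed_polydisc"
          by (rule holomorphic_several_on_scale[OF hol]) (rule scale_polydisc[OF r])
        have 1: "L2_inner torus_measure (dilate f r) ?C = f (r *\<^sub>R w)"
          using torus_Cauchy_formula[OF holr w] by (simp add: L2_inner_def cauchy_kernel_cnj)
        have "L2_inner torus_measure (\<lambda>\<zeta>. (boundary_value f \<zeta> - f (r *\<^sub>R \<zeta>)) + f (r *\<^sub>R \<zeta>)) ?C
            = L2_inner torus_measure (\<lambda>\<zeta>. boundary_value f \<zeta> - f (r *\<^sub>R \<zeta>)) ?C + f (r *\<^sub>R w)"
          using 1 by (subst L2_inner_add_left) (auto intro!: L2_diff hardy_boundary_L2 f dilate_L2 hol r CL)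
        then have "norm (f (r *\<^sub>R w) - L2_inner torus_measure (boundary_value f) ?C)
            = norm (L2_inner torus_measure (\<lambda>\<zeta>. boundary_value f \<zeta> - f (r *\<^sub>R \<zeta>)) ?C)"
          by (simp add: norm_minus_commute)
        also have "\<dots> \<le> L2_norm torus_measure (\<lambda>\<zeta>. boundary_value f \<zeta> - f (r *\<^sub>R \<zeta>)) * L2_norm torus_measure ?C"
          by (intro L2_Cauchy_Schwarz L2_diff hardy_boundary_L2 f dilate_L2 hol r CL)
        finally show ?case .
      qed
    qed
    then show "((\<lambda>r. f (r *\<^sub>R w)) \<longlongrightarrow> L2_inner torus_measure (boundary_value f) ?C) (at_left 1)"
      by (rule LIM_zero_cancel)
  qed simp
  ultimately show ?thesis by simp
qed

text \<open>Cauchy-Schwarz with |C(.,w)|^2 = C(w,w). The bound is uniform on the torus of radius r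
  and provides the majorant for dominated convergence in the density proof.\<close>

lemma hardy_point_bound:
  fixes f :: "complex^'n \<Rightarrow> complex"
  assumes f: "f \<in> hardy_space" and r: "0 \<le> r" "r < 1" and \<zeta>: "\<zeta> \<in> torus"
  shows "norm (f (r *\<^sub>R \<zeta>)) \<le> hardy_norm f * sqrt ((1 / (1 - r\<^sup>2)) ^ CARD('n))"
proof -
  have w: "r *\<^sub>R \<zeta> \<in> polydisc" by (rule scaled_torus_polydisc[OF r \<zeta>])
  note C = hardy_cauchy_kernel[OF w]
  have "(r *\<^sub>R \<zeta>) $ j * cnj ((r *\<^sub>R \<zeta>) $ j) = complex_of_real (r\<^sup>2)" for j
  proof -
    have "(r *\<^sub>R \<zeta>) $ j * cnj ((r *\<^sub>R \<zeta>) $ j) = complex_of_real ((norm ((r *\<^sub>R \<zeta>) $ j))\<^sup>2)"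
      by (rule complex_norm_square[symmetric])
    also have "norm ((r *\<^sub>R \<zeta>) $ j) = r" using \<zeta> r by (simp add: torus_def)
    finally show ?thesis .
  qed
  then have "cauchy_kernel (r *\<^sub>R \<zeta>) (r *\<^sub>R \<zeta>) = complex_of_real ((1 / (1 - r\<^sup>2)) ^ CARD('n))"
    by (simp add: cauchy_kernel_def)
  then have "complex_of_real ((hardy_norm (\<lambda>z. cauchy_kernel z (r *\<^sub>R \<zeta>)))\<^sup>2) = complex_of_real ((1 / (1 - r\<^sup>2)) ^ CARD('n))"
    using hardy_reproducing[OF C w] hardy_inner_self[of "\<lambda>z. cauchy_kernel z (r *\<^sub>R \<zeta>)"] by simp
  then have "hardy_norm (\<lambda>z. cauchy_kernel z (r *\<^sub>R \<zeta>)) = sqrt ((1 / (1 - r\<^sup>2)) ^ CARD('n))"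
    by (metis hardy_norm_nonneg of_real_eq_iff real_sqrt_unique)
  then show ?thesis
    using hardy_Cauchy_Schwarz[OF f C] hardy_reproducing[OF f w] by simp
qed

section \<open>Inner functions and the model space\<close>

lemma inner_functionD:
  assumes "inner_function I"
  shows "holomorphic_several_on I polydisc" "\<And>z. z \<in> polydisc \<Longrightarrow> norm (I z) < 1"
    "AE \<zeta> in torus_measure. norm (boundary_value I \<zeta>) = 1"
proof -
  show "holomorphic_several_on I polydisc" "\<And>z. z \<in> polydisc \<Longrightarrow> norm (I z) < 1"
    using assms by (auto simp: inner_function_def)
  have "AE \<zeta> in torus_measure. \<exists>l. ((\<lambda>r. I (r *\<^sub>R \<zeta>)) \<longlongrightarrow> l) (at_left 1) \<and> norm l = 1"
    using assms by (simp add: inner_function_def)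
  then show "AE \<zeta> in torus_measure. norm (boundary_value I \<zeta>) = 1"
    by eventually_elim (auto dest: boundary_value_eqI)
qed

lemma inner_function_mult:
  fixes I :: "complex^'n \<Rightarrow> complex"
  assumes I: "inner_function I" and f: "f \<in> hardy_space"
  shows "(\<lambda>z. I z * f z) \<in> hardy_space"
  by (rule hardy_mult_bounded[OF inner_functionD(1)[OF I] less_imp_le[OF inner_functionD(2)[OF I]] f])

lemma inner_function_isometry:
  fixes I :: "complex^'n \<Rightarrow> complex"
  assumes I: "inner_function I" and f: "f \<in> hardy_space" and g: "g \<in> hardy_space"
  shows "hardy_inner (\<lambda>z. I z * f z) (\<lambda>z. I z * g z) = hardy_inner f g"
proof -
  have IH: "I \<in> hardy_space" using inner_function_mult[OF I hardy_one] by simp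
  note [measurable] = hardy_bv_measurable[OF inner_function_mult[OF I f]]
    hardy_bv_measurable[OF inner_function_mult[OF I g]] hardy_bv_measurable[OF f] hardy_bv_measurable[OF g]
  show ?thesis
    unfolding hardy_inner_def L2_inner_def
  proof (rule integral_cong_AE)
    show "AE \<zeta> in torus_measure. boundary_value (\<lambda>z. I z * f z) \<zeta> * cnj (boundary_value (\<lambda>z. I z * g z) \<zeta>)
        = boundary_value f \<zeta> * cnj (boundary_value g \<zeta>)"
      using inner_functionD(3)[OF I] boundary_value_mult_AE[OF IH f] boundary_value_mult_AE[OF IH g]
    proof eventually_elim
      case (elim \<zeta>)
      have "boundary_value I \<zeta> * cnj (boundary_value I \<zeta>) = 1"
        using elim(1) by (simp flip: complex_norm_square)
      then show ?case unfolding elim(2,3) by (simp add: mult_ac)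
    qed
  qed measurable
qed

lemma model_space_hardy: "f \<in> model_space I \<Longrightarrow> f \<in> hardy_space"
  by (simp add: model_space_def)

lemma model_space_add:
  fixes I :: "complex^'n \<Rightarrow> complex"
  assumes I: "inner_function I" and f: "f \<in> model_space I" and g: "g \<in> model_space I"
  shows "(\<lambda>z. f z + g z) \<in> model_space I"
  using f g by (auto simp: model_space_def hardy_add hardy_inner_add_left inner_function_mult[OF I])

lemma model_space_cmult:
  fixes I :: "complex^'n \<Rightarrow> complex"
  assumes I: "inner_function I" and f: "f \<in> model_space I"
  shows "(\<lambda>z. c * f z) \<in> model_space I"
  using f by (auto simp: model_space_def hardy_cmult hardy_inner_cmult_left inner_function_mult[OF I])

lemma model_space_diff:
  fixes I :: "complex^'n \<Rightarrow> complex"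
  assumes I: "inner_function I" and f: "f \<in> model_space I" and g: "g \<in> model_space I"
  shows "(\<lambda>z. f z - g z) \<in> model_space I"
  using model_space_add[OF I f model_space_cmult[OF I g, of "-1"]] by simp

lemma model_kernel_eq:
  "model_kernel I w = (\<lambda>z. cauchy_kernel z w + (- cnj (I w)) * (I z * cauchy_kernel z w))"
  by (auto simp: model_kernel_def algebra_simps)

text \<open>Write C_w for C(.,w). Then <C_w, I g> is the conjugate of I(w) g(w), while <I C_w, I g>
  = <C_w, g> is the conjugate of g(w); the coefficient of I C_w in K_w makes the two cancel.\<close>

lemma model_kernel_in_model_space:
  fixes I :: "complex^'n \<Rightarrow> complex"
  assumes I: "inner_function I" and w: "w \<in> polydisc"
  shows "model_kernel I w \<in> model_space I"
proof -
  note C = hardy_cauchy_kernel[OF w]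
  note IC = inner_function_mult[OF I C]
  have "hardy_inner (model_kernel I w) (\<lambda>z. I z * g z) = 0" if g: "g \<in> hardy_space" for g
  proof -
    note Ig = inner_function_mult[OF I g]
    have "hardy_inner (model_kernel I w) (\<lambda>z. I z * g z)
      = hardy_inner (\<lambda>z. cauchy_kernel z w) (\<lambda>z. I z * g z) - cnj (I w) * hardy_inner (\<lambda>z. cauchy_kernel z w) g"
      unfolding model_kernel_eq
      by (subst hardy_inner_add_left[OF C hardy_cmult[OF IC] Ig], subst hardy_inner_cmult_left[OF IC Ig],
          subst inner_function_isometry[OF I C g]) simp
    also have "hardy_inner (\<lambda>z. cauchy_kernel z w) (\<lambda>z. I z * g z) = cnj (I w * g w)"
      using hardy_inner_cnj[of "\<lambda>z. cauchy_kernel z w" "\<lambda>z. I z * g z"] hardy_reproducing[OF Ig w] by simp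
    also have "hardy_inner (\<lambda>z. cauchy_kernel z w) g = cnj (g w)"
      using hardy_inner_cnj[of "\<lambda>z. cauchy_kernel z w" g] hardy_reproducing[OF g w] by simp
    finally show ?thesis by simp
  qed
  moreover have "model_kernel I w \<in> hardy_space"
    unfolding model_kernel_eq by (intro hardy_add hardy_cmult C IC)
  ultimately show ?thesis by (simp add: model_space_def)
qed

text \<open>The second term of K_w lies in I H^2, which is orthogonal to f, so the Cauchy kernel
  alone acts.\<close>

lemma model_kernel_reproducing:
  fixes I :: "complex^'n \<Rightarrow> complex"
  assumes I: "inner_function I" and f: "f \<in> model_space I" and w: "w \<in> polydisc"
  shows "hardy_inner f (model_kernel I w) = f w"
proof -
  note C = hardy_cauchy_kernel[OF w]
  note IC = inner_function_mult[OF I C]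
  note fH = model_space_hardy[OF f]
  have "hardy_inner f (\<lambda>z. I z * cauchy_kernel z w) = 0"
    using f C by (simp add: model_space_def)
  then show ?thesis
    unfolding model_kernel_eq
    by (subst hardy_inner_add_right[OF C hardy_cmult[OF IC] fH], subst hardy_inner_cmult_right[OF IC fH],
        subst hardy_reproducing[OF fH w]) simp
qed

text \<open>Formal linear combinations as lists: sums are appended lists, and points may repeat. The
  same list is read again in L^2(\<sigma>) by \<open>clark_comb\<close>, so both readings are
  compared before any question whether the map is well defined.\<close>

fun kernel_comb :: "(complex^'n \<Rightarrow> complex) \<Rightarrow> (complex \<times> (complex^'n)) list \<Rightarrow> complex^'n \<Rightarrow> complex" where
  "kernel_comb I [] = (\<lambda>z. 0)"
| "kernel_comb I ((c, w) # L) = (\<lambda>z. c * model_kernel I w z + kernel_comb I L z)"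

definition polydisc_list :: "(complex \<times> (complex^'n)) list \<Rightarrow> bool" where
  "polydisc_list L \<longleftrightarrow> (\<forall>(c, w)\<in>set L. w \<in> polydisc)"

definition scale_list :: "complex \<Rightarrow> (complex \<times> (complex^'n)) list \<Rightarrow> (complex \<times> (complex^'n)) list" where
  "scale_list a L = map (\<lambda>(c, w). (a * c, w)) L"

lemma polydisc_list_simps [simp]:
  "polydisc_list []"
  "polydisc_list ((c, w) # L) \<longleftrightarrow> w \<in> polydisc \<and> polydisc_list L"
  "polydisc_list (L @ M) \<longleftrightarrow> polydisc_list L \<and> polydisc_list M"
  "polydisc_list (scale_list a L) \<longleftrightarrow> polydisc_list L"
  by (auto simp: polydisc_list_def scale_list_def)

lemma kernel_comb_append: "kernel_comb I (L @ M) z = kernel_comb I L z + kernel_comb I M z"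
  by (induction L) auto

lemma kernel_comb_scale: "kernel_comb I (scale_list a L) z = a * kernel_comb I L z"
  by (induction L) (auto simp: scale_list_def algebra_simps)

lemma kernel_comb_model_space:
  fixes I :: "complex^'n \<Rightarrow> complex"
  assumes I: "inner_function I"
  shows "polydisc_list L \<Longrightarrow> kernel_comb I L \<in> model_space I"
proof (induction L)
  case Nil
  have "0 \<in> (polydisc :: (complex^'n) set)" by (simp add: polydisc_def)
  from model_space_cmult[OF I model_kernel_in_model_space[OF I this], of 0] show ?case by simp
next
  case (Cons p L)
  then show ?case
    by (cases p) (auto intro!: model_space_add model_space_cmult model_kernel_in_model_space I)
qed

text \<open>Density of the kernels. The differences \<open>e\<^sub>n\<close> of \<open>f\<close> and a minimizing sequence form a Cauchy
  sequence, and \<open>e\<^sub>n(w) = \<langle>e\<^sub>n, K\<^sub>w\<rangle> \<rightarrow> 0\<close> for all \<open>w\<close> by minimality; since one dilate of some \<open>e\<^sub>N\<close> is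
  close to \<open>e\<^sub>N\<close>, this forces \<open>e\<^sub>n \<rightarrow> 0\<close> without any use of completeness.\<close>

lemma kernel_comb_dense:
  fixes I :: "complex^'n \<Rightarrow> complex"
  assumes I: "inner_function I" and f: "f \<in> model_space I" and eps: "\<epsilon> > 0"
  shows "\<exists>L. polydisc_list L \<and> hardy_norm (\<lambda>z. f z - kernel_comb I L z) < \<epsilon>"
proof -
  define Q where "Q L = (hardy_norm (\<lambda>z. f z - kernel_comb I L z))\<^sup>2" for L
  define D where "D = (INF L\<in>Collect polydisc_list. Q L)"
  have bdd: "bdd_below (Q ` Collect polydisc_list)"
    by (rule bdd_belowI2[where m=0]) (simp add: Q_def)
  have D_le: "D \<le> Q L" if "polydisc_list L" for L
    unfolding D_def using that by (intro cINF_lower bdd) simp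
  have "\<exists>L. polydisc_list L \<and> Q L < D + 1 / real (Suc n)" for n
  proof -
    have "(INF L\<in>Collect polydisc_list. Q L) < D + 1 / real (Suc n)" by (simp add: D_def)
    then show ?thesis
      by (subst (asm) cINF_less_iff[OF _ bdd]) (auto intro: exI[of _ "[]"])
  qed
  then obtain L where L: "\<And>n. polydisc_list (L n)" "\<And>n. Q (L n) < D + 1 / real (Suc n)" by metis
  define e where "e n = (\<lambda>z. f z - kernel_comb I (L n) z)" for n
  have eM: "e n \<in> model_space I" for n
    unfolding e_def by (intro model_space_diff I f kernel_comb_model_space L)
  have eH: "e n \<in> hardy_space" for n by (rule model_space_hardy[OF eM])
  have Qe: "Q (L n) = (hardy_norm (e n))\<^sup>2" for n by (simp add: Q_def e_def)
  have pointwise: "(\<lambda>n. e n w) \<longlonglongrightarrow> 0" if w: "w \<in> polydisc" for w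
  proof -
    define k where "k = (hardy_norm (model_kernel I w))\<^sup>2"
    have k0: "0 \<le> k" by (simp add: k_def)
    note KH = model_space_hardy[OF model_kernel_in_model_space[OF I w]]
    have "(norm (e n w))\<^sup>2 \<le> (k + 1) * (1 / real (Suc n))" for n
    proof -
      \<comment> \<open>Minimality is tested in direction K_w. The coefficient e_n(w) / k would be
        optimal; k + 1 instead of k avoids a division by zero.\<close>
      define t where "t = 1 / (k + 1)"
      define c where "c = complex_of_real t * e n w"
      have t: "t > 0" "t * k \<le> 1" using k0 by (auto simp: t_def field_simps)
      have "D \<le> Q ((c, w) # L n)" using L(1) w by (intro D_le) simp
      also have "Q ((c, w) # L n) = (hardy_norm (\<lambda>z. e n z + (- c) * model_kernel I w z))\<^sup>2"
        unfolding Q_def e_def by (simp add: algebra_simps)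
      also have "\<dots> = (hardy_norm (e n))\<^sup>2 + (norm c)\<^sup>2 * k - 2 * Re (cnj c * e n w)"
        by (subst hardy_norm_add_sq[OF eH hardy_cmult[OF KH]], subst hardy_norm_cmult[OF KH],
            subst hardy_inner_cmult_right[OF KH eH], subst model_kernel_reproducing[OF I eM w])
          (simp add: k_def power_mult_distrib)
      also have "cnj c * e n w = complex_of_real (t * (norm (e n w))\<^sup>2)"
        unfolding c_def of_real_mult complex_norm_square by (simp add: mult_ac)
      also have "(norm c)\<^sup>2 * k = t * (t * k) * (norm (e n w))\<^sup>2"
        using t by (simp add: c_def norm_mult power_mult_distrib power2_eq_square)
      finally have "D \<le> (hardy_norm (e n))\<^sup>2 + t * (t * k) * (norm (e n w))\<^sup>2 - 2 * (t * (norm (e n w))\<^sup>2)"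
        by simp
      moreover have "t * (t * k) * (norm (e n w))\<^sup>2 \<le> t * 1 * (norm (e n w))\<^sup>2"
        using t by (intro mult_right_mono mult_left_mono) auto
      ultimately have "t * (norm (e n w))\<^sup>2 \<le> 1 / real (Suc n)"
        using L(2)[of n] unfolding Qe by linarith
      then have "(k + 1) * (t * (norm (e n w))\<^sup>2) \<le> (k + 1) * (1 / real (Suc n))"
        using k0 by (intro mult_left_mono) auto
      then show ?thesis using k0 by (simp add: t_def)
    qed
    moreover have "(\<lambda>n. (k + 1) * (1 / real (Suc n))) \<longlonglongrightarrow> (k + 1) * 0"
      by (intro tendsto_mult tendsto_const LIMSEQ_Suc lim_1_over_n)
    ultimately have "(\<lambda>n. (norm (e n w))\<^sup>2) \<longlonglongrightarrow> 0"
      by (intro Lim_null_comparison[of "\<lambda>n. (norm (e n w))\<^sup>2" "\<lambda>n. (k + 1) * (1 / real (Suc n))"]) auto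
    then have "(\<lambda>n. sqrt ((norm (e n w))\<^sup>2)) \<longlonglongrightarrow> sqrt 0" by (intro tendsto_intros)
    then show ?thesis by (simp add: tendsto_norm_zero_iff)
  qed
  have cauchy: "(hardy_norm (\<lambda>z. e n z - e m z))\<^sup>2 \<le> 2 / real (Suc n) + 2 / real (Suc m)" for n m
  proof -
    \<comment> \<open>The average of two combinations competes with the infimum D, so |e_n + e_m|^2
      \<ge> 4 D; the parallelogram law then bounds the difference.\<close>
    define M where "M = scale_list (1/2) (L n) @ scale_list (1/2) (L m)"
    have "D \<le> Q M" using L by (intro D_le) (simp add: M_def)
    also have "Q M = (hardy_norm (\<lambda>z. (1/2) * (e n z + e m z)))\<^sup>2"
      unfolding Q_def M_def e_def by (simp add: kernel_comb_append kernel_comb_scale field_simps)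
    also have "\<dots> = (hardy_norm (\<lambda>z. e n z + e m z))\<^sup>2 / 4"
      by (subst hardy_norm_cmult[OF hardy_add[OF eH eH]]) (simp add: power_divide)
    finally have "4 * D \<le> (hardy_norm (\<lambda>z. e n z + e m z))\<^sup>2" by simp
    also have "\<dots> = (hardy_norm (e n))\<^sup>2 + (hardy_norm (e m))\<^sup>2 + 2 * Re (hardy_inner (e n) (e m))"
      by (rule hardy_norm_add_sq[OF eH eH])
    finally have 1: "4 * D \<le> (hardy_norm (e n))\<^sup>2 + (hardy_norm (e m))\<^sup>2 + 2 * Re (hardy_inner (e n) (e m))" .
    have "(hardy_norm (\<lambda>z. e n z + (-1) * e m z))\<^sup>2
        = (hardy_norm (e n))\<^sup>2 + (hardy_norm (e m))\<^sup>2 - 2 * Re (hardy_inner (e n) (e m))"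
      by (subst hardy_norm_add_sq[OF eH hardy_cmult[OF eH]], subst hardy_norm_cmult[OF eH],
          subst hardy_inner_cmult_right[OF eH eH]) simp
    then have "(hardy_norm (\<lambda>z. e n z - e m z))\<^sup>2
        = (hardy_norm (e n))\<^sup>2 + (hardy_norm (e m))\<^sup>2 - 2 * Re (hardy_inner (e n) (e m))"
      by simp
    with 1 show ?thesis using L(2)[of n] L(2)[of m] unfolding Qe by linarith
  qed
  \<comment> \<open>Four errors add up: e_n to e_N in norm, e_N to its dilate, the dilate of e_N to
    that of e_n, and the size of the dilate of e_n.\<close>
  define \<delta> where "\<delta> = \<epsilon> / 4"
  have \<delta>: "\<delta> > 0" using eps by (simp add: \<delta>_def)
  obtain N where N: "1 / real (Suc N) < \<delta>\<^sup>2 / 4"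
    using \<delta> by (metis nat_approx_posE zero_less_divide_iff zero_less_numeral zero_less_power)
  have tail: "hardy_norm (\<lambda>z. e n z - e N z) \<le> \<delta>" if "n \<ge> N" for n
  proof (rule power2_le_imp_le)
    have "1 / real (Suc n) \<le> 1 / real (Suc N)" using that by (intro frac_le) auto
    moreover have "2 / real (Suc n) + 2 / real (Suc N) = 2 * (1 / real (Suc n)) + 2 * (1 / real (Suc N))" by simp
    ultimately show "(hardy_norm (\<lambda>z. e n z - e N z))\<^sup>2 \<le> \<delta>\<^sup>2"
      using cauchy[of n N] N by linarith
  qed (use \<delta> in simp)
  \<comment> \<open>The radius is fixed for e_N alone; passing to later e_n costs at most \<delta>
    since dilation does not increase the norm.\<close>
  have "eventually (\<lambda>r. dist (L2_norm torus_measure (\<lambda>\<zeta>. boundary_value (e N) \<zeta> - e N (r *\<^sub>R \<zeta>))) 0 < \<delta>) (at_left 1)"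
    using hardy_dilate_tendsto[OF eH] \<delta> by (rule tendstoD)
  moreover have "eventually (\<lambda>r. 0 < r \<and> r < 1) (at_left (1::real))"
    unfolding eventually_at_left_field by (intro exI[of _ 0]) auto
  ultimately have "eventually (\<lambda>r. dist (L2_norm torus_measure (\<lambda>\<zeta>. boundary_value (e N) \<zeta> - e N (r *\<^sub>R \<zeta>))) 0 < \<delta>
      \<and> 0 < r \<and> r < 1) (at_left 1)"
    by (rule eventually_conj)
  then obtain r where r: "L2_norm torus_measure (\<lambda>\<zeta>. boundary_value (e N) \<zeta> - e N (r *\<^sub>R \<zeta>)) < \<delta>" "0 \<le> r" "r < 1"
    by (auto dest!: eventually_happens)
  \<comment> \<open>At a fixed radius the bounded norms give a uniform pointwise bound, so the
    pointwise convergence to 0 holds in L2.\<close>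
  have dil0: "(\<lambda>n. L2_norm torus_measure (dilate (e n) r)) \<longlonglongrightarrow> 0"
  proof -
    define S where "S = sqrt ((1 / (1 - r\<^sup>2)) ^ CARD('n))"
    have meas[measurable]: "dilate (e n) r \<in> borel_measurable torus_measure" for n
      using dilate_L2[OF hardy_holomorphic[OF eH] r(2,3)] by (simp add: L2_functions_def)
    have S0: "0 \<le> S" using r by (simp add: S_def power_le_one)
    have enorm: "hardy_norm (e n) \<le> sqrt (D + 1)" for n
    proof (rule real_le_rsqrt)
      have "1 / real (Suc n) \<le> 1" by simp
      then show "(hardy_norm (e n))\<^sup>2 \<le> D + 1" using L(2)[of n] unfolding Qe by linarith
    qed
    have "(\<lambda>n. \<integral>\<zeta>. (norm (e n (r *\<^sub>R \<zeta>)))\<^sup>2 \<partial>torus_measure) \<longlonglongrightarrow> (\<integral>\<zeta>. 0 \<partial>(torus_measure :: (complex^'n) measure))"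
    proof (rule integral_dominated_convergence[where w="\<lambda>_. (sqrt (D + 1) * S)\<^sup>2"])
      show "AE \<zeta> in torus_measure. (\<lambda>n. (norm (e n (r *\<^sub>R \<zeta>)))\<^sup>2) \<longlonglongrightarrow> 0"
      proof (rule AE_I2)
        fix \<zeta> :: "complex^'n" assume "\<zeta> \<in> space torus_measure"
        then have "(\<lambda>n. e n (r *\<^sub>R \<zeta>)) \<longlonglongrightarrow> 0"
          by (intro pointwise scaled_torus_polydisc r) simp
        then have "(\<lambda>n. (norm (e n (r *\<^sub>R \<zeta>)))\<^sup>2) \<longlonglongrightarrow> (norm (0::complex))\<^sup>2" by (intro tendsto_intros)
        then show "(\<lambda>n. (norm (e n (r *\<^sub>R \<zeta>)))\<^sup>2) \<longlonglongrightarrow> 0" by simp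
      qed
      show "AE \<zeta> in torus_measure. norm ((norm (e n (r *\<^sub>R \<zeta>)))\<^sup>2) \<le> (sqrt (D + 1) * S)\<^sup>2" for n
      proof (rule AE_I2)
        fix \<zeta> :: "complex^'n" assume "\<zeta> \<in> space torus_measure"
        then have "norm (e n (r *\<^sub>R \<zeta>)) \<le> hardy_norm (e n) * S"
          unfolding S_def by (intro hardy_point_bound eH r) simp
        also have "\<dots> \<le> sqrt (D + 1) * S" using enorm S0 by (rule mult_right_mono)
        finally have "(norm (e n (r *\<^sub>R \<zeta>)))\<^sup>2 \<le> (sqrt (D + 1) * S)\<^sup>2" by (rule power_mono) simp
        then show "norm ((norm (e n (r *\<^sub>R \<zeta>)))\<^sup>2) \<le> (sqrt (D + 1) * S)\<^sup>2" by simp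
      qed
    qed simp_all
    then have "(\<lambda>n. sqrt (\<integral>\<zeta>. (norm (e n (r *\<^sub>R \<zeta>)))\<^sup>2 \<partial>torus_measure)) \<longlonglongrightarrow> sqrt 0"
      by (intro tendsto_real_sqrt) simp
    then show ?thesis by (simp add: L2_norm_def)
  qed
  then have "eventually (\<lambda>n. L2_norm torus_measure (dilate (e n) r) < \<delta>) sequentially"
    using \<delta> by (rule order_tendstoD)
  then obtain n where n: "n \<ge> N" "L2_norm torus_measure (dilate (e n) r) < \<delta>"
    unfolding eventually_sequentially by (metis nat_le_linear)
  note dL = dilate_L2[OF hardy_holomorphic[OF eH] r(2,3)]
  have "hardy_norm (e n) = hardy_norm (\<lambda>z. (e n z - e N z) + e N z)" by simp
  also have "\<dots> \<le> hardy_norm (\<lambda>z. e n z - e N z) + hardy_norm (e N)"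
    by (intro hardy_norm_triangle hardy_diff eH)
  finally have a1: "hardy_norm (e n) \<le> \<delta> + hardy_norm (e N)" using tail[OF n(1)] by simp
  have "hardy_norm (e N) = L2_norm torus_measure (\<lambda>\<zeta>. (boundary_value (e N) \<zeta> - e N (r *\<^sub>R \<zeta>)) + e N (r *\<^sub>R \<zeta>))"
    by (simp add: hardy_norm_def)
  also have "\<dots> \<le> L2_norm torus_measure (\<lambda>\<zeta>. boundary_value (e N) \<zeta> - e N (r *\<^sub>R \<zeta>)) + L2_norm torus_measure (dilate (e N) r)"
    by (intro L2_triangle L2_diff hardy_boundary_L2 eH dL)
  finally have a2: "hardy_norm (e N) < \<delta> + L2_norm torus_measure (dilate (e N) r)" using r(1) by linarith
  have "L2_norm torus_measure (dilate (e N) r)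
      = L2_norm torus_measure (\<lambda>\<zeta>. (e N (r *\<^sub>R \<zeta>) - e n (r *\<^sub>R \<zeta>)) + e n (r *\<^sub>R \<zeta>))" by simp
  also have "\<dots> \<le> L2_norm torus_measure (\<lambda>\<zeta>. e N (r *\<^sub>R \<zeta>) - e n (r *\<^sub>R \<zeta>)) + L2_norm torus_measure (dilate (e n) r)"
    by (intro L2_triangle L2_diff dL)
  also have "L2_norm torus_measure (\<lambda>\<zeta>. e N (r *\<^sub>R \<zeta>) - e n (r *\<^sub>R \<zeta>)) \<le> hardy_norm (\<lambda>z. e N z - e n z)"
    by (rule dilate_norm_le_hardy_norm[OF hardy_diff[OF eH eH] r(2,3)])
  also have "hardy_norm (\<lambda>z. e N z - e n z) \<le> \<delta>"
    using tail[OF n(1)] by (subst hardy_norm_diff_commute[OF eH eH])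
  finally have "L2_norm torus_measure (dilate (e N) r) < \<delta> + \<delta>" using n(2) by simp
  with a1 a2 have "hardy_norm (e n) < \<epsilon>" by (simp add: \<delta>_def)
  then show ?thesis using L(1) by (intro exI[of _ "L n"]) (simp add: e_def)
qed

section \<open>The isometry into the space of the Clark measure\<close>

text \<open>Differentiation under the integral. Local boundedness alone gives, by Cauchy's
  inequality, a uniform bound on the derivatives and hence on difference quotients; a constant
  majorant is integrable as M is finite.\<close>

lemma holomorphic_on_parameter_integral:
  fixes h :: "complex \<Rightarrow> 'a \<Rightarrow> complex"
  assumes M: "finite_measure M" and S: "open S"
    and hol: "\<And>x. x \<in> space M \<Longrightarrow> (\<lambda>y. h y x) holomorphic_on S"
    and meas: "\<And>y. y \<in> S \<Longrightarrow> h y \<in> borel_measurable M"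
    and bound: "\<And>a r. cball a r \<subseteq> S \<Longrightarrow> \<exists>B. \<forall>y\<in>cball a r. \<forall>x\<in>space M. norm (h y x) \<le> B"
  shows "(\<lambda>y. \<integral>x. h y x \<partial>M) holomorphic_on S"
  unfolding holomorphic_on_def
proof
  fix a assume a: "a \<in> S"
  interpret finite_measure M by fact
  obtain r where r: "r > 0" "cball a r \<subseteq> S"
    using open_contains_cball S a by blast
  obtain B where B: "\<And>y x. y \<in> cball a r \<Longrightarrow> x \<in> space M \<Longrightarrow> norm (h y x) \<le> B"
    using bound[OF r(2)] by blast
  \<comment> \<open>Half the radius, so that a closed disc of radius r/2 about any point of T stays
    in \<open>cball a r\<close>, where h is bounded by B.\<close>
  define T where "T = ball a (r/2)"
  have T: "T \<subseteq> S" "open T" "convex T" "a \<in> T" using r by (auto simp: T_def subset_iff)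
  define h' where "h' y x = deriv (\<lambda>y. h y x) y" for y x
  have deriv: "((\<lambda>y. h y x) has_field_derivative h' y x) (at y within T)" if "x \<in> space M" "y \<in> T" for x y
    unfolding h'_def using holomorphic_derivI[OF hol[OF that(1)] S] T that(2)
    by (auto intro: has_field_derivative_at_within)
  have deriv_le: "norm (h' y x) \<le> B / (r/2)" if x: "x \<in> space M" and y: "y \<in> T" for x y
  proof -
    have sub: "cball y (r/2) \<subseteq> cball a r"
    proof
      fix z assume "z \<in> cball y (r/2)"
      then show "z \<in> cball a r"
        using y dist_triangle[of a z y] by (simp add: T_def)
    qed
    have hb: "(\<lambda>y. h y x) holomorphic_on cball y (r/2)"
      using hol[OF x] sub r by (meson holomorphic_on_subset order_trans)
    have "norm ((deriv ^^ 1) (\<lambda>y. h y x) y) \<le> fact 1 * B / (r/2) ^ 1"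
    proof (rule Cauchy_inequality)
      show "(\<lambda>y. h y x) holomorphic_on ball y (r/2)" using hb by (rule holomorphic_on_subset) auto
      show "continuous_on (cball y (r/2)) (\<lambda>y. h y x)" using hb by (rule holomorphic_on_imp_continuous_on)
      show "norm (h z x) \<le> B" if "norm (y - z) = r/2" for z
        using that sub by (intro B x) (auto simp: dist_norm subset_iff)
    qed (use r in simp)
    then show ?thesis by (simp add: h'_def)
  qed
  have int: "integrable M (h y)" if "y \<in> T" for y
    using that T r B by (intro integrable_const_bound[where B=B] AE_I2 meas) (auto simp: T_def)
  have "((\<lambda>y. \<integral>x. h y x \<partial>M) has_field_derivative (\<integral>x. h' a x \<partial>M)) (at a within T)"
    unfolding has_field_derivative_iff tendsto_at_iff_sequentially comp_def
  proof (intro allI impI)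
    fix X :: "nat \<Rightarrow> complex"
    assume XT: "\<forall>i. X i \<in> T - {a}" and Xa: "X \<longlonglongrightarrow> a"
    have XT': "X i \<in> T" "X i \<noteq> a" for i using XT by auto
    have m[measurable]: "h (X i) \<in> borel_measurable M" "h a \<in> borel_measurable M" for i
      using XT' T by (auto intro!: meas)
    have lim: "(\<lambda>i. (h (X i) x - h a x) / (X i - a)) \<longlonglongrightarrow> h' a x" if "x \<in> space M" for x
      using deriv[OF that T(4)] XT Xa
      unfolding has_field_derivative_iff tendsto_at_iff_sequentially comp_def by blast
    \<comment> \<open>The derivative is measurable in x as a pointwise limit of difference
      quotients.\<close>
    have m'[measurable]: "h' a \<in> borel_measurable M"
      by (rule borel_measurable_LIMSEQ_metric[where f="\<lambda>i x. (h (X i) x - h a x) / (X i - a)"])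
        (use lim in simp_all)
    have "(\<lambda>i. \<integral>x. (h (X i) x - h a x) / (X i - a) \<partial>M) \<longlonglongrightarrow> (\<integral>x. h' a x \<partial>M)"
    proof (rule integral_dominated_convergence[where w="\<lambda>_. B / (r/2)"])
      show "AE x in M. (\<lambda>i. (h (X i) x - h a x) / (X i - a)) \<longlonglongrightarrow> h' a x"
        by (rule AE_I2) (rule lim)
      show "AE x in M. norm ((h (X i) x - h a x) / (X i - a)) \<le> B / (r/2)" for i
      proof (rule AE_I2)
        fix x assume x: "x \<in> space M"
        have "norm (h (X i) x - h a x) \<le> B / (r/2) * norm (X i - a)"
          by (rule field_differentiable_bound[OF T(3) deriv[OF x] deriv_le[OF x] XT'(1) T(4)])
        then show "norm ((h (X i) x - h a x) / (X i - a)) \<le> B / (r/2)"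
          using XT'(2)[of i] unfolding norm_divide by (subst pos_divide_le_eq) auto
      qed
    qed simp_all
    then show "(\<lambda>i. ((\<integral>x. h (X i) x \<partial>M) - (\<integral>x. h a x \<partial>M)) / (X i - a)) \<longlonglongrightarrow> (\<integral>x. h' a x \<partial>M)"
      using int[OF XT'(1)] int[OF T(4)] by simp
  qed
  then have "((\<lambda>y. \<integral>x. h y x \<partial>M) has_field_derivative (\<integral>x. h' a x \<partial>M)) (at a)"
    by (simp only: at_within_open[OF T(4,2)])
  then have "(\<lambda>y. \<integral>x. h y x \<partial>M) field_differentiable at a"
    unfolding field_differentiable_def by blast
  then show "(\<lambda>y. \<integral>x. h y x \<partial>M) field_differentiable at a within S"
    by (rule field_differentiable_at_within)
qed

text \<open>Makes the parameter domain in \<open>polarization\<close> convex: it is then connected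
  and contains 0, the midpoint of \<i> and -\<i>.\<close>

lemma convex_affine_norm_less:
  fixes a b :: complex
  shows "convex {y. norm (a + y * b) < 1}"
proof (rule convexI)
  fix x y :: complex and u v :: real
  assume x: "x \<in> {y. norm (a + y * b) < 1}" and y: "y \<in> {y. norm (a + y * b) < 1}"
    and uv: "0 \<le> u" "0 \<le> v" "u + v = 1"
  have v: "v = 1 - u" using uv by simp
  have "a + (u *\<^sub>R x + v *\<^sub>R y) * b = u *\<^sub>R (a + x * b) + v *\<^sub>R (a + y * b)"
    unfolding v scaleR_conv_of_real by (simp add: algebra_simps)
  then have "norm (a + (u *\<^sub>R x + v *\<^sub>R y) * b) \<le> u * norm (a + x * b) + v * norm (a + y * b)"
    using norm_triangle_ineq[of "u *\<^sub>R (a + x * b)" "v *\<^sub>R (a + y * b)"] uv by simp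
  also have "\<dots> < 1" using x y uv by (intro convex_bound_lt) auto
  finally show "u *\<^sub>R x + v *\<^sub>R y \<in> {y. norm (a + y * b) < 1}" by simp
qed

text \<open>Polarization along the complex line \<open>\<lambda> \<mapsto> (a + \<lambda> b, a + cnj \<lambda> b)\<close>: it meets the diagonal at
  the real points and passes through \<open>(z, w)\<close> at \<open>\<lambda> = \<i>\<close>.\<close>

lemma polarization:
  fixes F G :: "complex^'n \<Rightarrow> complex^'n \<Rightarrow> complex"
  assumes hol: "\<And>a b S. open S \<Longrightarrow> (\<And>y. y \<in> S \<Longrightarrow> a + y *s b \<in> polydisc) \<Longrightarrow>
        (\<And>y. y \<in> S \<Longrightarrow> a + cnj y *s b \<in> polydisc) \<Longrightarrow>
        (\<lambda>y. F (a + y *s b) (a + cnj y *s b) - G (a + y *s b) (a + cnj y *s b)) holomorphic_on S"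
    and diag: "\<And>z. z \<in> polydisc \<Longrightarrow> F z z = G z z"
    and z: "z \<in> polydisc" and w: "w \<in> polydisc"
  shows "F z w = G z w"
proof -
  define a where "a = (1/2) *s (z + w)"
  define b where "b = (- \<i> / 2) *s (z - w)"
  define S where "S = {y. a + y *s b \<in> polydisc} \<inter> {y. a + cnj y *s b \<in> polydisc}"
  define f where "f y = F (a + y *s b) (a + cnj y *s b) - G (a + y *s b) (a + cnj y *s b)" for y
  have z_eq: "a + \<i> *s b = z" and w_eq: "a + cnj \<i> *s b = w"
    by (simp_all add: a_def b_def vec_eq_iff field_simps)
  have eq1: "{y. a + y *s b \<in> polydisc} = (\<Inter>j. {y. norm (a $ j + y * b $ j) < 1})"
    by (auto simp: polydisc_def)
  \<comment> \<open>Conjugating inside the norm makes the condition affine in y again.\<close>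
  have eq2: "{y. a + cnj y *s b \<in> polydisc} = (\<Inter>j. {y. norm (cnj (a $ j) + y * cnj (b $ j)) < 1})"
  proof -
    have "norm (a $ j + cnj y * b $ j) = norm (cnj (a $ j) + y * cnj (b $ j))" for y j
      by (subst complex_mod_cnj[symmetric]) simp
    then show ?thesis by (auto simp: polydisc_def)
  qed
  have convS: "convex S"
    unfolding S_def eq1 eq2 by (intro convex_Int convex_INT convex_affine_norm_less)
  have openS: "open S"
    unfolding S_def eq1 eq2
    by (intro open_Int open_INT finite ballI open_Collect_less continuous_intros)
  have iS: "\<i> \<in> S" using z w z_eq w_eq by (simp add: S_def)
  \<comment> \<open>At -\<i> the line passes through (w, z), so the domain contains both of these
    parameters.\<close>
  have miS: "- \<i> \<in> S" using z w z_eq w_eq by (simp add: S_def)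
  have "(1/2) *\<^sub>R \<i> + (1/2) *\<^sub>R (- \<i>) \<in> S"
    using convS iS miS by (rule convexD) auto
  then have zeroS: "0 \<in> S" by simp
  \<comment> \<open>Near 0 the domain contains real parameters, where the difference f vanishes by
    \<open>diag\<close>; these accumulate at 0, as the identity theorem demands.\<close>
  have lim: "0 islimpt (S \<inter> \<real>)"
    unfolding islimpt_approachable
  proof (intro allI impI)
    fix e :: real assume e: "e > 0"
    obtain d where d: "d > 0" "ball 0 d \<subseteq> S" using openS zeroS open_contains_ball by blast
    define t where "t = complex_of_real (min d e / 2)"
    have "norm t = min d e / 2" using d e unfolding t_def norm_of_real by simp
    then have "t \<in> S" "dist t 0 < e" "t \<noteq> 0" using d e by (auto simp: subset_iff dist_norm)
    moreover have "t \<in> \<real>" by (simp add: t_def)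
    ultimately show "\<exists>x'\<in>S \<inter> \<real>. x' \<noteq> 0 \<and> dist x' 0 < e" by blast
  qed
  have "f \<i> = 0"
  proof (rule analytic_continuation[of f S "S \<inter> \<real>" 0])
    show "f holomorphic_on S" unfolding f_def by (rule hol[OF openS]) (auto simp: S_def)
    show "connected S" using convS by (rule convex_connected)
    show "f y = 0" if "y \<in> S \<inter> \<real>" for y
      using that diag by (auto simp: f_def S_def Reals_cnj_iff)
  qed (use openS zeroS lim iS in auto)
  then show ?thesis using z_eq w_eq by (simp add: f_def)
qed

lemma isometric_operatorD:
  assumes "isometric_operator_into_L2 V M T"
  shows "f \<in> V \<Longrightarrow> T f \<in> L2_functions M"
    "f \<in> V \<Longrightarrow> g \<in> V \<Longrightarrow> AE \<xi> in M. T (\<lambda>z. f z + g z) \<xi> = T f \<xi> + T g \<xi>"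
    "f \<in> V \<Longrightarrow> AE \<xi> in M. T (\<lambda>z. c * f z) \<xi> = c * T f \<xi>"
    "f \<in> V \<Longrightarrow> L2_norm M (T f) = hardy_norm f"
  using assms unfolding isometric_operator_into_L2_def by simp_all

section \<open>Integrals of products of Cauchy kernels against the Clark measure\<close>

locale clark =
  fixes I :: "complex^'n \<Rightarrow> complex" and \<alpha> :: complex and \<sigma> :: "(complex^'n) measure"
  assumes inner: "inner_function I"
    and \<alpha>: "norm \<alpha> = 1"
    and clark_measure: "is_clark_measure I \<alpha> \<sigma>"

context clark
begin

lemma sets_clark [measurable_cong]: "sets \<sigma> = sets (restrict_space borel torus)"
  using clark_measure by (simp add: is_clark_measure_def)

lemma space_clark: "space \<sigma> = torus"
  using sets_eq_imp_space_eq[OF sets_clark] by (simp add: space_restrict_space)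

sublocale finite_measure \<sigma>
  using clark_measure by (simp add: is_clark_measure_def)

lemma denominators_nonzero:
  assumes "z \<in> polydisc"
  shows "1 - \<alpha> * cnj (I z) \<noteq> 0" "1 - cnj \<alpha> * I z \<noteq> 0"
  using one_minus_mult_nonzero[of "cnj (I z)" \<alpha>] one_minus_mult_nonzero[of "I z" "cnj \<alpha>"]
    inner_functionD(2)[OF inner assms] \<alpha> by (simp_all add: mult.commute)

definition clark_gram :: "complex^'n \<Rightarrow> complex^'n \<Rightarrow> complex" where
  "clark_gram z w = (\<integral>\<xi>. cauchy_kernel z \<xi> * cauchy_kernel \<xi> w \<partial>\<sigma>)"

text \<open>The value that isometry forces on \<open>clark_gram\<close>: K(z,w) = <K_w, K_z> divided
  by the scalar factors that T attaches to the two kernels.\<close>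

definition gram_formula :: "complex^'n \<Rightarrow> complex^'n \<Rightarrow> complex" where
  "gram_formula z w = (1 - I z * cnj (I w)) / ((1 - \<alpha> * cnj (I w)) * (1 - cnj \<alpha> * I z)) * cauchy_kernel z w"

lemma clark_gram_diagonal:
  assumes z: "z \<in> polydisc"
  shows "clark_gram z z = gram_formula z z"
proof -
  define u where "u = I z"
  have \<alpha>1: "\<alpha> * cnj \<alpha> = 1" using \<alpha> by (simp flip: complex_norm_square)
  have "norm u < 1" unfolding u_def by (rule inner_functionD(2)[OF inner z])
  then have nz: "\<alpha> - u \<noteq> 0" using \<alpha> by auto
  have "clark_gram z z = (\<integral>\<xi>. complex_of_real (poisson_kernel z \<xi>) * cauchy_kernel z z \<partial>\<sigma>)"
    unfolding clark_gram_def by (simp only: poisson_cauchy[OF z])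
  also have "\<dots> = complex_of_real (poisson_integral \<sigma> z) * cauchy_kernel z z"
    by (simp only: integral_mult_left_zero integral_complex_of_real poisson_integral_def)
  also have "poisson_integral \<sigma> z = Re ((\<alpha> + u) / (\<alpha> - u))"
    using clark_measure z by (simp add: is_clark_measure_def u_def)
  also have "complex_of_real (Re ((\<alpha> + u) / (\<alpha> - u)))
      = (1 - u * cnj u) / ((1 - \<alpha> * cnj u) * (1 - cnj \<alpha> * u))"
  proof -
    \<comment> \<open>Because |\<alpha>| = 1, the factors are \<alpha> cnj (\<alpha> - u) and cnj
      \<alpha> (\<alpha> - u), with product |\<alpha> - u|^2.\<close>
    have d: "(1 - \<alpha> * cnj u) * (1 - cnj \<alpha> * u) = (\<alpha> - u) * cnj (\<alpha> - u)"
    proof -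
      have "(1 - \<alpha> * cnj u) * (1 - cnj \<alpha> * u) = 1 - cnj \<alpha> * u - \<alpha> * cnj u + (\<alpha> * cnj \<alpha>) * (u * cnj u)"
        by (simp add: algebra_simps)
      moreover have "(\<alpha> - u) * cnj (\<alpha> - u) = \<alpha> * cnj \<alpha> - cnj \<alpha> * u - \<alpha> * cnj u + u * cnj u"
        by (simp add: algebra_simps)
      ultimately show ?thesis by (simp add: \<alpha>1)
    qed
    have "complex_of_real (Re ((\<alpha> + u) / (\<alpha> - u)))
        = ((\<alpha> + u) / (\<alpha> - u) + cnj ((\<alpha> + u) / (\<alpha> - u))) / 2"
      by (simp only: complex_add_cnj) simp
    also have "\<dots> = ((\<alpha> + u) * cnj (\<alpha> - u) + cnj (\<alpha> + u) * (\<alpha> - u)) / (2 * ((\<alpha> - u) * cnj (\<alpha> - u)))"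
    proof -
      have "cnj (\<alpha> - u) \<noteq> 0" using nz by simp
      then show ?thesis using nz unfolding complex_cnj_divide by (simp add: add_frac_eq del: complex_cnj_diff)
    qed
    also have "(\<alpha> + u) * cnj (\<alpha> - u) + cnj (\<alpha> + u) * (\<alpha> - u) = 2 * (\<alpha> * cnj \<alpha> - u * cnj u)"
      by (simp add: algebra_simps)
    finally show ?thesis
      unfolding d \<alpha>1 by (simp only: mult_divide_mult_cancel_left[OF zero_neq_numeral[symmetric]])
  qed
  finally show ?thesis by (simp add: gram_formula_def u_def)
qed

lemma cauchy_kernel_torus_continuous:
  assumes "w \<in> polydisc"
  shows "continuous_on torus (\<lambda>\<xi>. cauchy_kernel \<xi> w)" "continuous_on torus (\<lambda>\<xi>. cauchy_kernel w \<xi>)"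
  using cauchy_kernel_continuous[OF assms] torus_subset_closed by (auto intro: continuous_on_subset)

text \<open>The first argument enters holomorphically and the second through its conjugate, so along
  \<open>y \<mapsto> (a + y *s b, a + cnj y *s b)\<close> both sides are holomorphic in y and
  polarization applies.\<close>

lemma clark_gram_eq:
  assumes z: "z \<in> polydisc" and w: "w \<in> polydisc"
  shows "clark_gram z w = gram_formula z w"
proof (rule polarization[OF _ clark_gram_diagonal z w])
  fix a b :: "complex^'n" and S :: "complex set"
  assume S: "open S" and Sz: "\<And>y. y \<in> S \<Longrightarrow> a + y *s b \<in> polydisc"
    and Sw: "\<And>y. y \<in> S \<Longrightarrow> a + cnj y *s b \<in> polydisc"
  have holI: "holomorphic_several_on I polydisc" by (rule inner_functionD(1)[OF inner])
  have kernel_l: "cauchy_kernel (a + y *s b) \<xi> = (\<Prod>j\<in>UNIV. 1 / (1 - (a $ j + y * b $ j) * cnj (\<xi> $ j)))" for y \<xi>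
    by (simp add: cauchy_kernel_def)
  have kernel_r: "cauchy_kernel \<xi> (a + cnj y *s b) = (\<Prod>j\<in>UNIV. 1 / (1 - \<xi> $ j * (cnj (a $ j) + y * cnj (b $ j))))" for y \<xi>
    by (simp add: cauchy_kernel_def)
  have nz_l: "1 - (a $ j + y * b $ j) * cnj (\<xi> $ j) \<noteq> 0" if "y \<in> S" "\<xi> \<in> closed_polydisc" for y \<xi> j
    using cauchy_denom_nonzero(2)[OF Sz[OF that(1)] that(2), of j] by simp
  have nz_r: "1 - \<xi> $ j * (cnj (a $ j) + y * cnj (b $ j)) \<noteq> 0" if "y \<in> S" "\<xi> \<in> closed_polydisc" for y \<xi> j
    using cauchy_denom_nonzero(1)[OF Sw[OF that(1)] that(2), of j] by simp
  have tc: "\<xi> \<in> torus \<Longrightarrow> \<xi> \<in> closed_polydisc" for \<xi> :: "complex^'n" using torus_subset_closed by auto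
  have "(\<lambda>y. clark_gram (a + y *s b) (a + cnj y *s b)) holomorphic_on S"
    unfolding clark_gram_def
  proof (rule holomorphic_on_parameter_integral[OF finite_measure_axioms S])
    fix \<xi> assume "\<xi> \<in> space \<sigma>"
    then show "(\<lambda>y. cauchy_kernel (a + y *s b) \<xi> * cauchy_kernel \<xi> (a + cnj y *s b)) holomorphic_on S"
      unfolding kernel_l kernel_r
      by (intro holomorphic_intros holomorphic_on_prod nz_l nz_r) (auto simp: space_clark tc)
  next
    fix y assume y: "y \<in> S"
    show "(\<lambda>\<xi>. cauchy_kernel (a + y *s b) \<xi> * cauchy_kernel \<xi> (a + cnj y *s b)) \<in> borel_measurable \<sigma>"
      by (subst measurable_cong_sets[OF sets_clark refl], rule measurable_on_torus)
        (intro continuous_intros cauchy_kernel_torus_continuous Sz Sw y)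
  next
    fix c r assume sub: "cball c r \<subseteq> S"
    let ?k = "\<lambda>p. cauchy_kernel (a + fst p *s b) (snd p) * cauchy_kernel (snd p) (a + cnj (fst p) *s b)"
    \<comment> \<open>Joint continuity on a compact product gives the bound, uniform in y and \<xi>,
      that the parameter integral asks for.\<close>
    have "continuous_on (cball c r \<times> torus) ?k"
      unfolding kernel_l kernel_r
      by (intro continuous_intros continuous_on_prod) (use sub nz_l nz_r tc in auto)
    then have "bounded (?k ` (cball c r \<times> torus))"
      by (intro compact_imp_bounded compact_continuous_image compact_Times compact_cball compact_torus)
    then obtain B where B: "\<forall>x\<in>?k ` (cball c r \<times> torus). norm x \<le> B"
      unfolding bounded_iff by blast
    have "\<forall>y\<in>cball c r. \<forall>\<xi>\<in>space \<sigma>.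
        norm (cauchy_kernel (a + y *s b) \<xi> * cauchy_kernel \<xi> (a + cnj y *s b)) \<le> B"
    proof (intro ballI)
      fix y \<xi> assume "y \<in> cball c r" "\<xi> \<in> space \<sigma>"
      then have "?k (y, \<xi>) \<in> ?k ` (cball c r \<times> torus)"
        by (intro imageI) (simp add: space_clark)
      with B show "norm (cauchy_kernel (a + y *s b) \<xi> * cauchy_kernel \<xi> (a + cnj y *s b)) \<le> B"
        by fastforce
    qed
    then show "\<exists>B. \<forall>y\<in>cball c r. \<forall>\<xi>\<in>space \<sigma>.
        norm (cauchy_kernel (a + y *s b) \<xi> * cauchy_kernel \<xi> (a + cnj y *s b)) \<le> B" ..
  qed
  moreover have "(\<lambda>y. gram_formula (a + y *s b) (a + cnj y *s b)) holomorphic_on S"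
  proof -
    have Iz: "(\<lambda>y. I (a + y *s b)) holomorphic_on S"
      by (rule holomorphic_on_line[OF holI Sz])
    \<comment> \<open>Reflection: conjugating both the argument and the value of a holomorphic
      function on the mirrored domain gives a holomorphic function.\<close>
    have "(\<lambda>y. I (a + y *s b)) holomorphic_on cnj ` S"
      by (rule holomorphic_on_line[OF holI]) (auto intro: Sw)
    then have Iw: "(\<lambda>y. cnj (I (a + cnj y *s b))) holomorphic_on S"
      using holomorphic_on_compose_cnj_cnj[of "\<lambda>y. I (a + y *s b)" S] S by (simp add: o_def)
    have "a + y *s b \<in> closed_polydisc" if "y \<in> S" for y
      using Sz[OF that] polydisc_subset_closed by auto
    from nz_r[OF _ this] have nz: "1 - (a + y *s b) $ j * (cnj (a $ j) + y * cnj (b $ j)) \<noteq> 0" if "y \<in> S" for y j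
      using that by blast
    have K: "(\<lambda>y. cauchy_kernel (a + y *s b) (a + cnj y *s b)) holomorphic_on S"
      unfolding kernel_r using nz by (auto intro!: holomorphic_intros holomorphic_on_prod)
    show ?thesis
      unfolding gram_formula_def
      by (intro holomorphic_intros Iz Iw K) (use denominators_nonzero Sz Sw in auto)
  qed
  ultimately show "(\<lambda>y. clark_gram (a + y *s b) (a + cnj y *s b) - gram_formula (a + y *s b) (a + cnj y *s b)) holomorphic_on S"
    by (rule holomorphic_on_diff)
qed

section \<open>Isometry on finite combinations of kernels\<close>

definition clark_kernel :: "complex^'n \<Rightarrow> complex^'n \<Rightarrow> complex" where
  "clark_kernel w = (\<lambda>\<xi>. (1 - \<alpha> * cnj (I w)) * cauchy_kernel \<xi> w)"

fun clark_comb :: "(complex \<times> (complex^'n)) list \<Rightarrow> complex^'n \<Rightarrow> complex" where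
  "clark_comb [] = (\<lambda>\<xi>. 0)"
| "clark_comb ((c, w) # L) = (\<lambda>\<xi>. c * clark_kernel w \<xi> + clark_comb L \<xi>)"

lemma clark_comb_append: "clark_comb (L @ M) \<xi> = clark_comb L \<xi> + clark_comb M \<xi>"
  by (induction L) auto

lemma clark_comb_scale: "clark_comb (scale_list a L) \<xi> = a * clark_comb L \<xi>"
  by (induction L) (auto simp: scale_list_def distrib_left mult.assoc)

lemma clark_kernel_L2:
  assumes "w \<in> polydisc"
  shows "clark_kernel w \<in> L2_functions \<sigma>"
  unfolding clark_kernel_def
  by (rule L2_cmult[OF L2_on_torus[OF cauchy_kernel_torus_continuous(1)[OF assms] finite_measure_axioms sets_clark]])

lemma clark_comb_L2: "polydisc_list L \<Longrightarrow> clark_comb L \<in> L2_functions \<sigma>"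
proof (induction L)
  case Nil
  then show ?case using L2_const[of 0] by simp
next
  case (Cons p L)
  obtain c w where p: "p = (c, w)" by (cases p)
  with Cons.prems have "w \<in> polydisc" "polydisc_list L" by auto
  then show ?case
    unfolding p clark_comb.simps using Cons.IH by (intro L2_add L2_cmult clark_kernel_L2)
qed

text \<open>Mind the order: conjugating the second Cauchy kernel gives C(w,\<xi>), so the integral
  is \<open>clark_gram w v\<close>, and it corresponds to K_v(w) = <K_v, K_w>.\<close>

lemma clark_kernel_inner:
  assumes v: "v \<in> polydisc" and w: "w \<in> polydisc"
  shows "L2_inner \<sigma> (clark_kernel v) (clark_kernel w) = hardy_inner (model_kernel I v) (model_kernel I w)"
proof -
  have "L2_inner \<sigma> (clark_kernel v) (clark_kernel w)
      = (\<integral>\<xi>. ((1 - \<alpha> * cnj (I v)) * (1 - cnj \<alpha> * I w)) * (cauchy_kernel w \<xi> * cauchy_kernel \<xi> v) \<partial>\<sigma>)"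
    unfolding L2_inner_def clark_kernel_def
    by (intro Bochner_Integration.integral_cong refl) (simp add: cauchy_kernel_cnj mult_ac)
  also have "\<dots> = ((1 - \<alpha> * cnj (I v)) * (1 - cnj \<alpha> * I w)) * gram_formula w v"
    by (simp only: integral_mult_right_zero clark_gram_def[symmetric] clark_gram_eq[OF w v])
  also have "\<dots> = model_kernel I v w"
    using denominators_nonzero[OF v] denominators_nonzero[OF w]
    by (simp add: gram_formula_def model_kernel_def)
  also have "\<dots> = hardy_inner (model_kernel I v) (model_kernel I w)"
    by (rule model_kernel_reproducing[symmetric, OF inner model_kernel_in_model_space[OF inner v] w])
  finally show ?thesis .
qed

lemma kernel_comb_hardy: "polydisc_list L \<Longrightarrow> kernel_comb I L \<in> hardy_space"
  by (rule model_space_hardy[OF kernel_comb_model_space[OF inner]])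

lemma model_kernel_hardy: "w \<in> polydisc \<Longrightarrow> model_kernel I w \<in> hardy_space"
  by (rule model_space_hardy[OF model_kernel_in_model_space[OF inner]])

lemma clark_comb_inner_left:
  assumes v: "v \<in> polydisc"
  shows "polydisc_list M \<Longrightarrow> L2_inner \<sigma> (clark_comb M) (clark_kernel v)
    = hardy_inner (kernel_comb I M) (model_kernel I v)"
proof (induction M)
  case Nil
  show ?case
    using L2_inner_cmult_left[of \<sigma> 0 "\<lambda>_. 0"] hardy_inner_cmult_left[OF hardy_one model_kernel_hardy[OF v], of 0]
    by simp
next
  case (Cons p M)
  obtain c w where p: "p = (c, w)" by (cases p)
  with Cons.prems have w: "w \<in> polydisc" and M: "polydisc_list M" by auto
  note K = model_kernel_hardy[OF w] and Kv = model_kernel_hardy[OF v]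
  show ?case
    unfolding p clark_comb.simps kernel_comb.simps
      L2_inner_add_left[OF L2_cmult[OF clark_kernel_L2[OF w]] clark_comb_L2[OF M] clark_kernel_L2[OF v]]
      hardy_inner_add_left[OF hardy_cmult[OF K] kernel_comb_hardy[OF M] Kv]
      L2_inner_cmult_left hardy_inner_cmult_left[OF K Kv] clark_kernel_inner[OF w v] Cons.IH[OF M] ..
qed

lemma clark_comb_inner:
  assumes M: "polydisc_list M"
  shows "polydisc_list L \<Longrightarrow> L2_inner \<sigma> (clark_comb M) (clark_comb L)
    = hardy_inner (kernel_comb I M) (kernel_comb I L)"
proof (induction L)
  case Nil
  show ?case
    using L2_inner_cmult_right[of \<sigma> _ 0 "\<lambda>_. 0"] hardy_inner_cmult_right[OF hardy_one kernel_comb_hardy[OF M], of 0]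
    by simp
next
  case (Cons p L)
  obtain c w where p: "p = (c, w)" by (cases p)
  with Cons.prems have w: "w \<in> polydisc" and L: "polydisc_list L" by auto
  note K = model_kernel_hardy[OF w] and KM = kernel_comb_hardy[OF M]
  show ?case
    unfolding p clark_comb.simps kernel_comb.simps
      L2_inner_add_right[OF L2_cmult[OF clark_kernel_L2[OF w]] clark_comb_L2[OF L] clark_comb_L2[OF M]]
      hardy_inner_add_right[OF hardy_cmult[OF K] kernel_comb_hardy[OF L] KM]
      L2_inner_cmult_right hardy_inner_cmult_right[OF K KM] clark_comb_inner_left[OF w M] Cons.IH[OF L] ..
qed

text \<open>Stated for formal combinations, it also shows that the map is well defined: a linear
  relation among the K_w is one among their images, almost everywhere.\<close>

lemma clark_comb_isometry:
  assumes "polydisc_list L"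
  shows "L2_norm \<sigma> (clark_comb L) = hardy_norm (kernel_comb I L)"
proof -
  have "complex_of_real ((L2_norm \<sigma> (clark_comb L))\<^sup>2) = complex_of_real ((hardy_norm (kernel_comb I L))\<^sup>2)"
    using clark_comb_inner[OF assms assms] by (simp only: L2_inner_self hardy_inner_self)
  then have "(L2_norm \<sigma> (clark_comb L))\<^sup>2 = (hardy_norm (kernel_comb I L))\<^sup>2"
    by (simp only: of_real_eq_iff)
  then show ?thesis by simp
qed

text \<open>Closure in H^2 \<times> L^2(\<sigma>) of the graph of the map on kernel combinations. As
  a relation it needs no choice of representatives, and sums and multiples can be handled at the
  level of pairs.\<close>

definition clark_graph :: "(complex^'n \<Rightarrow> complex) \<Rightarrow> (complex^'n \<Rightarrow> complex) \<Rightarrow> bool" where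
  "clark_graph f g \<longleftrightarrow> g \<in> L2_functions \<sigma> \<and> (\<forall>e>0. \<exists>L. polydisc_list L \<and>
     hardy_norm (\<lambda>z. f z - kernel_comb I L z) < e \<and> L2_norm \<sigma> (\<lambda>\<xi>. g \<xi> - clark_comb L \<xi>) < e)"

text \<open>Images of combinations converging to f form a Cauchy sequence by the isometry, and
  L^2(\<sigma>) is complete.\<close>

lemma clark_graph_exists:
  assumes f: "f \<in> model_space I"
  shows "\<exists>g. clark_graph f g"
proof -
  have "\<exists>L. polydisc_list L \<and> hardy_norm (\<lambda>z. f z - kernel_comb I L z) < 1 / real (Suc n)" for n
    by (rule kernel_comb_dense[OF inner f]) simp
  then obtain L where L: "\<And>n. polydisc_list (L n)"
    "\<And>n. hardy_norm (\<lambda>z. f z - kernel_comb I (L n) z) < 1 / real (Suc n)" by metis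
  note fH = model_space_hardy[OF f]
  have diff: "L2_norm \<sigma> (\<lambda>\<xi>. clark_comb (L m) \<xi> - clark_comb (L n) \<xi>) < 1 / real (Suc m) + 1 / real (Suc n)" for m n
  proof -
    \<comment> \<open>The difference is written as one combination, so that its norm can be computed
      in H^2.\<close>
    define M where "M = L m @ scale_list (-1) (L n)"
    have M: "polydisc_list M" using L by (simp add: M_def)
    have "L2_norm \<sigma> (\<lambda>\<xi>. clark_comb (L m) \<xi> - clark_comb (L n) \<xi>) = L2_norm \<sigma> (clark_comb M)"
      by (rule arg_cong[where f="L2_norm \<sigma>"]) (simp add: M_def clark_comb_append clark_comb_scale fun_eq_iff)
    also have "\<dots> = hardy_norm (kernel_comb I M)" by (rule clark_comb_isometry[OF M])
    also have "kernel_comb I M = (\<lambda>z. (kernel_comb I (L m) z - f z) + (f z - kernel_comb I (L n) z))"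
      by (simp add: M_def kernel_comb_append kernel_comb_scale fun_eq_iff)
    also have "hardy_norm \<dots> \<le> hardy_norm (\<lambda>z. kernel_comb I (L m) z - f z) + hardy_norm (\<lambda>z. f z - kernel_comb I (L n) z)"
      by (intro hardy_norm_triangle hardy_diff kernel_comb_hardy L fH)
    also have "hardy_norm (\<lambda>z. kernel_comb I (L m) z - f z) = hardy_norm (\<lambda>z. f z - kernel_comb I (L m) z)"
      by (rule hardy_norm_diff_commute[OF kernel_comb_hardy[OF L(1)] fH])
    finally show ?thesis using L(2)[of m] L(2)[of n] by linarith
  qed
  have "\<exists>g\<in>L2_functions \<sigma>. (\<lambda>n. L2_norm \<sigma> (\<lambda>\<xi>. g \<xi> - clark_comb (L n) \<xi>)) \<longlonglongrightarrow> 0"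
  proof (rule L2_complete)
    fix e :: real assume e: "e > 0"
    obtain N where N: "1 / real (Suc N) < e / 2"
      using e by (metis nat_approx_posE half_gt_zero)
    have "L2_norm \<sigma> (\<lambda>\<xi>. clark_comb (L m) \<xi> - clark_comb (L n) \<xi>) < e" if "m \<ge> N" "n \<ge> N" for m n
    proof -
      have "1 / real (Suc m) \<le> 1 / real (Suc N)" "1 / real (Suc n) \<le> 1 / real (Suc N)"
        using that by (auto intro!: frac_le)
      then show ?thesis using diff[of m n] N by linarith
    qed
    then show "\<exists>N. \<forall>m\<ge>N. \<forall>n\<ge>N. L2_norm \<sigma> (\<lambda>\<xi>. clark_comb (L m) \<xi> - clark_comb (L n) \<xi>) < e" by blast
  qed (use clark_comb_L2 L in auto)
  then obtain g where g: "g \<in> L2_functions \<sigma>" "(\<lambda>n. L2_norm \<sigma> (\<lambda>\<xi>. g \<xi> - clark_comb (L n) \<xi>)) \<longlonglongrightarrow> 0" by blast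
  have "clark_graph f g"
    unfolding clark_graph_def
  proof (intro conjI allI impI g(1))
    fix e :: real assume e: "e > 0"
    have "(\<lambda>n. 1 / real (Suc n)) \<longlonglongrightarrow> 0" by (intro LIMSEQ_Suc lim_1_over_n)
    from order_tendstoD(2)[OF this e] order_tendstoD(2)[OF g(2) e]
    have "eventually (\<lambda>n. 1 / real (Suc n) < e \<and> L2_norm \<sigma> (\<lambda>\<xi>. g \<xi> - clark_comb (L n) \<xi>) < e) sequentially"
      by (rule eventually_conj)
    then obtain n where "1 / real (Suc n) < e" "L2_norm \<sigma> (\<lambda>\<xi>. g \<xi> - clark_comb (L n) \<xi>) < e"
      by (auto dest!: eventually_happens)
    then show "\<exists>L. polydisc_list L \<and> hardy_norm (\<lambda>z. f z - kernel_comb I L z) < e \<and>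
        L2_norm \<sigma> (\<lambda>\<xi>. g \<xi> - clark_comb L \<xi>) < e"
      using L[of n] by (intro exI[of _ "L n"]) auto
  qed
  then show ?thesis by blast
qed

lemma clark_graph_norm:
  assumes f: "f \<in> hardy_space" and G: "clark_graph f g"
  shows "L2_norm \<sigma> g = hardy_norm f"
proof -
  have gL: "g \<in> L2_functions \<sigma>" using G by (simp add: clark_graph_def)
  \<comment> \<open>f is within e of a combination and g within e of its image, and these two have
    equal norms.\<close>
  have close: "\<bar>L2_norm \<sigma> g - hardy_norm f\<bar> \<le> 2 * e" if e: "e > 0" for e
  proof -
    obtain L where L: "polydisc_list L" "hardy_norm (\<lambda>z. f z - kernel_comb I L z) < e"
      "L2_norm \<sigma> (\<lambda>\<xi>. g \<xi> - clark_comb L \<xi>) < e"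
      using G e unfolding clark_graph_def by blast
    note K = kernel_comb_hardy[OF L(1)] and C = clark_comb_L2[OF L(1)]
    have "hardy_norm (\<lambda>z. (f z - kernel_comb I L z) + kernel_comb I L z)
        \<le> hardy_norm (\<lambda>z. f z - kernel_comb I L z) + hardy_norm (kernel_comb I L)"
      by (intro hardy_norm_triangle hardy_diff f K)
    moreover have "hardy_norm (\<lambda>z. (kernel_comb I L z - f z) + f z)
        \<le> hardy_norm (\<lambda>z. kernel_comb I L z - f z) + hardy_norm f"
      by (intro hardy_norm_triangle hardy_diff f K)
    moreover have "L2_norm \<sigma> (\<lambda>\<xi>. (g \<xi> - clark_comb L \<xi>) + clark_comb L \<xi>)
        \<le> L2_norm \<sigma> (\<lambda>\<xi>. g \<xi> - clark_comb L \<xi>) + L2_norm \<sigma> (clark_comb L)"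
      by (intro L2_triangle L2_diff gL C)
    moreover have "L2_norm \<sigma> (\<lambda>\<xi>. (clark_comb L \<xi> - g \<xi>) + g \<xi>)
        \<le> L2_norm \<sigma> (\<lambda>\<xi>. clark_comb L \<xi> - g \<xi>) + L2_norm \<sigma> g"
      by (intro L2_triangle L2_diff gL C)
    ultimately show ?thesis
      using L(2,3) clark_comb_isometry[OF L(1)] hardy_norm_diff_commute[OF f K]
        L2_norm_diff_commute[of \<sigma> g "clark_comb L"] by simp
  qed
  have "\<bar>L2_norm \<sigma> g - hardy_norm f\<bar> \<le> 0"
  proof (rule field_le_epsilon)
    fix e :: real assume "e > 0"
    then show "\<bar>L2_norm \<sigma> g - hardy_norm f\<bar> \<le> 0 + e" using close[of "e/2"] by simp
  qed
  then show ?thesis by simp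
qed

lemma clark_graph_add:
  assumes f: "f \<in> hardy_space" and f': "f' \<in> hardy_space"
    and G: "clark_graph f g" and G': "clark_graph f' g'"
  shows "clark_graph (\<lambda>z. f z + f' z) (\<lambda>\<xi>. g \<xi> + g' \<xi>)"
  unfolding clark_graph_def
proof (intro conjI allI impI)
  have gL: "g \<in> L2_functions \<sigma>" "g' \<in> L2_functions \<sigma>" using G G' by (auto simp: clark_graph_def)
  show "(\<lambda>\<xi>. g \<xi> + g' \<xi>) \<in> L2_functions \<sigma>" by (intro L2_add gL)
  fix e :: real assume "e > 0"
  then have e: "e / 2 > 0" by simp
  obtain L where L: "polydisc_list L" "hardy_norm (\<lambda>z. f z - kernel_comb I L z) < e / 2"
    "L2_norm \<sigma> (\<lambda>\<xi>. g \<xi> - clark_comb L \<xi>) < e / 2"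
    using G e unfolding clark_graph_def by blast
  obtain M where M: "polydisc_list M" "hardy_norm (\<lambda>z. f' z - kernel_comb I M z) < e / 2"
    "L2_norm \<sigma> (\<lambda>\<xi>. g' \<xi> - clark_comb M \<xi>) < e / 2"
    using G' e unfolding clark_graph_def by blast
  have "(\<lambda>z. (f z + f' z) - kernel_comb I (L @ M) z)
      = (\<lambda>z. (f z - kernel_comb I L z) + (f' z - kernel_comb I M z))"
    by (simp add: kernel_comb_append fun_eq_iff)
  then have 1: "hardy_norm (\<lambda>z. (f z + f' z) - kernel_comb I (L @ M) z)
      \<le> hardy_norm (\<lambda>z. f z - kernel_comb I L z) + hardy_norm (\<lambda>z. f' z - kernel_comb I M z)"
    using hardy_norm_triangle[OF hardy_diff[OF f kernel_comb_hardy[OF L(1)]] hardy_diff[OF f' kernel_comb_hardy[OF M(1)]]]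
    by simp
  have "(\<lambda>\<xi>. (g \<xi> + g' \<xi>) - clark_comb (L @ M) \<xi>)
      = (\<lambda>\<xi>. (g \<xi> - clark_comb L \<xi>) + (g' \<xi> - clark_comb M \<xi>))"
    by (simp add: clark_comb_append fun_eq_iff)
  then have 2: "L2_norm \<sigma> (\<lambda>\<xi>. (g \<xi> + g' \<xi>) - clark_comb (L @ M) \<xi>)
      \<le> L2_norm \<sigma> (\<lambda>\<xi>. g \<xi> - clark_comb L \<xi>) + L2_norm \<sigma> (\<lambda>\<xi>. g' \<xi> - clark_comb M \<xi>)"
    using L2_triangle[OF L2_diff[OF gL(1) clark_comb_L2[OF L(1)]] L2_diff[OF gL(2) clark_comb_L2[OF M(1)]]]
    by simp
  show "\<exists>L. polydisc_list L \<and> hardy_norm (\<lambda>z. (f z + f' z) - kernel_comb I L z) < e \<and>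
     L2_norm \<sigma> (\<lambda>\<xi>. (g \<xi> + g' \<xi>) - clark_comb L \<xi>) < e"
    by (intro exI[of _ "L @ M"] conjI) (use 1 2 L M in simp_all)
qed

lemma clark_graph_cmult:
  assumes f: "f \<in> hardy_space" and G: "clark_graph f g"
  shows "clark_graph (\<lambda>z. c * f z) (\<lambda>\<xi>. c * g \<xi>)"
  unfolding clark_graph_def
proof (intro conjI allI impI)
  have gL: "g \<in> L2_functions \<sigma>" using G by (simp add: clark_graph_def)
  show "(\<lambda>\<xi>. c * g \<xi>) \<in> L2_functions \<sigma>" by (intro L2_cmult gL)
  fix e :: real assume e: "e > 0"
  \<comment> \<open>The summand 1 keeps the quotient meaningful for c = 0.\<close>
  define d where "d = e / (norm c + 1)"
  have d: "d > 0" using e by (simp add: d_def add_nonneg_pos)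
  have cd: "norm c * d < e"
  proof -
    have "norm c * d < (norm c + 1) * d" using d by (simp add: distrib_right)
    also have "\<dots> = e" by (simp add: d_def add_nonneg_pos[THEN less_imp_neq, symmetric])
    finally show ?thesis .
  qed
  obtain L where L: "polydisc_list L" "hardy_norm (\<lambda>z. f z - kernel_comb I L z) < d"
    "L2_norm \<sigma> (\<lambda>\<xi>. g \<xi> - clark_comb L \<xi>) < d"
    using G d unfolding clark_graph_def by blast
  have small: "norm c * hardy_norm (\<lambda>z. f z - kernel_comb I L z) < e"
      "norm c * L2_norm \<sigma> (\<lambda>\<xi>. g \<xi> - clark_comb L \<xi>) < e"
    using L(2,3) by (auto intro!: le_less_trans[OF mult_left_mono cd])
  have "(\<lambda>z. c * f z - kernel_comb I (scale_list c L) z) = (\<lambda>z. c * (f z - kernel_comb I L z))"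
    by (simp add: kernel_comb_scale fun_eq_iff algebra_simps)
  then have 1: "hardy_norm (\<lambda>z. c * f z - kernel_comb I (scale_list c L) z) < e"
    using hardy_norm_cmult[OF hardy_diff[OF f kernel_comb_hardy[OF L(1)]], of c] small(1) by simp
  have "(\<lambda>\<xi>. c * g \<xi> - clark_comb (scale_list c L) \<xi>) = (\<lambda>\<xi>. c * (g \<xi> - clark_comb L \<xi>))"
    by (simp add: clark_comb_scale fun_eq_iff algebra_simps)
  then have 2: "L2_norm \<sigma> (\<lambda>\<xi>. c * g \<xi> - clark_comb (scale_list c L) \<xi>) < e"
    using L2_norm_cmult[of \<sigma> c "\<lambda>\<xi>. g \<xi> - clark_comb L \<xi>"] small(2) by simp
  show "\<exists>L. polydisc_list L \<and> hardy_norm (\<lambda>z. c * f z - kernel_comb I L z) < e \<and>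
     L2_norm \<sigma> (\<lambda>\<xi>. c * g \<xi> - clark_comb L \<xi>) < e"
    by (intro exI[of _ "scale_list c L"] conjI) (use 1 2 L in simp_all)
qed

text \<open>Subtracting the pairs relates the zero function to g - g', whose norm is then 0 because
  the closed graph is still isometric.\<close>

lemma clark_graph_unique:
  assumes f: "f \<in> hardy_space" and G: "clark_graph f g" and G': "clark_graph f g'"
  shows "AE \<xi> in \<sigma>. g \<xi> = g' \<xi>"
proof -
  have "clark_graph (\<lambda>z. f z + (-1) * f z) (\<lambda>\<xi>. g \<xi> + (-1) * g' \<xi>)"
    by (intro clark_graph_add clark_graph_cmult hardy_cmult f G G')
  then have "L2_norm \<sigma> (\<lambda>\<xi>. g \<xi> + (-1) * g' \<xi>) = hardy_norm (\<lambda>z. f z + (-1) * f z)"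
    by (intro clark_graph_norm hardy_add hardy_cmult f)
  also have "\<dots> = 0" using hardy_norm_cmult[OF f, of 0] by simp
  finally have "L2_norm \<sigma> (\<lambda>\<xi>. g \<xi> - g' \<xi>) = 0" by simp
  moreover have "(\<lambda>\<xi>. g \<xi> - g' \<xi>) \<in> L2_functions \<sigma>"
    using G G' by (intro L2_diff) (auto simp: clark_graph_def)
  ultimately have "AE \<xi> in \<sigma>. g \<xi> - g' \<xi> = 0" by (intro L2_norm_eq_0_AE)
  then show ?thesis by simp
qed

lemma clark_graph_kernel:
  assumes w: "w \<in> polydisc"
  shows "clark_graph (model_kernel I w) (clark_kernel w)"
  unfolding clark_graph_def
proof (intro conjI allI impI clark_kernel_L2 w)
  fix e :: real assume e: "e > 0"
  have "hardy_norm (\<lambda>z::complex^'n. 0) = 0" using hardy_norm_cmult[OF hardy_one, of 0] by simp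
  then show "\<exists>L. polydisc_list L \<and> hardy_norm (\<lambda>z. model_kernel I w z - kernel_comb I L z) < e \<and>
     L2_norm \<sigma> (\<lambda>\<xi>. clark_kernel w \<xi> - clark_comb L \<xi>) < e"
    using e w by (intro exI[of _ "[(1, w)]"]) (simp add: L2_norm_def)
qed

section \<open>Existence and uniqueness of the extension\<close>

lemma clark_operator_comb:
  assumes T: "isometric_operator_into_L2 (model_space I) \<sigma> T" "extends_kernel_map I \<alpha> \<sigma> T"
  shows "polydisc_list L \<Longrightarrow> AE \<xi> in \<sigma>. T (kernel_comb I L) \<xi> = clark_comb L \<xi>"
proof (induction L)
  case Nil
  \<comment> \<open>The zero function is presented as 0 times a kernel, so that homogeneity of T
    determines its image.\<close>
  have "0 \<in> (polydisc :: (complex^'n) set)" by (simp add: polydisc_def)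
  then have "model_kernel I 0 \<in> model_space I" by (rule model_kernel_in_model_space[OF inner])
  then have "AE \<xi> in \<sigma>. T (\<lambda>z. 0 * model_kernel I 0 z) \<xi> = 0 * T (model_kernel I 0) \<xi>"
    by (rule isometric_operatorD(3)[OF T(1)])
  then show ?case by simp
next
  case (Cons p L)
  obtain c w where p: "p = (c, w)" by (cases p)
  with Cons.prems have w: "w \<in> polydisc" and L: "polydisc_list L" by auto
  note K = model_kernel_in_model_space[OF inner w] and KL = kernel_comb_model_space[OF inner L]
  have "AE \<xi> in \<sigma>. T (\<lambda>z. c * model_kernel I w z + kernel_comb I L z) \<xi>
      = T (\<lambda>z. c * model_kernel I w z) \<xi> + T (kernel_comb I L) \<xi>"
    by (rule isometric_operatorD(2)[OF T(1) model_space_cmult[OF inner K] KL])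
  moreover have "AE \<xi> in \<sigma>. T (\<lambda>z. c * model_kernel I w z) \<xi> = c * T (model_kernel I w) \<xi>"
    by (rule isometric_operatorD(3)[OF T(1) K])
  moreover have "AE \<xi> in \<sigma>. T (model_kernel I w) \<xi> = clark_kernel w \<xi>"
    using T(2) w unfolding extends_kernel_map_def clark_kernel_def by blast
  ultimately show ?case
    using Cons.IH[OF L] unfolding p clark_comb.simps kernel_comb.simps
    by eventually_elim simp
qed

text \<open>T f minus the image of a combination is T of the difference almost everywhere, so by
  isometry a combination close to f has its image equally close to T f. Uniqueness of T thus reduces
  to \<open>clark_graph_unique\<close>.\<close>

lemma clark_operator_graph:
  assumes T: "isometric_operator_into_L2 (model_space I) \<sigma> T" "extends_kernel_map I \<alpha> \<sigma> T"
    and f: "f \<in> model_space I"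
  shows "clark_graph f (T f)"
  unfolding clark_graph_def
proof (intro conjI allI impI)
  note TL = isometric_operatorD(1)[OF T(1)]
  show "T f \<in> L2_functions \<sigma>" by (rule TL[OF f])
  fix e :: real assume "e > 0"
  then obtain L where L: "polydisc_list L" "hardy_norm (\<lambda>z. f z - kernel_comb I L z) < e"
    using kernel_comb_dense[OF inner f] by blast
  note K = kernel_comb_model_space[OF inner L(1)]
  note mK = model_space_cmult[OF inner K, of "-1"]
  have "AE \<xi> in \<sigma>. T (\<lambda>z. f z + (-1) * kernel_comb I L z) \<xi> = T f \<xi> + T (\<lambda>z. (-1) * kernel_comb I L z) \<xi>"
    by (rule isometric_operatorD(2)[OF T(1) f mK])
  moreover have "AE \<xi> in \<sigma>. T (\<lambda>z. (-1) * kernel_comb I L z) \<xi> = (-1) * T (kernel_comb I L) \<xi>"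
    by (rule isometric_operatorD(3)[OF T(1) K])
  ultimately have "AE \<xi> in \<sigma>. T f \<xi> - clark_comb L \<xi> = T (\<lambda>z. f z + (-1) * kernel_comb I L z) \<xi>"
    using clark_operator_comb[OF T L(1)] by eventually_elim simp
  then have "L2_norm \<sigma> (\<lambda>\<xi>. T f \<xi> - clark_comb L \<xi>) = L2_norm \<sigma> (T (\<lambda>z. f z + (-1) * kernel_comb I L z))"
    using L2_diff[OF TL[OF f] clark_comb_L2[OF L(1)]] TL[OF model_space_add[OF inner f mK]]
    by (intro L2_norm_cong_AE) (auto simp: L2_functions_def)
  also have "\<dots> = hardy_norm (\<lambda>z. f z + (-1) * kernel_comb I L z)"
    by (rule isometric_operatorD(4)[OF T(1) model_space_add[OF inner f mK]])
  also have "\<dots> < e" using L(2) by simp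
  finally show "\<exists>L. polydisc_list L \<and> hardy_norm (\<lambda>z. f z - kernel_comb I L z) < e \<and>
     L2_norm \<sigma> (\<lambda>\<xi>. T f \<xi> - clark_comb L \<xi>) < e"
    using L by blast
qed

lemma clark_operator_exists_unique:
  "\<exists>T. isometric_operator_into_L2 (model_space I) \<sigma> T \<and> extends_kernel_map I \<alpha> \<sigma> T \<and>
     (\<forall>T'. isometric_operator_into_L2 (model_space I) \<sigma> T' \<and> extends_kernel_map I \<alpha> \<sigma> T' \<longrightarrow>
        (\<forall>f\<in>model_space I. AE \<xi> in \<sigma>. T' f \<xi> = T f \<xi>))"
proof -
  \<comment> \<open>An arbitrary representative for each f: sums and multiples are again related to
    their images, so uniqueness in the graph makes T linear up to null sets.\<close>
  define T where "T f = (SOME g. clark_graph f g)" for f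
  have T: "clark_graph f (T f)" if "f \<in> model_space I" for f
    unfolding T_def using clark_graph_exists[OF that] by (rule someI_ex)
  note H = model_space_hardy
  have "isometric_operator_into_L2 (model_space I) \<sigma> T"
    unfolding isometric_operator_into_L2_def
  proof (intro conjI ballI allI)
    fix f assume f: "f \<in> model_space I"
    show "T f \<in> L2_functions \<sigma>" using T[OF f] by (simp add: clark_graph_def)
    show "L2_norm \<sigma> (T f) = hardy_norm f" by (rule clark_graph_norm[OF H[OF f] T[OF f]])
    show "AE \<xi> in \<sigma>. T (\<lambda>z. c * f z) \<xi> = c * T f \<xi>" for c
      by (rule clark_graph_unique[OF hardy_cmult[OF H[OF f]] T[OF model_space_cmult[OF inner f]]
          clark_graph_cmult[OF H[OF f] T[OF f]]])
    fix g assume g: "g \<in> model_space I"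
    show "AE \<xi> in \<sigma>. T (\<lambda>z. f z + g z) \<xi> = T f \<xi> + T g \<xi>"
      by (rule clark_graph_unique[OF hardy_add[OF H[OF f] H[OF g]] T[OF model_space_add[OF inner f g]]
          clark_graph_add[OF H[OF f] H[OF g] T[OF f] T[OF g]]])
  qed
  moreover have "extends_kernel_map I \<alpha> \<sigma> T"
    unfolding extends_kernel_map_def
  proof
    fix w :: "complex^'n" assume w: "w \<in> polydisc"
    note K = model_kernel_in_model_space[OF inner w]
    from clark_graph_unique[OF H[OF K] T[OF K] clark_graph_kernel[OF w]]
    show "AE \<xi> in \<sigma>. T (model_kernel I w) \<xi> = (1 - \<alpha> * cnj (I w)) * cauchy_kernel \<xi> w"
      by (simp add: clark_kernel_def)
  qed
  moreover have "AE \<xi> in \<sigma>. T' f \<xi> = T f \<xi>"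
    if "isometric_operator_into_L2 (model_space I) \<sigma> T'" "extends_kernel_map I \<alpha> \<sigma> T'" "f \<in> model_space I" for T' f
    by (rule clark_graph_unique[OF H[OF that(3)] clark_operator_graph[OF that] T[OF that(3)]])
  ultimately show ?thesis by blast
qed

end

theorem theorem3p1:
  fixes I :: "complex^'n \<Rightarrow> complex" and \<alpha> :: complex and \<sigma> :: "(complex^'n) measure"
  assumes "CARD('n) \<ge> 2"
    and "inner_function I"
    and "norm \<alpha> = 1"
    and "is_clark_measure I \<alpha> \<sigma>"
  shows "\<exists>T. isometric_operator_into_L2 (model_space I) \<sigma> T \<and> extends_kernel_map I \<alpha> \<sigma> T \<and>
           (\<forall>T'. isometric_operator_into_L2 (model_space I) \<sigma> T' \<and> extends_kernel_map I \<alpha> \<sigma> T' \<longrightarrow>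
              (\<forall>f\<in>model_space I. AE \<xi> in \<sigma>. T' f \<xi> = T f \<xi>))"
proof -
  interpret clark I \<alpha> \<sigma> using assms(2-4) by unfold_locales
  show ?thesis by (rule clark_operator_exists_unique)
qed

end
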